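(* There is an algorithm for describing all integer solutions to any three-monomial Diophantine equation that can be written in the form $$a \prod_{i=1}^n x_i^{\alpha_i} + b \prod_{i=1}^n x_i^{\beta_i} = c \prod_{i=1}^n x_i^{\gamma_i},$$ where $x_1,\dots,x_n$ are variables, $\alpha_i,\beta_i,\gamma_i$ are non-negative integers and $a,b,c$ are non-zero integers, in such a way that the system $$\sum_{i=1}^n \alpha_i z_i = \sum_{i=1}^n \beta_i z_i = \sum_{i=1}^n \gamma_i z_i - 1, \qquad z_i \geq 0,\quad i=1,\dots,n,$$ is solvable in non-negative integers $z_1,\dots,z_n$.
   Context: Each three-monomial equation can be written in the displayed form in three ways, according to which monomial is placed on the right-hand side; the hypothesis is that the system is solvable for at least one of them. Format of descriptions of solution sets: for integers $m$ and $k\ge 0$ let $D_k(m)$ be the set of all integers $z$ such that $z^k$ is a divisor of $m$ (so $D_0(m)=\mathbb{Z}$ and $D_1(m)$ is the set of divisors of $m$). A set of integer solutions is regarded as described if it is given by finitely many explicit parametric families, in which parameters range over $\mathbb{Z}$ or may be restricted to be divisors of polynomial or rational expressions in other parameters, that is, to lie in sets $D_k(E)$ where $E$ is an integer-valued expression in other parameters. For example, the solutions of $yzt=x^2+1$ are described by $(x,y,z,t)=\left(u_1,u_2,u_3,\frac{u_1^2+1}{u_2u_3}\right)$ with $u_1\in\mathbb{Z}$, $u_2\in D_1(u_1^2+1)$, $u_3\in D_1\left(\frac{u_1^2+1}{u_2}\right)$. *)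

theory Defs
  imports "HOL-Library.Nat_Bijection"
begin

section \<open>Algorithms: Kleene's partial recursive functions\<close>

datatype recf =
    Zero
  | Succ
  | Proj nat
  | Comp recf "recf list"
  | PrimRec recf recf
  | Minim recf

text \<open>
  \<open>computes p xs y\<close>: the program \<open>p\<close> halts on the arguments \<open>xs\<close> with result \<open>y\<close>.
  The recursion variable of \<open>PrimRec\<close> and the search variable of \<open>Minim\<close> come first in the
  argument list. As usual, \<open>Minim p\<close> halts with \<open>n\<close> only if \<open>p\<close> halts on all smaller candidates,
  with non-zero results.
\<close>

inductive computes :: "recf \<Rightarrow> nat list \<Rightarrow> nat \<Rightarrow> bool" where
  zero: "computes Zero xs 0"
| succ: "computes Succ [x] (Suc x)"
| proj: "i < length xs \<Longrightarrow> computes (Proj i) xs (xs ! i)"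
| comp: "list_all2 (\<lambda>g y. computes g xs y) gs ys \<Longrightarrow> computes p ys y \<Longrightarrow> computes (Comp p gs) xs y"
| primrec_0: "computes p xs y \<Longrightarrow> computes (PrimRec p q) (0 # xs) y"
| primrec_Suc: "computes (PrimRec p q) (n # xs) r \<Longrightarrow> computes q (n # r # xs) y
    \<Longrightarrow> computes (PrimRec p q) (Suc n # xs) y"
| minim: "computes p (n # xs) 0 \<Longrightarrow> (\<And>m. m < n \<Longrightarrow> \<exists>k. computes p (m # xs) (Suc k))
    \<Longrightarrow> computes (Minim p) xs n"

inductive_cases computes_ZeroE: "computes Zero xs y"
inductive_cases computes_SuccE: "computes Succ xs y"
inductive_cases computes_ProjE: "computes (Proj i) xs y"
inductive_cases computes_CompE: "computes (Comp p gs) xs y"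
inductive_cases computes_PrimRec0E: "computes (PrimRec p q) (0 # xs) y"
inductive_cases computes_PrimRecSucE: "computes (PrimRec p q) (Suc n # xs) y"
inductive_cases computes_MinimE: "computes (Minim p) xs y"

lemma computes_deterministic: "computes p xs y \<Longrightarrow> computes p xs z \<Longrightarrow> y = z"
proof (induction arbitrary: z rule: computes.induct)
  case zero
  then show ?case by (rule computes_ZeroE) simp
next
  case (succ x)
  then show ?case by (rule computes_SuccE) simp
next
  case (proj i xs)
  from proj.prems show ?case by (rule computes_ProjE) simp
next
  case (comp xs gs ys p y)
  from comp.prems obtain ys' where
    ys': "list_all2 (\<lambda>g y. computes g xs y) gs ys'" "computes p ys' z"
    by (rule computes_CompE)
  have "ys = ys'"
  proof (rule nth_equalityI)
    show "length ys = length ys'"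
      using list_all2_lengthD[OF comp.IH(1)] list_all2_lengthD[OF ys'(1)] by simp
    show "ys ! i = ys' ! i" if "i < length ys" for i
      using list_all2_nthD2[OF comp.IH(1) that] list_all2_nthD2[OF ys'(1), of i]
        \<open>length ys = length ys'\<close> that by simp
  qed
  with comp.IH(2) ys'(2) show ?case by simp
next
  case (primrec_0 p xs y q)
  from primrec_0.prems show ?case by (rule computes_PrimRec0E) (rule primrec_0.IH)
next
  case (primrec_Suc p q n xs r y)
  from primrec_Suc.prems obtain r' where
    r': "computes (PrimRec p q) (n # xs) r'" "computes q (n # r' # xs) z"
    by (rule computes_PrimRecSucE)
  from primrec_Suc.IH(1)[OF r'(1)] r'(2) show ?case by (intro primrec_Suc.IH(2)) simp
next
  case (minim p n xs)
  from minim.prems have z: "computes p (z # xs) 0 \<and>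
    (\<forall>m<z. \<exists>k. computes p (m # xs) (Suc k))"
    by (rule computes_MinimE) simp
  show ?case
  proof (cases n z rule: linorder_cases)
    case less
    with z obtain k where "computes p (n # xs) (Suc k)" by blast
    from minim.IH(1)[OF this] show ?thesis by simp
  next
    case greater
    from minim.IH(2)[OF this] obtain k where
      "\<And>w. computes p (z # xs) w \<Longrightarrow> Suc k = w" by blast
    with z show ?thesis by blast
  qed
qed


section \<open>Descriptions of sets of integer points by parametric families\<close>

text \<open>
  A polynomial in the parameters is a list of terms (coefficient, exponent list), where the exponent
  list refers to the parameters in order; a rational expression is a pair (numerator, denominator).
  Exponents beyond the given list of parameter values are ignored.
\<close>

type_synonym ppoly = "(int \<times> nat list) list"
type_synonym pexpr = "ppoly \<times> ppoly"

definition poly_at :: "ppoly \<Rightarrow> int list \<Rightarrow> int" where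
  "poly_at p u = (\<Sum>(c, es)\<leftarrow>p. c * (\<Prod>(v, e)\<leftarrow>zip u es. v ^ e))"

definition integral_at :: "pexpr \<Rightarrow> int list \<Rightarrow> bool" where
  "integral_at E u \<longleftrightarrow> poly_at (snd E) u \<noteq> 0 \<and> poly_at (snd E) u dvd poly_at (fst E) u"

text \<open>Used only where \<open>integral_at E u\<close> holds, so that \<open>div\<close> is exact division.\<close>

definition value_at :: "pexpr \<Rightarrow> int list \<Rightarrow> int" where
  "value_at E u = poly_at (fst E) u div poly_at (snd E) u"

definition D :: "nat \<Rightarrow> int \<Rightarrow> int set" where
  "D k m = {z. z ^ k dvd m}"

datatype prange = Integers | Divisors nat pexpr

text \<open>
  A family consists of the ranges of its parameters, where the range of the \<open>j\<close>-th parameter may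
  depend on the earlier parameters only, and of one expression for each coordinate.
\<close>

type_synonym family = "prange list \<times> pexpr list"

fun range_at :: "prange \<Rightarrow> int list \<Rightarrow> int set" where
  "range_at Integers u = UNIV"
| "range_at (Divisors k E) u = D k (value_at E u)"

definition admissible :: "prange list \<Rightarrow> int list \<Rightarrow> bool" where
  "admissible R u \<longleftrightarrow> length u = length R \<and> (\<forall>j<length R. u ! j \<in> range_at (R ! j) (take j u))"

text \<open>
  Integrality is a requirement on the family at all admissible parameter values; it does not serve
  to select parameter values. In particular no denominator may vanish at admissible values, also
  not through the divisor 0 of 0.
\<close>

definition integer_valued :: "family \<Rightarrow> bool" where
  "integer_valued F \<longleftrightarrow>
     (\<forall>j<length (fst F). \<forall>k E. fst F ! j = Divisors k E \<longrightarrow>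
        (\<forall>u. admissible (take j (fst F)) u \<longrightarrow> integral_at E u)) \<and>
     (\<forall>E\<in>set (snd F). \<forall>u. admissible (fst F) u \<longrightarrow> integral_at E u)"

definition points :: "family \<Rightarrow> int list set" where
  "points F = {map (\<lambda>E. value_at E u) (snd F) | u. admissible (fst F) u}"

definition describes :: "family list \<Rightarrow> int list set \<Rightarrow> bool" where
  "describes Fs S \<longleftrightarrow> (\<forall>F\<in>set Fs. integer_valued F) \<and> S = (\<Union>F\<in>set Fs. points F)"


section \<open>Encoding of descriptions as natural numbers\<close>

text \<open>
  Explicit codes, since computability of the output would be meaningless for codes obtained by
  choice, such as \<open>to_nat\<close> of class \<open>countable\<close>.
\<close>

fun encode_pair :: "('a \<Rightarrow> nat) \<Rightarrow> ('b \<Rightarrow> nat) \<Rightarrow> 'a \<times> 'b \<Rightarrow> nat" where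
  "encode_pair f g (x, y) = prod_encode (f x, g y)"

definition encode_list :: "('a \<Rightarrow> nat) \<Rightarrow> 'a list \<Rightarrow> nat" where
  "encode_list f xs = list_encode (map f xs)"

definition encode_poly :: "ppoly \<Rightarrow> nat" where
  "encode_poly = encode_list (encode_pair int_encode list_encode)"

definition encode_expr :: "pexpr \<Rightarrow> nat" where
  "encode_expr = encode_pair encode_poly encode_poly"

fun encode_range :: "prange \<Rightarrow> nat" where
  "encode_range Integers = 0"
| "encode_range (Divisors k E) = Suc (prod_encode (k, encode_expr E))"

definition encode_family :: "family \<Rightarrow> nat" where
  "encode_family = encode_pair (encode_list encode_range) (encode_list encode_expr)"

definition encode_description :: "family list \<Rightarrow> nat" where
  "encode_description = encode_list encode_family"

lemma inj_encode_pair: "inj f \<Longrightarrow> inj g \<Longrightarrow> inj (encode_pair f g)"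
  by (auto simp: inj_def prod_encode_eq)

lemma inj_encode_list: "inj f \<Longrightarrow> inj (encode_list f)"
  by (rule injI) (simp add: encode_list_def list_encode_eq inj_map_eq_map)

lemma inj_encode_expr: "inj encode_expr"
  unfolding encode_expr_def encode_poly_def
  by (intro inj_encode_pair inj_encode_list inj_int_encode inj_list_encode)

lemma inj_encode_range: "inj encode_range"
proof (rule injI)
  show "x = y" if "encode_range x = encode_range y" for x y
    using that inj_encode_expr by (cases x; cases y) (auto simp: prod_encode_eq dest: injD)
qed

lemma inj_encode_description: "inj encode_description"
  unfolding encode_description_def encode_family_def
  by (intro inj_encode_pair inj_encode_list inj_encode_range inj_encode_expr)


section \<open>Three-monomial equations\<close>

text \<open>
  The points \<open>x\<close> of \<open>\<int>\<^sup>n\<close> with \<open>a x\<^sup>\<alpha> + b x\<^sup>\<beta> = c x\<^sup>\<gamma>\<close>; exponent vectors are lists of length \<open>n\<close>.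
\<close>

definition solutions ::
  "nat \<Rightarrow> int \<Rightarrow> int \<Rightarrow> int \<Rightarrow> nat list \<Rightarrow> nat list \<Rightarrow> nat list \<Rightarrow> int list set" where
  "solutions n a b c \<alpha> \<beta> \<gamma> = {x. length x = n \<and>
     a * (\<Prod>i<n. x ! i ^ (\<alpha> ! i)) + b * (\<Prod>i<n. x ! i ^ (\<beta> ! i)) = c * (\<Prod>i<n. x ! i ^ (\<gamma> ! i))}"

definition system_solvable :: "nat \<Rightarrow> nat list \<Rightarrow> nat list \<Rightarrow> nat list \<Rightarrow> bool" where
  "system_solvable n \<alpha> \<beta> \<gamma> \<longleftrightarrow> (\<exists>z :: nat \<Rightarrow> int. (\<forall>i<n. z i \<ge> 0) \<and>
     (\<Sum>i<n. int (\<alpha> ! i) * z i) = (\<Sum>i<n. int (\<beta> ! i) * z i) \<and>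
     (\<Sum>i<n. int (\<beta> ! i) * z i) = (\<Sum>i<n. int (\<gamma> ! i) * z i) - 1)"

text \<open>
  Moving another monomial to the right-hand side permutes the exponent vectors and otherwise changes
  only signs of coefficients, on which the system does not depend.
\<close>

definition solvable_in_some_form :: "nat \<Rightarrow> nat list \<Rightarrow> nat list \<Rightarrow> nat list \<Rightarrow> bool" where
  "solvable_in_some_form n \<alpha> \<beta> \<gamma> \<longleftrightarrow>
     system_solvable n \<alpha> \<beta> \<gamma> \<or> system_solvable n \<alpha> \<gamma> \<beta> \<or> system_solvable n \<gamma> \<beta> \<alpha>"

end

theory Submission
  imports Defs "HOL-Number_Theory.Cong" "HOL-Library.Multiset"
begin

text \<open>
  Appending \<open>a, b, -c\<close> as further coordinates turns the equation into the vanishing of a sum of three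
  monomials with coefficient 1. At each prime the smallest of the three valuations is attained twice,
  so the vector of valuations of the coordinates lies in one of three cones. Each cone is generated by
  lattice points \<open>h\<close> of bounded size, so sorting the primes by cone gives \<open>x\<^sub>i = \<plusminus>\<Prod>\<^sub>h u\<^sub>h ^ h\<^sub>i\<close>. After
  division by the common factor, the equation reads \<open>\<plusminus>U \<plusminus> V \<plusminus> W = 0\<close>, where \<open>U, V, W\<close> are monomials in
  disjoint sets of the \<open>u\<^sub>h\<close>, and a solution of the linear system yields a \<open>u\<^sub>h\<close> that occurs in \<open>W\<close> with
  exponent 1. Those \<open>u\<^sub>h\<close> that contribute to a constant coordinate divide a constant and hence take
  finitely many values. The other \<open>u\<^sub>h\<close> become parameters: in \<open>W\<close> they are successively chosen as
  divisors of \<open>\<plusminus>U \<plusminus> V\<close>, and the linear one is the remaining quotient. That the constant part of \<open>W\<close> divides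
  \<open>\<plusminus>U \<plusminus> V\<close> is a condition on residues modulo a fixed number \<open>q\<close>.

  No denominator may vanish, so \<open>\<plusminus>U \<plusminus> V\<close> must be non-zero for all parameter values. If all parameters in
  \<open>U\<close> and \<open>V\<close> are 1, this is a finite check. Otherwise a prime divides, say, a parameter of \<open>V\<close>. The
  family then has \<open>p = 3q\<^sup>2k + const\<close> with \<open>k \<noteq> 0\<close> in place of this prime, so that \<open>p\<close> is neither 0 nor a
  unit, takes \<open>V\<close> divisible by \<open>p\<close>, and lets the parameters of \<open>U\<close> be coprime to \<open>p\<close>, that is, divisors of
  some \<open>ps + 1\<close>. Finally, an integer is non-zero iff it divides some \<open>(2s + 1)(3t + 1)\<close>, which
  expresses \<open>k \<noteq> 0\<close>.
\<close>

section \<open>Computable functions\<close>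

text \<open>The set of divisors of 0 contains 0. If \<open>\<plusminus>U \<plusminus> V\<close>
  vanished at admissible values, a later parameter of W could be 0 and a denominator would vanish; p
  and k exist to prevent this.

  The linear system enters through additivity. Its solution is a vector in the cone of W whose
  exponent in W exceeds the exponents in U and V by exactly 1. In a decomposition into generators of
  that cone the excesses add up, so a single generator carries the 1. Only completeness uses this.

  No minimal set of generators is computed: all vectors of a box are taken, and those outside the
  three cones get class 4 and the value 1. Likewise, the right data are not derived from the
  equation: all data of bounded size are listed and filtered by a decidable test. Soundness rests on
  the test alone; completeness asks that the datum of every solution is listed and passes.

  If a monomial is zero, the valuations need not lie in a cone. Either all three monomials vanish,
  or the other two are opposite and have equal valuations at every prime. The families are then
  purely monomial, and the signs carry the zeros.\<close>

definition ncomp :: "(nat \<Rightarrow> nat) \<Rightarrow> bool" where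
  "ncomp f \<longleftrightarrow> (\<exists>p. \<forall>x. computes p [x] (f x))"

definition ncomp2 :: "(nat \<Rightarrow> nat \<Rightarrow> nat) \<Rightarrow> bool" where
  "ncomp2 f \<longleftrightarrow> (\<exists>p. \<forall>x y. computes p [x, y] (f x y))"

definition ncomp3 :: "(nat \<Rightarrow> nat \<Rightarrow> nat \<Rightarrow> nat) \<Rightarrow> bool" where
  "ncomp3 f \<longleftrightarrow> (\<exists>p. \<forall>x y z. computes p [x, y, z] (f x y z))"

lemma computes_Proj: "i < length xs \<Longrightarrow> xs ! i = y \<Longrightarrow> computes (Proj i) xs y"
  using computes.proj by blast

lemma computes_Comp1: "computes g xs y \<Longrightarrow> computes p [y] z \<Longrightarrow> computes (Comp p [g]) xs z"
  by (rule computes.comp[where ys = "[y]"]) auto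

lemma computes_Comp2:
  "computes g xs y \<Longrightarrow> computes g' xs y' \<Longrightarrow> computes p [y, y'] z \<Longrightarrow> computes (Comp p [g, g']) xs z"
  by (rule computes.comp[where ys = "[y, y']"]) auto

lemma computes_Comp3:
  "computes g xs y \<Longrightarrow> computes g' xs y' \<Longrightarrow> computes g'' xs y'' \<Longrightarrow>
    computes p [y, y', y''] z \<Longrightarrow> computes (Comp p [g, g', g'']) xs z"
  by (rule computes.comp[where ys = "[y, y', y'']"]) auto

lemma ncomp_const: "ncomp (\<lambda>x. c)"
proof (induction c)
  case 0
  show ?case unfolding ncomp_def by (meson computes.zero)
next
  case (Suc c)
  then show ?case unfolding ncomp_def by (meson computes_Comp1 computes.succ)
qed

lemma ncomp_id: "ncomp (\<lambda>x. x)"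
  unfolding ncomp_def by (rule exI[of _ "Proj 0"]) (auto intro: computes_Proj)

lemma ncomp_Suc: "ncomp Suc"
  unfolding ncomp_def by (meson computes.succ)

lemma ncomp_comp: "ncomp f \<Longrightarrow> ncomp g \<Longrightarrow> ncomp (\<lambda>x. f (g x))"
  unfolding ncomp_def by (meson computes_Comp1)

lemma ncomp_comp2: "ncomp2 f \<Longrightarrow> ncomp g \<Longrightarrow> ncomp h \<Longrightarrow> ncomp (\<lambda>x. f (g x) (h x))"
  unfolding ncomp_def ncomp2_def by (meson computes_Comp2)

lemma ncomp_comp3:
  "ncomp3 f \<Longrightarrow> ncomp g \<Longrightarrow> ncomp h \<Longrightarrow> ncomp k \<Longrightarrow> ncomp (\<lambda>x. f (g x) (h x) (k x))"
  unfolding ncomp_def ncomp3_def by (meson computes_Comp3)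

lemma ncomp2_comp: "ncomp f \<Longrightarrow> ncomp2 g \<Longrightarrow> ncomp2 (\<lambda>x y. f (g x y))"
  unfolding ncomp_def ncomp2_def by (meson computes_Comp1)

lemma ncomp2_comp2: "ncomp2 f \<Longrightarrow> ncomp2 g \<Longrightarrow> ncomp2 h \<Longrightarrow> ncomp2 (\<lambda>x y. f (g x y) (h x y))"
  unfolding ncomp2_def by (meson computes_Comp2)

lemma ncomp2_comp3:
  "ncomp3 f \<Longrightarrow> ncomp2 g \<Longrightarrow> ncomp2 h \<Longrightarrow> ncomp2 k \<Longrightarrow> ncomp2 (\<lambda>x y. f (g x y) (h x y) (k x y))"
  unfolding ncomp2_def ncomp3_def by (meson computes_Comp3)

lemma ncomp3_comp: "ncomp f \<Longrightarrow> ncomp3 g \<Longrightarrow> ncomp3 (\<lambda>x y z. f (g x y z))"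
  unfolding ncomp_def ncomp3_def by (meson computes_Comp1)

lemma ncomp3_comp2: "ncomp2 f \<Longrightarrow> ncomp3 g \<Longrightarrow> ncomp3 h \<Longrightarrow> ncomp3 (\<lambda>x y z. f (g x y z) (h x y z))"
  unfolding ncomp2_def ncomp3_def by (meson computes_Comp2)

lemma ncomp2_proj: "ncomp2 (\<lambda>x y. x)" "ncomp2 (\<lambda>x y. y)"
  unfolding ncomp2_def
  by (rule exI[of _ "Proj 0"], auto intro: computes_Proj, rule exI[of _ "Proj 1"], auto intro: computes_Proj)

lemma ncomp3_proj: "ncomp3 (\<lambda>x y z. x)" "ncomp3 (\<lambda>x y z. y)" "ncomp3 (\<lambda>x y z. z)"
  unfolding ncomp3_def
  by (rule exI[of _ "Proj 0"], auto intro: computes_Proj, rule exI[of _ "Proj 1"], auto intro: computes_Proj,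
      rule exI[of _ "Proj 2"], auto intro: computes_Proj)

lemma ncomp2_rec:
  assumes "ncomp g" "ncomp3 h"
  shows "ncomp2 (\<lambda>n x. rec_nat (g x) (\<lambda>n r. h n r x) n)"
proof -
  from assms obtain p q where pq: "\<And>x. computes p [x] (g x)" "\<And>n r x. computes q [n, r, x] (h n r x)"
    unfolding ncomp_def ncomp3_def by metis
  have "computes (PrimRec p q) [n, x] (rec_nat (g x) (\<lambda>n r. h n r x) n)" for n x
  proof (induction n)
    case 0
    show ?case using primrec_0[OF pq(1)] by simp
  next
    case (Suc n)
    show ?case using primrec_Suc[OF Suc pq(2)] by simp
  qed
  then show ?thesis unfolding ncomp2_def by blast
qed

lemma ncomp_rec: "ncomp2 h \<Longrightarrow> ncomp (\<lambda>n. rec_nat c h n)"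
  using ncomp_comp2[OF ncomp2_rec[OF ncomp_const[of c] ncomp3_comp2[of h, OF _ ncomp3_proj(1,2)]] ncomp_id ncomp_id]
  by simp

lemma ncomp2_add: "ncomp2 (+)"
proof -
  have "(+) = (\<lambda>n x. rec_nat x (\<lambda>n r. Suc r) n)"
  proof (intro ext)
    fix n x :: nat
    show "n + x = rec_nat x (\<lambda>n r. Suc r) n" by (induction n) auto
  qed
  then show ?thesis
    using ncomp2_rec[OF ncomp_id ncomp3_comp[OF ncomp_Suc ncomp3_proj(2)]] by simp
qed

lemma ncomp_pred: "ncomp (\<lambda>n. n - 1)"
proof -
  have "(\<lambda>n. n - 1) = (\<lambda>n. rec_nat 0 (\<lambda>n r. n) n)"
  proof (intro ext)
    fix n :: nat
    show "n - 1 = rec_nat 0 (\<lambda>n r. n) n" by (cases n) auto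
  qed
  then show ?thesis using ncomp_rec[OF ncomp2_proj(1)] by simp
qed

lemma ncomp2_diff: "ncomp2 (-)"
proof -
  have "(-) = (\<lambda>x n. rec_nat x (\<lambda>n r. r - 1) n)"
  proof (intro ext)
    fix n x :: nat
    show "x - n = rec_nat x (\<lambda>n r. r - 1) n" by (induction n) auto
  qed
  then show ?thesis
    using ncomp2_comp2[OF ncomp2_rec[OF ncomp_id ncomp3_comp[OF ncomp_pred ncomp3_proj(2)]] ncomp2_proj(2) ncomp2_proj(1)]
    by simp
qed

lemma ncomp2_mult: "ncomp2 (*)"
proof -
  have "(*) = (\<lambda>n x. rec_nat 0 (\<lambda>n r. x + r) n)"
  proof (intro ext)
    fix n x :: nat
    show "n * x = rec_nat 0 (\<lambda>n r. x + r) n" by (induction n) auto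
  qed
  then show ?thesis
    using ncomp2_rec[OF ncomp_const[of 0] ncomp3_comp2[OF ncomp2_add ncomp3_proj(3) ncomp3_proj(2)]] by simp
qed

text \<open>Truncated subtraction turns the test into arithmetic: \<open>1 - c\<close> is 1 at
  \<open>c = 0\<close> and 0 elsewhere.\<close>

lemma ncomp3_if: "ncomp3 (\<lambda>c x y. if c = 0 then x else y)"
proof -
  have e: "(if c = 0 then x else y) = (1 - c) * x + (1 - (1 - c)) * y" for c x y :: nat by simp
  have c1: "ncomp3 (\<lambda>c x y. 1 - c)"
    using ncomp3_comp[OF ncomp_comp2[OF ncomp2_diff ncomp_const[of 1] ncomp_id] ncomp3_proj(1)] .
  have c2: "ncomp3 (\<lambda>c x y. 1 - (1 - c))"
    using ncomp3_comp[OF ncomp_comp2[OF ncomp2_diff ncomp_const[of 1] ncomp_id] c1] .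
  show ?thesis unfolding e
    by (intro ncomp3_comp2[OF ncomp2_add] ncomp3_comp2[OF ncomp2_mult] c1 c2 ncomp3_proj)
qed

section \<open>The Cantor pairing and its projections\<close>

lemma ncomp_triangle: "ncomp triangle"
proof -
  have "triangle = (\<lambda>n. rec_nat 0 (\<lambda>n r. r + Suc n) n)"
  proof (intro ext)
    fix n show "triangle n = rec_nat 0 (\<lambda>n r. r + Suc n) n" by (induction n) auto
  qed
  moreover have "ncomp2 (\<lambda>n r. r + Suc n)"
    by (intro ncomp2_comp2[OF ncomp2_add] ncomp2_comp[OF ncomp_Suc] ncomp2_proj)
  ultimately show ?thesis using ncomp_rec by metis
qed

lemma ncomp2_pair: "ncomp2 (\<lambda>x y. prod_encode (x, y))"
  unfolding prod_encode_def prod.case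
  by (intro ncomp2_comp2[OF ncomp2_add] ncomp2_comp[OF ncomp_triangle] ncomp2_proj)

text \<open>The largest r with \<open>triangle r \<le> z\<close>, that is, the sum of the two
  components of the pair with code z. From one code to the next it grows by at most 1, so primitive
  recursion finds it without a search.\<close>

definition diagonal :: "nat \<Rightarrow> nat" where
  "diagonal = rec_nat 0 (\<lambda>z r. if triangle (Suc r) - Suc z = 0 then Suc r else r)"

lemma diagonal_bounds: "triangle (diagonal z) \<le> z \<and> z < triangle (Suc (diagonal z))"
  by (induction z) (auto simp: diagonal_def)

lemma triangle_mono: "a \<le> b \<Longrightarrow> triangle a \<le> triangle b"
  by (induction b rule: dec_induct) auto

lemma diagonal_prod_encode: "diagonal (prod_encode (x, y)) = x + y"
proof -
  let ?z = "prod_encode (x, y)"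
  have z: "triangle (x + y) \<le> ?z" "?z < triangle (Suc (x + y))" by (auto simp: prod_encode_def)
  have "\<not> Suc (diagonal ?z) \<le> x + y"
    using triangle_mono[of "Suc (diagonal ?z)" "x + y"] diagonal_bounds[of ?z] z by linarith
  moreover have "\<not> Suc (x + y) \<le> diagonal ?z"
    using triangle_mono[of "Suc (x + y)" "diagonal ?z"] diagonal_bounds[of ?z] z by linarith
  ultimately show ?thesis by linarith
qed

lemma ncomp_diagonal: "ncomp diagonal"
proof -
  have "ncomp2 (\<lambda>z r. if triangle (Suc r) - Suc z = 0 then Suc r else r)"
    by (intro ncomp2_comp3[OF ncomp3_if] ncomp2_comp2[OF ncomp2_diff] ncomp2_comp[OF ncomp_triangle]
        ncomp2_comp[OF ncomp_Suc] ncomp2_proj)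
  then show ?thesis unfolding diagonal_def by (rule ncomp_rec)
qed

definition pfst :: "nat \<Rightarrow> nat" where "pfst z = z - triangle (diagonal z)"
definition psnd :: "nat \<Rightarrow> nat" where "psnd z = diagonal z - pfst z"

lemma pfst_prod_encode [simp]: "pfst (prod_encode (x, y)) = x"
  by (simp add: pfst_def diagonal_prod_encode) (simp add: prod_encode_def)

lemma psnd_prod_encode [simp]: "psnd (prod_encode (x, y)) = y"
  by (simp add: psnd_def diagonal_prod_encode)

lemma ncomp_pfst: "ncomp pfst"
  unfolding pfst_def
  by (intro ncomp_comp2[OF ncomp2_diff] ncomp_id ncomp_comp[OF ncomp_triangle] ncomp_diagonal)

lemma ncomp_psnd: "ncomp psnd"
  unfolding psnd_def by (intro ncomp_comp2[OF ncomp2_diff] ncomp_pfst ncomp_diagonal)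

section \<open>Explicit codes of structured data, and computable functions on them\<close>

class enc =
  fixes enc :: "'a \<Rightarrow> nat"

instantiation nat :: enc
begin
definition enc_nat :: "nat \<Rightarrow> nat" where [simp]: "enc_nat x = x"
instance ..
end

instantiation int :: enc
begin
definition enc_int :: "int \<Rightarrow> nat" where "enc_int = int_encode"
instance ..
end

instantiation bool :: enc
begin
text \<open>\<open>True\<close> has code 0 because \<open>ncomp3_if\<close> takes its first branch
  at 0.\<close>

definition enc_bool :: "bool \<Rightarrow> nat" where "enc_bool b = (if b then 0 else 1)"
instance ..
end

instantiation prod :: (enc, enc) enc
begin
definition enc_prod :: "'a \<times> 'b \<Rightarrow> nat" where "enc_prod = encode_pair enc enc"
instance ..
end

instantiation list :: (enc) enc
begin
definition enc_list :: "'a list \<Rightarrow> nat" where "enc_list = encode_list enc"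
instance ..
end

instantiation prange :: enc
begin
definition enc_prange :: "prange \<Rightarrow> nat" where "enc_prange = encode_range"
instance ..
end

lemma enc_Pair [simp]: "enc (x, y) = prod_encode (enc x, enc y)"
  by (simp add: enc_prod_def)

lemma enc_Nil [simp]: "enc [] = 0"
  by (simp add: enc_list_def encode_list_def)

lemma enc_Cons [simp]: "enc (x # xs) = Suc (prod_encode (enc x, enc xs))"
  by (simp add: enc_list_def encode_list_def)

lemma enc_nat_list: "enc (xs :: nat list) = list_encode xs"
  by (induction xs) auto

lemma enc_pexpr: "enc (E :: pexpr) = encode_expr E"
proof -
  have "(enc :: nat list \<Rightarrow> nat) = list_encode" by (rule ext) (rule enc_nat_list)
  then have "(enc :: ppoly \<Rightarrow> nat) = encode_poly"
    by (simp add: enc_list_def[where 'a = "int \<times> nat list"] enc_prod_def enc_int_def encode_poly_def)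
  then show ?thesis by (simp add: enc_prod_def encode_expr_def)
qed

lemma enc_description: "enc (Fs :: family list) = encode_description Fs"
proof -
  have "(enc :: pexpr \<Rightarrow> nat) = encode_expr" by (rule ext) (rule enc_pexpr)
  then have "(enc :: family \<Rightarrow> nat) = encode_family"
    by (simp add: enc_prod_def[where 'a = "prange list"] enc_list_def[where 'a = prange]
        enc_list_def[where 'a = pexpr] enc_prange_def encode_family_def)
  then show ?thesis by (simp add: enc_list_def encode_description_def)
qed

text \<open>\<open>F\<close> is total but constrained only at codes of actual values; on other
  numbers it may do anything.\<close>

definition computable :: "('a :: enc \<Rightarrow> 'b :: enc) \<Rightarrow> bool" where
  "computable f \<longleftrightarrow> (\<exists>F. ncomp F \<and> (\<forall>x. F (enc x) = enc (f x)))"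

named_theorems computable_intros

lemma computableI: "ncomp F \<Longrightarrow> (\<And>x. F (enc x) = enc (f x)) \<Longrightarrow> computable f"
  unfolding computable_def by blast

lemma computableE:
  assumes "computable f"
  obtains F where "ncomp F" "\<And>x. F (enc x) = enc (f x)"
  using assms unfolding computable_def by blast

lemma computable_const [computable_intros]: "computable (\<lambda>x. c)"
  by (rule computableI[OF ncomp_const[of "enc c"]]) simp

lemma computable_id [computable_intros]: "computable (\<lambda>x. x)"
  by (rule computableI[OF ncomp_id]) simp

lemma computable_comp: "computable f \<Longrightarrow> computable g \<Longrightarrow> computable (\<lambda>x. f (g x))"
  by (elim computableE) (rule computableI, erule (1) ncomp_comp, simp)

lemma computable_Pair [computable_intros]:
  "computable f \<Longrightarrow> computable g \<Longrightarrow> computable (\<lambda>x. (f x, g x))"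
  by (elim computableE) (rule computableI, erule (1) ncomp_comp2[OF ncomp2_pair], simp)

lemma computable_fst [computable_intros]:
  fixes f :: "'a :: enc \<Rightarrow> 'b :: enc \<times> 'c :: enc"
  assumes "computable f"
  shows "computable (\<lambda>x. fst (f x))"
proof -
  have "computable (fst :: 'b \<times> 'c \<Rightarrow> 'b)"
    by (rule computableI[OF ncomp_pfst]) auto
  then show ?thesis using assms by (rule computable_comp)
qed

lemma computable_snd [computable_intros]:
  fixes f :: "'a :: enc \<Rightarrow> 'b :: enc \<times> 'c :: enc"
  assumes "computable f"
  shows "computable (\<lambda>x. snd (f x))"
proof -
  have "computable (snd :: 'b \<times> 'c \<Rightarrow> 'c)"
    by (rule computableI[OF ncomp_psnd]) auto
  then show ?thesis using assms by (rule computable_comp)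
qed

lemma computable_comp2:
  assumes "computable (\<lambda>p. f (fst p) (snd p))" "computable g" "computable h"
  shows "computable (\<lambda>x. f (g x) (h x))"
  using computable_comp[OF assms(1) computable_Pair[OF assms(2,3)]] by simp

lemma computable_nat_fun: "ncomp F \<Longrightarrow> computable f \<Longrightarrow> computable (\<lambda>x. F (f x))"
  by (rule computable_comp[of F]) (auto intro: computableI)

lemma computable_nat_fun2:
  assumes "ncomp2 F" "computable f" "computable g"
  shows "computable (\<lambda>x. F (f x) (g x))"
proof (rule computable_comp2[OF _ assms(2,3)])
  show "computable (\<lambda>p. F (fst p) (snd p))"
    by (rule computableI[OF ncomp_comp2[OF assms(1) ncomp_pfst ncomp_psnd]]) auto
qed

lemmas computable_Suc [computable_intros] = computable_nat_fun[OF ncomp_Suc]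
lemmas computable_add_nat [computable_intros] = computable_nat_fun2[OF ncomp2_add]
lemmas computable_diff_nat [computable_intros] = computable_nat_fun2[OF ncomp2_diff]
lemmas computable_mult_nat [computable_intros] = computable_nat_fun2[OF ncomp2_mult]

lemma computable_If [computable_intros]:
  assumes "computable P" "computable f" "computable g"
  shows "computable (\<lambda>x. if P x then f x else g x)"
proof -
  from assms obtain P' f' g' where
    "ncomp P'" "ncomp f'" "ncomp g'" "\<And>x. P' (enc x) = enc (P x)"
    "\<And>x. f' (enc x) = enc (f x)" "\<And>x. g' (enc x) = enc (g x)"
    by (elim computableE) blast
  then show ?thesis
    by (intro computableI[OF ncomp_comp3[OF ncomp3_if, of P' f' g']]) (auto simp: enc_bool_def)
qed

lemma computable_not [computable_intros]: "computable P \<Longrightarrow> computable (\<lambda>x. \<not> P x)"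
proof -
  have "(\<lambda>x. \<not> P x) = (\<lambda>x. if P x then False else True)" by auto
  then show "computable P \<Longrightarrow> ?thesis"
    by (simp only:) (intro computable_If computable_const)
qed

lemma computable_conj [computable_intros]:
  "computable P \<Longrightarrow> computable Q \<Longrightarrow> computable (\<lambda>x. P x \<and> Q x)"
proof -
  have "(\<lambda>x. P x \<and> Q x) = (\<lambda>x. if P x then Q x else False)" by auto
  then show "computable P \<Longrightarrow> computable Q \<Longrightarrow> ?thesis"
    by (simp only:) (intro computable_If computable_const)
qed

lemma computable_disj [computable_intros]:
  "computable P \<Longrightarrow> computable Q \<Longrightarrow> computable (\<lambda>x. P x \<or> Q x)"
proof -
  have "(\<lambda>x. P x \<or> Q x) = (\<lambda>x. if P x then True else Q x)" by auto
  then show "computable P \<Longrightarrow> computable Q \<Longrightarrow> ?thesis"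
    by (simp only:) (intro computable_If computable_const)
qed

lemma computable_imp [computable_intros]:
  "computable P \<Longrightarrow> computable Q \<Longrightarrow> computable (\<lambda>x. P x \<longrightarrow> Q x)"
  unfolding imp_conv_disj by (intro computable_disj computable_not)

lemma computable_eq_0: "computable f \<Longrightarrow> computable (\<lambda>x. f x = (0 :: nat))"
  by (rule computable_comp[of "\<lambda>n :: nat. n = 0"])
    (rule computableI[OF ncomp_comp3[OF ncomp3_if ncomp_id ncomp_const[of 0] ncomp_const[of 1]]],
      auto simp: enc_bool_def)

lemma computable_le_nat [computable_intros]:
  "computable f \<Longrightarrow> computable g \<Longrightarrow> computable (\<lambda>x. f x \<le> (g x :: nat))"
  using computable_eq_0[OF computable_diff_nat, of f g] by simp

lemma computable_less_nat [computable_intros]: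
  "computable f \<Longrightarrow> computable g \<Longrightarrow> computable (\<lambda>x. f x < (g x :: nat))"
  using computable_le_nat[OF computable_Suc, of f g] by (simp add: Suc_le_eq)

lemma computable_eq_nat [computable_intros]:
  "computable f \<Longrightarrow> computable g \<Longrightarrow> computable (\<lambda>x. f x = (g x :: nat))"
  unfolding order_eq_iff by (intro computable_intros)

lemma computable_Let [computable_intros]:
  assumes "computable f" "computable (\<lambda>p. g (fst p) (snd p))"
  shows "computable (\<lambda>x. let y = f x in g x y)"
  unfolding Let_def using computable_comp2[OF assms(2) computable_id assms(1)] .

text \<open>The state of the recursion may have any encoded type, so loops with several variables
  are recursions on tuples.\<close>

lemma computable_rec_nat [computable_intros]:
  fixes g :: "'a :: enc \<Rightarrow> 'b :: enc"
  assumes "computable g" "computable (\<lambda>p. h (fst p) (fst (snd p)) (snd (snd p)))" "computable k"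
  shows "computable (\<lambda>x. rec_nat (g x) (\<lambda>n r. h x n r) (k x))"
proof -
  from assms obtain G H K where ghk: "ncomp G" "ncomp H" "ncomp K" "\<And>x. G (enc x) = enc (g x)"
    "\<And>p. H (enc p) = enc (h (fst p) (fst (snd p)) (snd (snd p)))" "\<And>x. K (enc x) = enc (k x)"
    by (elim computableE) blast
  let ?H = "\<lambda>n r x. H (prod_encode (x, prod_encode (n, r)))"
  have c3: "ncomp3 (\<lambda>n r x. ?H n r x)"
    by (intro ncomp3_comp[OF ghk(2)] ncomp3_comp2[OF ncomp2_pair] ncomp3_proj)
  have "rec_nat (G (enc x)) (\<lambda>n r. ?H n r (enc x)) n = enc (rec_nat (g x) (\<lambda>n r. h x n r) n)" for x n
  proof (induction n)
    case 0
    show ?case by (simp add: ghk)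
  next
    case (Suc n)
    show ?case using ghk(5)[of "(x, n, rec_nat (g x) (\<lambda>n r. h x n r) n)"] by (simp add: Suc)
  qed
  then show ?thesis
    using ghk(6)
    by (intro computableI[OF ncomp_comp2[OF ncomp2_rec[OF ghk(1) c3] ghk(3) ncomp_id]]) auto
qed

lemma power_rec_nat: "x ^ n = rec_nat 1 (\<lambda>_ r. x * r) n"
  by (induction n) auto

lemma computable_power_nat [computable_intros]:
  "computable f \<Longrightarrow> computable g \<Longrightarrow> computable (\<lambda>x. (f x :: nat) ^ g x)"
  unfolding power_rec_nat by (assumption | intro computable_intros | rule computable_comp[of f] computable_comp[of g])+

section \<open>Lists\<close>

lemma enc_Cons_conv: "xs \<noteq> [] \<Longrightarrow> enc xs = Suc (prod_encode (enc (hd xs), enc (tl xs)))"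
  by (cases xs) auto

lemma computable_Cons [computable_intros]:
  "computable f \<Longrightarrow> computable g \<Longrightarrow> computable (\<lambda>x. f x # g x)"
  by (elim computableE)
    (rule computableI, erule (1) ncomp_comp[OF ncomp_Suc ncomp_comp2[OF ncomp2_pair]], simp)

lemma computable_is_Nil [computable_intros]:
  fixes f :: "'a :: enc \<Rightarrow> 'b :: enc list"
  assumes "computable f"
  shows "computable (\<lambda>x. f x = [])"
proof (rule computable_comp[OF _ assms])
  show "computable (\<lambda>xs :: 'b list. xs = [])"
    by (rule computableI[OF ncomp_comp3[OF ncomp3_if ncomp_id ncomp_const[of 0] ncomp_const[of 1]]])
      (auto simp: enc_bool_def enc_Cons_conv)
qed

lemma computable_tl [computable_intros]:
  fixes f :: "'a :: enc \<Rightarrow> 'b :: enc list"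
  assumes "computable f"
  shows "computable (\<lambda>x. tl (f x))"
proof (rule computable_comp[OF _ assms])
  show "computable (tl :: 'b list \<Rightarrow> 'b list)"
  proof (rule computableI)
    show "ncomp (\<lambda>n. if n = 0 then 0 else psnd (n - 1))"
      by (intro ncomp_comp3[OF ncomp3_if] ncomp_id ncomp_const ncomp_comp[OF ncomp_psnd] ncomp_pred)
    show "(if enc xs = 0 then 0 else psnd (enc xs - 1)) = enc (tl xs)" for xs :: "'b list"
      by (cases xs) auto
  qed
qed

lemma computable_hd [computable_intros]:
  fixes f :: "'a :: enc \<Rightarrow> 'b :: enc list"
  assumes "computable f"
  shows "computable (\<lambda>x. hd (f x))"
proof (rule computable_comp[OF _ assms])
  show "computable (hd :: 'b list \<Rightarrow> 'b)"
  proof (rule computableI)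
    \<comment> \<open>\<open>hd []\<close> is unspecified but fixed, so its code may enter the
      program as a constant.\<close>
    show "ncomp (\<lambda>n. if n = 0 then enc (hd [] :: 'b) else pfst (n - 1))"
      by (intro ncomp_comp3[OF ncomp3_if] ncomp_id ncomp_const ncomp_comp[OF ncomp_pfst] ncomp_pred)
    show "(if enc xs = 0 then enc (hd [] :: 'b) else pfst (enc xs - 1)) = enc (hd xs)" for xs :: "'b list"
      by (cases xs) auto
  qed
qed

lemma computable_enc: "computable f \<Longrightarrow> computable (\<lambda>x. enc (f x))"
  by (rule computable_comp[of enc]) (auto intro!: computableI[OF ncomp_id])

text \<open>Makes the code of a list usable as a number of iterations that surely exhausts the
  list.\<close>

lemma length_le_enc: "length xs \<le> enc xs"
  by (induction xs) (auto intro: order_trans[OF _ le_prod_encode_2])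

text \<open>The fold is iterated on pairs of remaining list and accumulator. The step is idle once
  the list is empty, so running it as often as the code of the list says does no harm.\<close>

lemma computable_fold [computable_intros]:
  fixes xs :: "'a :: enc \<Rightarrow> 'b :: enc list" and z :: "'a \<Rightarrow> 'c :: enc"
  assumes "computable (\<lambda>p. F (fst p) (fst (snd p)) (snd (snd p)))" "computable xs" "computable z"
  shows "computable (\<lambda>x. fold (\<lambda>a b. F x a b) (xs x) (z x))"
proof -
  let ?step = "\<lambda>x (n :: nat) s. if fst s = [] then s else (tl (fst s), F x (hd (fst s)) (snd s))"
  have "snd (rec_nat (ys, b) (?step x) n) = fold (F x) (take n ys) b
      \<and> fst (rec_nat (ys, b) (?step x) n) = drop n ys" for x n ys b
  proof (induction n)
    case (Suc n)
    show ?case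
    proof (cases "n < length ys")
      case True
      then show ?thesis using Suc
        by (simp add: take_Suc_conv_app_nth hd_drop_conv_nth drop_Suc tl_drop)
    qed (use Suc in auto)
  qed simp
  then have "fold (F x) (xs x) (z x) = snd (rec_nat (xs x, z x) (?step x) (enc (xs x)))" for x
    using length_le_enc[of "xs x"] by simp
  moreover have "computable (\<lambda>p :: 'a \<times> nat \<times> 'b list \<times> 'c. (fst p, hd (fst (snd (snd p))), snd (snd (snd p))))"
    by (intro computable_intros)
  note computable_comp[OF assms(1) this, unfolded fst_conv snd_conv]
  ultimately show ?thesis
    using assms(2,3) by (simp only:) (intro computable_intros computable_enc)
qed

lemma computable_rev [computable_intros]: "computable f \<Longrightarrow> computable (\<lambda>x. rev (f x))"
  unfolding rev_conv_fold by (intro computable_intros)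

lemma computable_foldr [computable_intros]:
  assumes "computable (\<lambda>p. F (fst p) (fst (snd p)) (snd (snd p)))" "computable xs" "computable z"
  shows "computable (\<lambda>x. foldr (\<lambda>a b. F x a b) (xs x) (z x))"
  unfolding foldr_conv_fold by (intro computable_intros assms)

lemma computable_append [computable_intros]:
  "computable f \<Longrightarrow> computable g \<Longrightarrow> computable (\<lambda>x. f x @ g x)"
proof -
  have "xs @ ys = foldr (#) xs ys" for xs ys :: "'b list" by (induction xs) auto
  then show "computable f \<Longrightarrow> computable g \<Longrightarrow> ?thesis"
    by (simp only:) (intro computable_intros)
qed

lemma computable_map [computable_intros]:
  assumes "computable (\<lambda>p. f (fst p) (snd p))" "computable xs"
  shows "computable (\<lambda>x. map (\<lambda>a. f x a) (xs x))"
proof -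
  have "map h as = foldr (\<lambda>a b. h a # b) as []" for h :: "'b \<Rightarrow> 'c" and as by (induction as) auto
  moreover have "computable (\<lambda>p :: 'a \<times> 'b \<times> 'c list. (fst p, fst (snd p)))"
    by (intro computable_intros)
  note computable_comp[OF assms(1) this, unfolded fst_conv snd_conv]
  ultimately show ?thesis by (simp only:) (intro computable_intros assms(2))
qed

lemma computable_filter [computable_intros]:
  assumes "computable (\<lambda>p. f (fst p) (snd p))" "computable xs"
  shows "computable (\<lambda>x. filter (\<lambda>a. f x a) (xs x))"
proof -
  have "filter h as = foldr (\<lambda>a b. if h a then a # b else b) as []" for h :: "'b \<Rightarrow> bool" and as
    by (induction as) auto
  moreover have "computable (\<lambda>p :: 'a \<times> 'b \<times> 'b list. (fst p, fst (snd p)))"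
    by (intro computable_intros)
  note computable_comp[OF assms(1) this, unfolded fst_conv snd_conv]
  ultimately show ?thesis by (simp only:) (intro computable_intros assms(2))
qed

lemma computable_concat [computable_intros]: "computable f \<Longrightarrow> computable (\<lambda>x. concat (f x))"
  unfolding concat_conv_foldr by (intro computable_intros)

lemma computable_length [computable_intros]: "computable f \<Longrightarrow> computable (\<lambda>x. length (f x))"
proof -
  have "length xs = foldr (\<lambda>_. Suc) xs 0" for xs :: "'b list" by (induction xs) auto
  then show "computable f \<Longrightarrow> ?thesis" by (simp only:) (intro computable_intros)
qed

lemma computable_upt_0 [computable_intros]: "computable f \<Longrightarrow> computable (\<lambda>x. [0..<f x])"
proof -
  have "[0..<n] = rec_nat [] (\<lambda>k r. r @ [k]) n" for n by (induction n) auto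
  then show "computable f \<Longrightarrow> ?thesis" by (simp only:) (intro computable_intros)
qed

lemma computable_drop [computable_intros]:
  "computable f \<Longrightarrow> computable g \<Longrightarrow> computable (\<lambda>x. drop (f x) (g x))"
proof -
  have "drop n xs = rec_nat xs (\<lambda>_. tl) n" for n and xs :: "'b list"
    by (induction n) (auto simp: drop_Suc tl_drop[symmetric])
  then show "computable f \<Longrightarrow> computable g \<Longrightarrow> ?thesis"
    by (simp only:) (rule computable_comp2, (intro computable_intros)+)
qed

lemma computable_replicate [computable_intros]:
  "computable f \<Longrightarrow> computable g \<Longrightarrow> computable (\<lambda>x. replicate (f x) (g x))"
proof -
  have "replicate n c = map (\<lambda>_. c) [0..<n]" for n and c :: 'b by (simp add: map_replicate_const)
  then show "computable f \<Longrightarrow> computable g \<Longrightarrow> ?thesis"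
    by (simp only:) (rule computable_comp2, (intro computable_intros)+)
qed

lemma computable_all [computable_intros]:
  assumes "computable (\<lambda>p. P (fst p) (snd p))" "computable xs"
  shows "computable (\<lambda>x. \<forall>a\<in>set (xs x). P x a)"
proof -
  have "(\<forall>a\<in>set as. h a) \<longleftrightarrow> filter (\<lambda>a. \<not> h a) as = []" for h :: "'b \<Rightarrow> bool" and as
    by (simp add: filter_empty_conv)
  then show ?thesis by (simp only:) (intro computable_intros assms)
qed

lemma computable_ball_less [computable_intros]:
  fixes k :: "'a :: enc \<Rightarrow> nat"
  assumes "computable (\<lambda>p. P (fst p) (snd p))" "computable k"
  shows "computable (\<lambda>x. \<forall>i<k x. P x i)"
proof -
  have "(\<forall>i<k x. P x i) \<longleftrightarrow> (\<forall>i\<in>set [0..<k x]. P x i)" for x by auto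
  then show ?thesis by (simp only:) (intro computable_intros assms)
qed

text \<open>The value of \<open>(!)\<close> beyond the end of a list is unspecified, so \<open>(!)\<close> cannot be shown to be computable.\<close>

definition nthz :: "'a :: zero list \<Rightarrow> nat \<Rightarrow> 'a" where
  "nthz xs i = (if drop i xs = [] then 0 else hd (drop i xs))"

lemma nthz_eq: "nthz xs i = (if i < length xs then xs ! i else 0)"
  by (auto simp: nthz_def hd_drop_conv_nth)

lemma computable_nthz [computable_intros]:
  "computable f \<Longrightarrow> computable g \<Longrightarrow> computable (\<lambda>x. nthz (f x) (g x))"
  unfolding nthz_def by (intro computable_intros)

lemma computable_n_lists [computable_intros]:
  "computable f \<Longrightarrow> computable g \<Longrightarrow> computable (\<lambda>x. List.n_lists (f x) (g x))"
proof -
  have "List.n_lists n xs = rec_nat [[]] (\<lambda>_ r. concat (map (\<lambda>ys. map (\<lambda>y. y # ys) xs) r)) n"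
    for n and xs :: "'b list" by (induction n) auto
  then show "computable f \<Longrightarrow> computable g \<Longrightarrow> ?thesis"
    by (simp only:) (rule computable_comp2, (intro computable_intros)+)
qed

section \<open>Division and integer arithmetic\<close>

lemma computable_mod_nat [computable_intros]:
  "computable f \<Longrightarrow> computable g \<Longrightarrow> computable (\<lambda>x. f x mod (g x :: nat))"
proof -
  \<comment> \<open>For \<open>x = 0\<close> the counter is never reset, in agreement with
    \<open>n mod 0 = n\<close>.\<close>
  have "n mod x = rec_nat 0 (\<lambda>_ r. if Suc r = x then 0 else Suc r) n" for n x :: nat
    by (induction n) (auto simp: mod_Suc)
  then show "computable f \<Longrightarrow> computable g \<Longrightarrow> ?thesis"
    by (simp only:) (rule computable_comp2, (intro computable_intros)+)
qed

lemma computable_half: "computable f \<Longrightarrow> computable (\<lambda>x. f x div (2 :: nat))"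
proof -
  have "n div 2 = rec_nat 0 (\<lambda>k r. r + k mod 2) n" for n :: nat
  proof (induction n)
    case (Suc n)
    have "Suc n div 2 = n div 2 + n mod 2" by presburger
    with Suc show ?case by simp
  qed simp
  then show "computable f \<Longrightarrow> ?thesis"
    by (simp only:) (intro computable_intros)
qed

lemma ncompI: "computable F \<Longrightarrow> ncomp F"
  unfolding computable_def by (auto simp: fun_eq_iff[symmetric])

lemma enc_int_nonneg: "0 \<le> i \<Longrightarrow> enc i = 2 * nat i"
  by (simp add: enc_int_def int_encode_def sum_encode_def)

lemma enc_int_neg: "i < 0 \<Longrightarrow> enc i = Suc (2 * (nat (- i) - 1))"
  by (simp add: enc_int_def int_encode_def sum_encode_def nat_diff_distrib)

lemma computable_nat [computable_intros]: "computable f \<Longrightarrow> computable (\<lambda>x. nat (f x))"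
proof (rule computable_comp[of nat])
  show "computable nat"
  proof (rule computableI[OF ncompI])
    show "computable (\<lambda>c :: nat. if c mod 2 = 0 then c div 2 else 0)"
      by (intro computable_intros computable_half)
    show "(if enc i mod 2 = 0 then enc i div 2 else 0) = enc (nat i)" for i :: int
      by (cases "0 \<le> i") (auto simp: enc_int_nonneg enc_int_neg mod_Suc)
  qed
qed

lemma computable_nat_uminus: "computable f \<Longrightarrow> computable (\<lambda>x. nat (- f x))"
proof (rule computable_comp[of "\<lambda>i. nat (- i)"])
  show "computable (\<lambda>i. nat (- i))"
  proof (rule computableI[OF ncompI])
    show "computable (\<lambda>c :: nat. if c mod 2 = 0 then 0 else Suc (c div 2))"
      by (intro computable_intros computable_half)
    show "(if enc i mod 2 = 0 then 0 else Suc (enc i div 2)) = enc (nat (- i))" for i :: int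
      by (cases "0 \<le> i") (auto simp: enc_int_nonneg enc_int_neg mod_Suc)
  qed
qed

text \<open>Integer addition, negation and multiplication reduce to this: the result is written as a
  difference of two naturals made from the positive and negative parts \<open>nat i\<close> and
  \<open>nat (- i)\<close>.\<close>

lemma computable_diff_of_nat:
  assumes "computable f" "computable g"
  shows "computable (\<lambda>x. int (f x) - int (g x))"
proof (rule computable_comp2[OF _ assms])
  show "computable (\<lambda>p. int (fst p) - int (snd p))"
  proof (rule computableI[OF ncompI])
    show "computable (\<lambda>c. if snd (pfst c, psnd c) \<le> fst (pfst c, psnd c) then 2 * (pfst c - psnd c)
      else Suc (2 * (psnd c - pfst c - 1)))"
      by (intro computable_intros computable_nat_fun[OF ncomp_pfst] computable_nat_fun[OF ncomp_psnd])
    show "(if snd (pfst (enc p), psnd (enc p)) \<le> fst (pfst (enc p), psnd (enc p))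
      then 2 * (pfst (enc p) - psnd (enc p))
      else Suc (2 * (psnd (enc p) - pfst (enc p) - 1))) = enc (int (fst p) - int (snd p))" for p
      by (cases p) (auto simp: enc_int_nonneg enc_int_neg)
  qed
qed

lemma computable_of_nat [computable_intros]: "computable f \<Longrightarrow> computable (\<lambda>x. int (f x))"
  using computable_diff_of_nat[of f "\<lambda>x. 0"] by (simp add: computable_const)

lemma computable_add_int [computable_intros]:
  "computable f \<Longrightarrow> computable g \<Longrightarrow> computable (\<lambda>x. f x + (g x :: int))"
proof -
  have "i + j = int (nat i + nat j) - int (nat (- i) + nat (- j))" for i j by simp
  then show "computable f \<Longrightarrow> computable g \<Longrightarrow> ?thesis"
    by (simp only:) (intro computable_diff_of_nat computable_nat_uminus computable_intros)
qed

lemma computable_uminus_int [computable_intros]: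
  "computable f \<Longrightarrow> computable (\<lambda>x. - (f x :: int))"
proof -
  have "int (nat (- i)) - int (nat i) = - i" for i by simp
  then show "computable f \<Longrightarrow> ?thesis"
    using computable_diff_of_nat[OF computable_nat_uminus computable_nat, of f f] by (simp only:)
qed

lemma computable_diff_int [computable_intros]:
  "computable f \<Longrightarrow> computable g \<Longrightarrow> computable (\<lambda>x. f x - (g x :: int))"
  using computable_add_int[OF _ computable_uminus_int, of f g] by simp

lemma computable_mult_int [computable_intros]:
  "computable f \<Longrightarrow> computable g \<Longrightarrow> computable (\<lambda>x. f x * (g x :: int))"
proof -
  have "i * j = int (nat i * nat j + nat (- i) * nat (- j)) - int (nat i * nat (- j) + nat (- i) * nat j)"
    for i j by (cases "0 \<le> i"; cases "0 \<le> j") auto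
  then show "computable f \<Longrightarrow> computable g \<Longrightarrow> ?thesis"
    by (simp only:) (intro computable_diff_of_nat computable_nat_uminus computable_intros)
qed

lemma computable_power_int [computable_intros]:
  "computable f \<Longrightarrow> computable g \<Longrightarrow> computable (\<lambda>x. (f x :: int) ^ g x)"
  unfolding power_rec_nat by (rule computable_comp2, (intro computable_intros)+)

lemma computable_eq_int [computable_intros]:
  "computable f \<Longrightarrow> computable g \<Longrightarrow> computable (\<lambda>x. f x = (g x :: int))"
proof -
  have "i = j \<longleftrightarrow> nat i = nat j \<and> nat (- i) = nat (- j)" for i j by auto
  then show "computable f \<Longrightarrow> computable g \<Longrightarrow> ?thesis"
    by (simp only:) (intro computable_nat_uminus computable_intros)
qed

lemma computable_abs_int [computable_intros]:
  "computable f \<Longrightarrow> computable (\<lambda>x. \<bar>f x :: int\<bar>)"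
proof -
  have "\<bar>i\<bar> = int (nat i + nat (- i))" for i by simp
  then show "computable f \<Longrightarrow> ?thesis"
    by (simp only:) (intro computable_nat_uminus computable_intros)
qed

lemma computable_dvd_int [computable_intros]:
  "computable f \<Longrightarrow> computable g \<Longrightarrow> computable (\<lambda>x. f x dvd (g x :: int))"
proof -
  have "i dvd j \<longleftrightarrow> nat \<bar>j\<bar> mod nat \<bar>i\<bar> = 0" for i j :: int
    by (simp add: dvd_eq_mod_eq_0[symmetric] nat_abs_dvd_iff flip: dvd_nat_abs_iff)
  then show "computable f \<Longrightarrow> computable g \<Longrightarrow> ?thesis"
    by (simp only:) (intro computable_intros)
qed

lemma computable_sum_list_nat [computable_intros]:
  "computable f \<Longrightarrow> computable (\<lambda>x. sum_list (f x :: nat list))"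
  unfolding sum_list.eq_foldr comp_id by (intro computable_intros)

lemma computable_sum_list_int [computable_intros]:
  "computable f \<Longrightarrow> computable (\<lambda>x. sum_list (f x :: int list))"
  unfolding sum_list.eq_foldr by (intro computable_intros)

lemma computable_prod_list_int [computable_intros]:
  "computable f \<Longrightarrow> computable (\<lambda>x. prod_list (f x :: int list))"
  unfolding prod_list.eq_foldr by (intro computable_intros)

lemma computable_nat_max [computable_intros]:
  "computable f \<Longrightarrow> computable g \<Longrightarrow> computable (\<lambda>x. max (f x) (g x :: nat))"
  unfolding max_def by (intro computable_intros)

lemma computable_nat_min [computable_intros]:
  "computable f \<Longrightarrow> computable g \<Longrightarrow> computable (\<lambda>x. min (f x) (g x :: nat))"
  unfolding min_def by (intro computable_intros)

lemma computable_Divisors [computable_intros]: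
  fixes f :: "'a :: enc \<Rightarrow> nat" and g :: "'a \<Rightarrow> pexpr"
  assumes "computable f" "computable g"
  shows "computable (\<lambda>x. Divisors (f x) (g x))"
proof -
  have "enc (Divisors k E) = Suc (enc (k, E))" for k E
    by (simp add: enc_prange_def enc_pexpr del: enc_Pair add: enc_Pair[of k])
  then have "computable (\<lambda>p. Divisors (fst p) (snd p))"
    by (intro computableI[OF ncomp_Suc]) auto
  then show ?thesis using assms by (rule computable_comp2)
qed

section \<open>Arithmetic of polynomials in the parameters\<close>

definition add_exps :: "nat list \<Rightarrow> nat list \<Rightarrow> nat list" where
  "add_exps es fs = map (\<lambda>i. nthz es i + nthz fs i) [0..<max (length es) (length fs)]"

definition pconst :: "int \<Rightarrow> ppoly" where "pconst c = [(c, [])]"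

definition pvar :: "nat \<Rightarrow> ppoly" where "pvar i = [(1, replicate i 0 @ [1])]"

definition padd :: "ppoly \<Rightarrow> ppoly \<Rightarrow> ppoly" where "padd p q = p @ q"

definition pmul :: "ppoly \<Rightarrow> ppoly \<Rightarrow> ppoly" where
  "pmul p q = concat (map (\<lambda>s. map (\<lambda>t. (fst s * fst t, add_exps (snd s) (snd t))) q) p)"

definition ppow :: "ppoly \<Rightarrow> nat \<Rightarrow> ppoly" where
  "ppow p n = rec_nat (pconst 1) (\<lambda>_ r. pmul p r) n"

definition pprod :: "ppoly list \<Rightarrow> ppoly" where
  "pprod ps = foldr pmul ps (pconst 1)"

lemma ppow_simps [simp]: "ppow p 0 = pconst 1" "ppow p (Suc n) = pmul p (ppow p n)"
  by (simp_all add: ppow_def)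

lemma computable_add_exps [computable_intros]:
  "computable f \<Longrightarrow> computable g \<Longrightarrow> computable (\<lambda>x. add_exps (f x) (g x))"
  unfolding add_exps_def by (rule computable_comp2, (intro computable_intros)+)

lemma computable_pconst [computable_intros]: "computable f \<Longrightarrow> computable (\<lambda>x. pconst (f x))"
  unfolding pconst_def by (intro computable_intros)

lemma computable_pvar [computable_intros]: "computable f \<Longrightarrow> computable (\<lambda>x. pvar (f x))"
  unfolding pvar_def by (intro computable_intros)

lemma computable_padd [computable_intros]:
  "computable f \<Longrightarrow> computable g \<Longrightarrow> computable (\<lambda>x. padd (f x) (g x))"
  unfolding padd_def by (intro computable_intros)

lemma computable_pmul [computable_intros]:
  "computable f \<Longrightarrow> computable g \<Longrightarrow> computable (\<lambda>x. pmul (f x) (g x))"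
  unfolding pmul_def by (rule computable_comp2, (intro computable_intros)+)

lemma computable_ppow [computable_intros]:
  "computable f \<Longrightarrow> computable g \<Longrightarrow> computable (\<lambda>x. ppow (f x) (g x))"
  unfolding ppow_def by (rule computable_comp2, (intro computable_intros)+)

lemma computable_pprod [computable_intros]: "computable f \<Longrightarrow> computable (\<lambda>x. pprod (f x))"
  unfolding pprod_def by (intro computable_intros)

lemma prod_list_zip_powers:
  "(\<Prod>(v, e)\<leftarrow>zip u es. v ^ e) = (\<Prod>i<length u. u ! i ^ nthz es i)" for u :: "int list"
proof (induction u arbitrary: es)
  case (Cons v u)
  show ?case
  proof (cases es)
    case (Cons e es')
    have "nthz (e # es') (Suc i) = nthz es' i" for i by (simp add: nthz_eq)
    then show ?thesis using Cons.IH[of es']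
      by (simp add: Cons prod.lessThan_Suc_shift del: prod.lessThan_Suc) (simp add: nthz_eq)
  qed (simp add: nthz_eq)
qed simp

lemma poly_at_alt: "poly_at p u = (\<Sum>t\<leftarrow>p. fst t * (\<Prod>i<length u. u ! i ^ nthz (snd t) i))"
  unfolding poly_at_def prod_list_zip_powers
  by (intro arg_cong[of _ _ sum_list] map_cong refl) (auto split: prod.splits)

lemma nthz_add_exps: "nthz (add_exps es fs) i = nthz es i + nthz fs i"
  by (simp add: nthz_eq add_exps_def less_max_iff_disj)

lemma poly_at_pconst [simp]: "poly_at (pconst c) u = c"
  by (simp add: poly_at_alt pconst_def nthz_eq)

lemma poly_at_pvar [simp]: "poly_at (pvar i) u = (if i < length u then u ! i else 1)"
proof -
  have "nthz (replicate i 0 @ [1]) k = (if k = i then 1 else 0 :: nat)" for k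
    by (simp add: nthz_eq nth_append)
  then show ?thesis by (simp add: poly_at_alt pvar_def if_distrib[of "\<lambda>e. _ ^ e"] prod.delta cong: if_cong)
qed

lemma poly_at_padd [simp]: "poly_at (padd p q) u = poly_at p u + poly_at q u"
  by (simp add: poly_at_alt padd_def)

lemma poly_at_pmul [simp]: "poly_at (pmul p q) u = poly_at p u * poly_at q u"
proof (induction p)
  case (Cons s p)
  have "pmul (s # p) q = map (\<lambda>t. (fst s * fst t, add_exps (snd s) (snd t))) q @ pmul p q"
    by (simp add: pmul_def)
  moreover have "poly_at (map (\<lambda>t. (fst s * fst t, add_exps (snd s) (snd t))) q) u = poly_at [s] u * poly_at q u"
    by (induction q) (auto simp: poly_at_alt nthz_add_exps power_add prod.distrib algebra_simps)
  ultimately show ?case using Cons by (simp add: poly_at_alt algebra_simps)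
qed (simp add: pmul_def poly_at_alt)

lemma poly_at_ppow [simp]: "poly_at (ppow p n) u = poly_at p u ^ n"
  by (induction n) auto

lemma poly_at_pprod: "poly_at (pprod ps) u = (\<Prod>p\<leftarrow>ps. poly_at p u)"
  by (induction ps) (auto simp: pprod_def)

lemma poly_at_pprod_upt [simp]: "poly_at (pprod (map f [0..<m])) u = (\<Prod>j<m. poly_at (f j) u)"
  by (simp add: poly_at_pprod interv_sum_list_conv_sum_set_nat prod.list_conv_set_nth lessThan_atLeast0)

text \<open>The range of a parameter is evaluated at the earlier parameters only. A polynomial with
  this syntactic bound has the same value there as at the full list, see
  \<open>poly_at_take\<close>.\<close>

definition vars_below :: "nat \<Rightarrow> ppoly \<Rightarrow> bool" where
  "vars_below b p \<longleftrightarrow> (\<forall>t\<in>set p. length (snd t) \<le> b)"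

lemma vars_below_pconst [simp]: "vars_below b (pconst c)"
  by (simp add: vars_below_def pconst_def)

lemma vars_below_pvar: "i < b \<Longrightarrow> vars_below b (pvar i)"
  by (simp add: vars_below_def pvar_def)

lemma vars_below_padd: "vars_below b p \<Longrightarrow> vars_below b q \<Longrightarrow> vars_below b (padd p q)"
  by (auto simp: vars_below_def padd_def)

lemma vars_below_pmul: "vars_below b p \<Longrightarrow> vars_below b q \<Longrightarrow> vars_below b (pmul p q)"
  by (auto simp: vars_below_def pmul_def add_exps_def)

lemma vars_below_ppow: "vars_below b p \<Longrightarrow> vars_below b (ppow p n)"
  by (induction n) (auto intro: vars_below_pmul)

lemma vars_below_pprod: "(\<And>p. p \<in> set ps \<Longrightarrow> vars_below b p) \<Longrightarrow> vars_below b (pprod ps)"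
  unfolding pprod_def by (induction ps) (auto intro: vars_below_pmul)

lemmas vars_below_intros = vars_below_pconst vars_below_pvar vars_below_padd vars_below_pmul
  vars_below_ppow vars_below_pprod

lemma zip_take_left: "length es \<le> b \<Longrightarrow> zip (take b u) es = zip u es"
proof (induction es arbitrary: b u)
  case (Cons e es)
  then show ?case by (cases u; cases b) auto
qed simp

lemma poly_at_take: "vars_below b p \<Longrightarrow> b \<le> i \<Longrightarrow> poly_at p (take i u) = poly_at p u"
  unfolding poly_at_def vars_below_def
  by (intro arg_cong[of _ _ sum_list] map_cong refl) (auto simp: zip_take_left)


section \<open>The parametric families\<close>

text \<open>
  A datum fixes everything about a family that takes finitely many values. For the \<open>j\<close>-th generator,
  \<open>cls\<close> says where \<open>u\<^sub>j\<close> occurs in the reduced equation (0: nowhere, 1: \<open>U\<close>, 2: \<open>V\<close>, 3: \<open>W\<close>, 4: the generator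
  is not admissible), \<open>mults\<close> is its exponent there, and \<open>fixs\<close> is non-zero if it contributes to a constant
  coordinate, in which case \<open>u\<^sub>j\<close> has the value given by \<open>kap\<close>. The lists \<open>eps\<close> and \<open>sgs\<close> contain the signs of
  the coordinates and of the three monomials. The mode \<open>md\<close> is 2 if some monomial is zero, 0 if all parameters
  in \<open>U\<close> and \<open>V\<close> are 1, and 1 if the parameter \<open>jv\<close> of \<open>V\<close> is divisible by \<open>p\<close>. The linear parameter of \<open>W\<close> is \<open>jw\<close>.
  Residues modulo \<open>md_q\<close> are given by \<open>rho - 1\<close> (of \<open>p\<close>), \<open>rho_inv\<close> (of its inverse) and \<open>res\<close>.
\<close>

datatype dat = Dat (gens: "nat list list") (cls: "nat list") (mults: "nat list") (fixs: "nat list")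
  (eps: "int list") (kap: "nat list") (sgs: "int list") (md: nat) (jv: nat) (jw: nat)
  (md_q: nat) (rho: nat) (rho_inv: nat) (res: "nat list")

type_synonym dat_tuple = "nat list list \<times> nat list \<times> nat list \<times> nat list \<times> int list \<times> nat list \<times> int list
  \<times> nat \<times> nat \<times> nat \<times> nat \<times> nat \<times> nat \<times> nat list"

definition tuple_of_dat :: "dat \<Rightarrow> dat_tuple" where
  "tuple_of_dat d = (gens d, cls d, mults d, fixs d, eps d, kap d, sgs d, md d, jv d, jw d,
    md_q d, rho d, rho_inv d, res d)"

instantiation dat :: enc
begin
definition enc_dat :: "dat \<Rightarrow> nat" where "enc_dat d = enc (tuple_of_dat d)"
instance ..
end

lemma computable_tuple_of_dat: "computable f \<Longrightarrow> computable (\<lambda>x. tuple_of_dat (f x))"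
  by (rule computable_comp[of tuple_of_dat]) (auto intro: computableI[OF ncomp_id] simp: enc_dat_def)

lemma computable_Dat [computable_intros]:
  assumes "computable f1" "computable f2" "computable f3" "computable f4" "computable f5"
    "computable f6" "computable f7" "computable f8" "computable f9" "computable f10"
    "computable f11" "computable f12" "computable f13" "computable f14"
  shows "computable (\<lambda>x. Dat (f1 x) (f2 x) (f3 x) (f4 x) (f5 x) (f6 x) (f7 x) (f8 x) (f9 x) (f10 x)
    (f11 x) (f12 x) (f13 x) (f14 x))"
proof -
  let ?t = "\<lambda>x. (f1 x, f2 x, f3 x, f4 x, f5 x, f6 x, f7 x, f8 x, f9 x, f10 x, f11 x, f12 x, f13 x, f14 x)"
  have "computable ?t" by (intro computable_intros assms)
  then obtain F where "ncomp F" "\<And>x. F (enc x) = enc (?t x)" by (rule computableE) blast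
  then show ?thesis by (intro computableI[of F]) (auto simp: enc_dat_def tuple_of_dat_def)
qed

lemma dat_selectors:
  "gens d = fst (tuple_of_dat d)"
  "cls d = fst (snd (tuple_of_dat d))"
  "mults d = fst (snd (snd (tuple_of_dat d)))"
  "fixs d = fst (snd (snd (snd (tuple_of_dat d))))"
  "eps d = fst (snd (snd (snd (snd (tuple_of_dat d)))))"
  "kap d = fst (snd (snd (snd (snd (snd (tuple_of_dat d))))))"
  "sgs d = fst (snd (snd (snd (snd (snd (snd (tuple_of_dat d)))))))"
  "md d = fst (snd (snd (snd (snd (snd (snd (snd (tuple_of_dat d))))))))"
  "jv d = fst (snd (snd (snd (snd (snd (snd (snd (snd (tuple_of_dat d)))))))))"
  "jw d = fst (snd (snd (snd (snd (snd (snd (snd (snd (snd (tuple_of_dat d))))))))))"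
  "md_q d = fst (snd (snd (snd (snd (snd (snd (snd (snd (snd (snd (tuple_of_dat d)))))))))))"
  "rho d = fst (snd (snd (snd (snd (snd (snd (snd (snd (snd (snd (snd (tuple_of_dat d))))))))))))"
  "rho_inv d = fst (snd (snd (snd (snd (snd (snd (snd (snd (snd (snd (snd (snd (tuple_of_dat d)))))))))))))"
  "res d = snd (snd (snd (snd (snd (snd (snd (snd (snd (snd (snd (snd (snd (tuple_of_dat d)))))))))))))"
  by (simp_all add: tuple_of_dat_def)

lemma computable_selectors [computable_intros]:
  assumes "computable f"
  shows "computable (\<lambda>x. gens (f x))" "computable (\<lambda>x. cls (f x))" "computable (\<lambda>x. mults (f x))"
    "computable (\<lambda>x. fixs (f x))" "computable (\<lambda>x. eps (f x))" "computable (\<lambda>x. kap (f x))"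
    "computable (\<lambda>x. sgs (f x))" "computable (\<lambda>x. md (f x))" "computable (\<lambda>x. jv (f x))"
    "computable (\<lambda>x. jw (f x))" "computable (\<lambda>x. md_q (f x))" "computable (\<lambda>x. rho (f x))"
    "computable (\<lambda>x. rho_inv (f x))" "computable (\<lambda>x. res (f x))"
  unfolding dat_selectors by (intro computable_intros computable_tuple_of_dat assms)+

text \<open>
  With \<open>m\<close> generators there are \<open>3 + 3m\<close> parameters: two for the non-zero integer \<open>k\<close>, then \<open>k\<close>
  itself, and three blocks of length \<open>m\<close>: the \<open>s\<close> in \<open>ps + 1\<close>, the parameters outside \<open>W\<close>, and those in \<open>W\<close>.
\<close>

definition mod_poly :: "dat \<Rightarrow> ppoly" where
  "mod_poly d = padd (pmul (pconst (int (3 * md_q d ^ 2))) (pvar 2)) (pconst (int (rho d) - 1))"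

text \<open>
  For \<open>r\<close> the residue, \<open>p\<close> prime to \<open>q\<close> and \<open>p'\<close> the inverse of \<open>p\<close> modulo \<open>q\<close>, the integers \<open>r p' p + q v\<close> with
  \<open>v\<close> prime to \<open>p\<close> are exactly the integers prime to \<open>p\<close> with residue \<open>r\<close> modulo \<open>q\<close>.
\<close>

definition gen_poly :: "dat \<Rightarrow> nat \<Rightarrow> ppoly" where
  "gen_poly d j =
    (if nthz (cls d) j = 4 then pconst 1
     else if nthz (fixs d) j \<noteq> 0 then pconst (int (nthz (kap d) j))
     else if nthz (cls d) j = 0 then pvar (3 + length (gens d) + j)
     else if nthz (cls d) j = 3 then pvar (3 + 2 * length (gens d) + j)
     else if md d = 0 then pconst 1
     else if nthz (cls d) j = 1 then
       padd (pmul (pconst (int (nthz (res d) j * rho_inv d))) (mod_poly d))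
         (pmul (pconst (int (md_q d))) (pvar (3 + length (gens d) + j)))
     else pmul (if j = jv d then mod_poly d else pconst 1)
       (padd (pmul (pconst (int (md_q d))) (pvar (3 + length (gens d) + j)))
         (pconst (int (nthz (res d) j)))))"

text \<open>For t = 1 and t = 2 these are the monomials U and V.\<close>

definition class_poly :: "dat \<Rightarrow> nat \<Rightarrow> ppoly" where
  "class_poly d t = pprod (map (\<lambda>j. if nthz (cls d) j = t then ppow (gen_poly d j) (nthz (mults d) j)
    else pconst 1) [0..<length (gens d)])"

text \<open>The reduced equation solved for its W term, sign included.\<close>

definition num_poly :: "dat \<Rightarrow> ppoly" where
  "num_poly d = padd (pmul (pconst (- nthz (sgs d) 0)) (class_poly d 1))
    (pmul (pconst (- nthz (sgs d) 1)) (class_poly d 2))"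

text \<open>The part of the W term known before parameter t of W is chosen: its sign, the fixed
  factors and the parameters with smaller index. For t = 0 it is a constant; for t the number of
  generators it is the whole W term without the linear parameter.\<close>

definition den_poly :: "dat \<Rightarrow> nat \<Rightarrow> ppoly" where
  "den_poly d t = pmul (pconst (nthz (sgs d) 2)) (pprod (map (\<lambda>j.
    if nthz (cls d) j = 3 \<and> j \<noteq> jw d \<and> (nthz (fixs d) j \<noteq> 0 \<or> j < t)
    then ppow (gen_poly d j) (nthz (mults d) j) else pconst 1) [0..<length (gens d)]))"

text \<open>Every generator has a slot in each block, so that positions stay uniform; slots without
  a purpose range over the integers. The slot of \<open>jw d\<close> in the last block is such a
  dummy, since \<open>coord_expr\<close> puts the quotient in its place.\<close>

definition param_range :: "dat \<Rightarrow> nat \<Rightarrow> prange" where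
  "param_range d i = (let m = length (gens d) in
    if i < 2 then Integers
    else if i = 2 then Divisors 1 (pmul (padd (pmul (pconst 2) (pvar 0)) (pconst 1))
      (padd (pmul (pconst 3) (pvar 1)) (pconst 1)), pconst 1)
    else if i < 3 + m then Integers
    else if i < 3 + 2 * m then
      if nthz (cls d) (i - (3 + m)) = 1 \<and> nthz (fixs d) (i - (3 + m)) = 0
      then Divisors 1 (padd (pmul (mod_poly d) (pvar (3 + (i - (3 + m))))) (pconst 1), pconst 1)
      else Integers
    else if nthz (cls d) (i - (3 + 2 * m)) = 3 \<and> nthz (fixs d) (i - (3 + 2 * m)) = 0
        \<and> i - (3 + 2 * m) \<noteq> jw d
      then Divisors (nthz (mults d) (i - (3 + 2 * m))) (num_poly d, den_poly d (i - (3 + 2 * m)))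
      else Integers)"

text \<open>The linear parameter is \<open>num_poly\<close> divided by the complete
  \<open>den_poly\<close>; its power contributes to both numerator and denominator of the
  coordinate.\<close>

definition coord_expr :: "dat \<Rightarrow> nat \<Rightarrow> pexpr" where
  "coord_expr d i =
    (pmul (pconst (nthz (eps d) i)) (pprod (map (\<lambda>j.
       ppow (if j = jw d then num_poly d else gen_poly d j) (nthz (hd (drop j (gens d))) i))
         [0..<length (gens d)])),
     if jw d < length (gens d)
     then ppow (den_poly d (length (gens d))) (nthz (hd (drop (jw d) (gens d))) i) else pconst 1)"

definition dat_family :: "nat \<Rightarrow> dat \<Rightarrow> family" where
  "dat_family n d = (map (param_range d) [0..<3 + 3 * length (gens d)], map (coord_expr d) [0..<n])"

lemma computable_mod_poly [computable_intros]: "computable f \<Longrightarrow> computable (\<lambda>x. mod_poly (f x))"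
  unfolding mod_poly_def by (intro computable_intros)

lemma computable_gen_poly [computable_intros]:
  "computable f \<Longrightarrow> computable g \<Longrightarrow> computable (\<lambda>x. gen_poly (f x) (g x))"
  unfolding gen_poly_def by (rule computable_comp2, (intro computable_intros)+)

lemma computable_class_poly [computable_intros]:
  "computable f \<Longrightarrow> computable g \<Longrightarrow> computable (\<lambda>x. class_poly (f x) (g x))"
  unfolding class_poly_def by (rule computable_comp2, (intro computable_intros)+)

lemma computable_num_poly [computable_intros]: "computable f \<Longrightarrow> computable (\<lambda>x. num_poly (f x))"
  unfolding num_poly_def by (intro computable_intros)

lemma computable_den_poly [computable_intros]:
  "computable f \<Longrightarrow> computable g \<Longrightarrow> computable (\<lambda>x. den_poly (f x) (g x))"
  unfolding den_poly_def by (rule computable_comp2, (intro computable_intros)+)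

lemma computable_param_range [computable_intros]:
  "computable f \<Longrightarrow> computable g \<Longrightarrow> computable (\<lambda>x. param_range (f x) (g x))"
  unfolding param_range_def Let_def by (rule computable_comp2, (intro computable_intros)+)

lemma computable_coord_expr [computable_intros]:
  "computable f \<Longrightarrow> computable g \<Longrightarrow> computable (\<lambda>x. coord_expr (f x) (g x))"
  unfolding coord_expr_def by (rule computable_comp2, (intro computable_intros)+)

lemma computable_dat_family [computable_intros]:
  "computable f \<Longrightarrow> computable g \<Longrightarrow> computable (\<lambda>x. dat_family (f x) (g x))"
  unfolding dat_family_def by (rule computable_comp2, (intro computable_intros)+)

text \<open>
  Exponents beyond the list of parameter values are ignored, so \<open>poly_at p []\<close> is the value of \<open>p\<close> with
  all parameters equal to 1. It represents the residue of \<open>num_poly\<close>, which is constant modulo \<open>md_q\<close>.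
\<close>

lemma poly_at_Nil: "poly_at p [] = sum_list (map fst p)"
  by (simp add: poly_at_alt)

lemma vars_below_mono: "vars_below b p \<Longrightarrow> b \<le> c \<Longrightarrow> vars_below c p"
  by (auto simp: vars_below_def)

section \<open>Dependence and values of the polynomials of a datum\<close>

definition gen_exp :: "dat \<Rightarrow> nat \<Rightarrow> nat \<Rightarrow> nat" where
  "gen_exp d j i = nthz (hd (drop j (gens d))) i"

definition adm :: "dat \<Rightarrow> nat \<Rightarrow> int list \<Rightarrow> bool" where
  "adm d b u \<longleftrightarrow> length u = b \<and> (\<forall>i<b. u ! i \<in> range_at (param_range d i) (take i u))"

lemma admissible_iff_adm:
  assumes "b \<le> N"
  shows "admissible (take b (map (param_range d) [0..<N])) u \<longleftrightarrow> adm d b u"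
  using assms by (auto simp: admissible_def adm_def)

lemma vars_below_mod_poly: "3 \<le> b \<Longrightarrow> vars_below b (mod_poly d)"
  unfolding mod_poly_def by (intro vars_below_intros) simp

lemma vars_below_gen_poly:
  assumes "j < length (gens d)" "nthz (cls d) j \<noteq> 3 \<or> nthz (fixs d) j \<noteq> 0"
  shows "vars_below (3 + 2 * length (gens d)) (gen_poly d j)"
  using assms unfolding gen_poly_def
  by (auto intro!: vars_below_intros vars_below_mod_poly)

lemma vars_below_gen_poly_dependent:
  assumes "j < t" "t \<le> length (gens d)"
  shows "vars_below (3 + 2 * length (gens d) + t) (gen_poly d j)"
  using assms unfolding gen_poly_def
  by (auto intro!: vars_below_intros vars_below_mod_poly)

lemma vars_below_class_poly:
  "t \<noteq> 3 \<Longrightarrow> vars_below (3 + 2 * length (gens d)) (class_poly d t)"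
  unfolding class_poly_def
  by (rule vars_below_pprod) (auto intro!: vars_below_ppow vars_below_gen_poly)

lemma vars_below_num_poly: "vars_below (3 + 2 * length (gens d)) (num_poly d)"
  unfolding num_poly_def by (intro vars_below_intros vars_below_class_poly) auto

text \<open>Justifies the order of choice in W: the quotient that bounds parameter t involves only
  parameters that precede it.\<close>

lemma vars_below_den_poly:
  assumes "t \<le> length (gens d)"
  shows "vars_below (3 + 2 * length (gens d) + t) (den_poly d t)"
proof -
  have "vars_below (3 + 2 * length (gens d) + t) (gen_poly d j)"
    if "j < length (gens d)" "nthz (fixs d) j \<noteq> 0 \<or> j < t" for j
    using that vars_below_gen_poly_dependent[OF _ assms]
      vars_below_mono[OF vars_below_gen_poly, of j d "3 + 2 * length (gens d) + t"] by auto
  then show ?thesis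
    unfolding den_poly_def
    by (intro vars_below_pmul vars_below_pconst vars_below_pprod) (auto intro!: vars_below_ppow)
qed

lemma poly_at_class_poly:
  "poly_at (class_poly d t) u = (\<Prod>j<length (gens d). if nthz (cls d) j = t
    then poly_at (gen_poly d j) u ^ nthz (mults d) j else 1)"
  unfolding class_poly_def poly_at_pprod_upt by (rule prod.cong) auto

lemma poly_at_num_poly:
  "poly_at (num_poly d) u =
    - nthz (sgs d) 0 * poly_at (class_poly d 1) u - nthz (sgs d) 1 * poly_at (class_poly d 2) u"
  by (simp add: num_poly_def)

lemma poly_at_den_poly:
  "poly_at (den_poly d t) u = nthz (sgs d) 2 * (\<Prod>j<length (gens d).
    if nthz (cls d) j = 3 \<and> j \<noteq> jw d \<and> (nthz (fixs d) j \<noteq> 0 \<or> j < t)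
    then poly_at (gen_poly d j) u ^ nthz (mults d) j else 1)"
  unfolding den_poly_def poly_at_pmul poly_at_pprod_upt
  by (intro arg_cong2[of _ _ _ _ "(*)"] prod.cong) auto

lemma poly_at_den_poly_Suc:
  assumes "t < length (gens d)"
  shows "poly_at (den_poly d (Suc t)) u = poly_at (den_poly d t) u *
    (if nthz (cls d) t = 3 \<and> t \<noteq> jw d \<and> nthz (fixs d) t = 0
     then poly_at (gen_poly d t) u ^ nthz (mults d) t else 1)"
proof -
  let ?f = "\<lambda>s j. if nthz (cls d) j = 3 \<and> j \<noteq> jw d \<and> (nthz (fixs d) j \<noteq> 0 \<or> j < s)
    then poly_at (gen_poly d j) u ^ nthz (mults d) j else 1"
  have "prod (?f s) {..<length (gens d)} = ?f s t * prod (?f s) ({..<length (gens d)} - {t})" for s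
    using assms by (intro prod.remove) auto
  moreover have "prod (?f (Suc t)) ({..<length (gens d)} - {t}) = prod (?f t) ({..<length (gens d)} - {t})"
    by (intro prod.cong) (auto simp: less_Suc_eq)
  ultimately show ?thesis unfolding poly_at_den_poly by auto
qed

text \<open>Substituting products of generators into a monomial gives each generator the scalar
  product of the two exponent vectors as its exponent.\<close>

lemma monomial_of_products:
  fixes e V :: "nat \<Rightarrow> int"
  shows "(\<Prod>i<k. (e i * (\<Prod>j<m. V j ^ h j i)) ^ A i) =
    (\<Prod>i<k. e i ^ A i) * (\<Prod>j<m. V j ^ (\<Sum>i<k. A i * h j i))"
proof -
  have "(\<Prod>i<k. (\<Prod>j<m. V j ^ h j i) ^ A i) = (\<Prod>i<k. \<Prod>j<m. V j ^ (A i * h j i))"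
    by (simp add: prod_power_distrib power_mult[symmetric] mult.commute)
  also have "\<dots> = (\<Prod>j<m. \<Prod>i<k. V j ^ (A i * h j i))" by (rule prod.swap)
  finally show ?thesis by (simp add: power_mult_distrib prod.distrib power_sum)
qed

text \<open>This is how a family expresses coprimality to p; \<open>ex_dvd_linear\<close> provides
  the converse.\<close>

lemma coprime_of_dvd_Suc_mult: "x dvd p * s + 1 \<Longrightarrow> coprime p x" for p x s :: int
  by (intro coprimeI) (metis dvd_add_right_iff dvd_mult2 dvd_trans)

lemma coprime_add_multiple: "coprime p y \<Longrightarrow> coprime p (r * p + y)" for p y r :: int
  by (intro coprimeI) (metis coprime_common_divisor dvd_add_right_iff dvd_mult)

text \<open>Only fixed generators occur for t = 0, and their polynomials are constants.\<close>

lemma den_poly_0: "poly_at (den_poly d 0) u = poly_at (den_poly d 0) []"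
  unfolding poly_at_den_poly
  by (intro arg_cong2[of _ _ _ _ "(*)"] prod.cong refl) (auto simp: gen_poly_def)

text \<open>A free parameter occurs here only with the factor \<open>md_q d\<close>, and k only with
  the factor \<open>3 * md_q d ^ 2\<close>.\<close>

lemma gen_poly_cong:
  assumes "md d \<noteq> 0" "nthz (cls d) j \<in> {1, 2}" 
  shows "[poly_at (gen_poly d j) u = poly_at (gen_poly d j) []] (mod int (md_q d))"
proof -
  have p: "[poly_at (mod_poly d) u = poly_at (mod_poly d) []] (mod int (md_q d))"
  proof -
    have "poly_at (mod_poly d) u - poly_at (mod_poly d) [] =
        int (md_q d) * (3 * int (md_q d) * (poly_at (pvar 2) u - poly_at (pvar 2) []))"
      by (simp add: mod_poly_def power2_eq_square algebra_simps del: poly_at_pvar)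
    then show ?thesis unfolding cong_iff_dvd_diff by simp
  qed
  have q: "[a + int (md_q d) * b = a' + int (md_q d) * b'] (mod int (md_q d))"
    "[int (md_q d) * b + a = int (md_q d) * b' + a'] (mod int (md_q d))"
    if "[a = a'] (mod int (md_q d))" for a a' b b'
    using that by (simp_all add: cong_def mod_simps)
  show ?thesis
    using assms p unfolding gen_poly_def
    by (auto intro!: q cong_mult cong_refl simp del: poly_at_pvar of_nat_mult)
qed

lemma num_poly_cong:
  assumes "md d \<noteq> 0"
  shows "[poly_at (num_poly d) u = poly_at (num_poly d) []] (mod int (md_q d))"
  unfolding poly_at_num_poly poly_at_class_poly
  by (intro cong_diff cong_mult cong_prod cong_refl) (auto intro!: cong_pow gen_poly_cong[OF assms])

lemma num_poly_mode_0: "md d = 0 \<Longrightarrow> poly_at (num_poly d) u = poly_at (num_poly d) []"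
  unfolding poly_at_num_poly poly_at_class_poly
  by (intro arg_cong2[of _ _ _ _ "(-)"] arg_cong2[of _ _ _ _ "(*)"] prod.cong refl) (auto simp: gen_poly_def)

text \<open>The requirements of mode 1. The constant part of W divides q, so whether it divides the
  numerator depends on residues modulo q. The fixed values in U divide q and p is invertible modulo
  q, hence p is coprime to them. The bound on \<open>rho d\<close> keeps p away from 0 and the
  units.\<close>

definition coprime_data :: "dat \<Rightarrow> bool" where
  "coprime_data d \<longleftrightarrow> md d \<noteq> 0 \<and> md_q d > 0 \<and> poly_at (den_poly d 0) [] dvd int (md_q d) \<and>
     nthz (sgs d) 0 dvd 1 \<and>
     (\<forall>j<length (gens d). nthz (cls d) j = 1 \<and> nthz (fixs d) j \<noteq> 0 \<longrightarrow> nthz (kap d) j dvd md_q d) \<and>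
     rho d < 3 * md_q d ^ 2 \<and> int (md_q d) dvd (int (rho d) - 1) * int (rho_inv d) - 1 \<and>
     jv d < length (gens d) \<and> nthz (cls d) (jv d) = 2 \<and> nthz (fixs d) (jv d) = 0 \<and>
     nthz (mults d) (jv d) > 0"

text \<open>All conditions inspect entries of the datum or evaluate polynomials at
  \<open>[]\<close>. They are therefore decidable and serve as the filter of the algorithm.\<close>

locale main_family =
  fixes d :: dat
  assumes jw_less: "jw d < length (gens d)"
    and jw_class: "nthz (cls d) (jw d) = 3" "nthz (mults d) (jw d) = 1" "nthz (fixs d) (jw d) = 0"
    and den_nonzero: "poly_at (den_poly d 0) [] \<noteq> 0"
    and den_dvd: "poly_at (den_poly d 0) [] dvd poly_at (num_poly d) []"
    and modes: "md d = 0 \<and> poly_at (num_poly d) [] \<noteq> 0 \<or> coprime_data d"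
begin

abbreviation "m \<equiv> length (gens d)"
abbreviation "G j u \<equiv> poly_at (gen_poly d j) u"
abbreviation "NP u \<equiv> poly_at (num_poly d) u"
abbreviation "DP t u \<equiv> poly_at (den_poly d t) u"

text \<open>k divides a product of two non-zero integers, so it is not 0. As
  \<open>rho d - 1\<close>, taken in the integers, lies between -1 and
  \<open>3q\<^sup>2 - 2\<close>, p is at least \<open>3q\<^sup>2 - 1\<close> for positive k and at
  most -2 for negative k. With q at least 1 both bounds have absolute value at least 2.\<close>

lemma mod_poly_at:
  assumes "adm d b u" "3 \<le> b" "md d \<noteq> 0"
  shows "coprime (poly_at (mod_poly d) u) (int (md_q d))" "\<bar>poly_at (mod_poly d) u\<bar> \<ge> 2"
proof -
  let ?p = "poly_at (mod_poly d) u" and ?q = "int (md_q d)"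
  have q: "?q > 0" "rho d < 3 * md_q d ^ 2" "?q dvd (int (rho d) - 1) * int (rho_inv d) - 1"
    using modes assms(3) by (auto simp: coprime_data_def)
  have p: "?p = 3 * ?q ^ 2 * u ! 2 + (int (rho d) - 1)"
    using assms(1,2) by (simp add: mod_poly_def adm_def)
  have len: "2 < length u" "u \<noteq> []" using assms(1,2) by (auto simp: adm_def)
  have "u ! 2 \<in> range_at (param_range d 2) (take 2 u)"
    using assms(1,2) by (simp add: adm_def)
  then have "u ! 2 dvd (2 * u ! 0 + 1) * (3 * u ! 1 + 1)"
    using len by (simp add: param_range_def Let_def D_def value_at_def)
  moreover have "2 * u ! 0 + 1 \<noteq> 0" "3 * u ! 1 + 1 \<noteq> 0" by presburger+
  ultimately have k: "u ! 2 \<noteq> 0" by auto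
  have r: "0 \<le> int (rho d)" "int (rho d) < 3 * ?q ^ 2"
    using q(2) of_nat_less_iff[of "rho d" "3 * md_q d ^ 2", where 'a = int] by simp_all
  have q1: "3 * ?q ^ 2 \<ge> 3" using q(1) one_le_power[of ?q 2] by linarith
  show "\<bar>?p\<bar> \<ge> 2"
  proof (cases "u ! 2 > 0")
    case True
    then have "3 * ?q ^ 2 * 1 \<le> 3 * ?q ^ 2 * u ! 2" using q1 by (intro mult_left_mono) auto
    then show ?thesis using p q1 r by linarith
  next
    case False
    then have "3 * ?q ^ 2 * u ! 2 \<le> 3 * ?q ^ 2 * (- 1)" using q1 k by (intro mult_left_mono) auto
    then show ?thesis using p q1 r by linarith
  qed
  have "[?p * int (rho_inv d) = (int (rho d) - 1) * int (rho_inv d)] (mod ?q)"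
  proof (intro cong_mult cong_refl)
    have "?p - (int (rho d) - 1) = ?q * (3 * ?q * u ! 2)"
      unfolding p by (simp add: power2_eq_square)
    then show "[?p = int (rho d) - 1] (mod ?q)" unfolding cong_iff_dvd_diff by simp
  qed
  also have "[(int (rho d) - 1) * int (rho_inv d) = 1] (mod ?q)"
    using q(3) by (simp add: cong_iff_dvd_diff)
  finally show "coprime ?p ?q"
    unfolding coprime_iff_invertible_int by blast
qed

text \<open>In mode 1, p divides V through the parameter \<open>jv d\<close> and is coprime to every
  factor of U: to the free ones by their ranges, to the fixed ones because they divide q. If the
  numerator vanished, p would divide a number coprime to it and would be a unit.\<close>

lemma num_poly_nonzero:
  assumes "adm d b u" "3 + 2 * m \<le> b"
  shows "NP u \<noteq> 0"
proof (cases "md d = 0")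
  case True
  then show ?thesis using num_poly_mode_0[of d u] modes by (auto simp: coprime_data_def)
next
  case md: False
  let ?p = "poly_at (mod_poly d) u" and ?q = "int (md_q d)"
  note p = mod_poly_at[OF assms(1) _ md]
  have b: "3 \<le> b" using assms(2) by simp
  have jv: "jv d < m" "nthz (cls d) (jv d) = 2" "nthz (fixs d) (jv d) = 0" "nthz (mults d) (jv d) > 0"
    and s: "nthz (sgs d) 0 dvd 1"
    and kap: "\<And>j. j < m \<Longrightarrow> nthz (cls d) j = 1 \<Longrightarrow> nthz (fixs d) j \<noteq> 0 \<Longrightarrow> nthz (kap d) j dvd md_q d"
    using modes md by (auto simp: coprime_data_def)
  have "coprime ?p (G j u)" if j: "j < m" "nthz (cls d) j = 1" for j
  proof (cases "nthz (fixs d) j = 0")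
    case True
    let ?i = "3 + m + j"
    have i: "?i < b" "length u = b" "gens d \<noteq> []" using assms j by (auto simp: adm_def)
    have "u ! ?i \<in> range_at (param_range d ?i) (take ?i u)"
      using assms(1) i by (simp add: adm_def)
    then have "u ! ?i dvd ?p * u ! (3 + j) + 1"
      using j True i poly_at_take[OF vars_below_mod_poly[OF order_refl], of ?i d u]
      by (simp add: param_range_def Let_def D_def value_at_def)
    then have "coprime ?p (u ! ?i)"
      by (rule coprime_of_dvd_Suc_mult)
    then have "coprime ?p (?q * u ! ?i)" using p(1)[OF b] by simp
    moreover have "G j u = int (nthz (res d) j * rho_inv d) * ?p + ?q * u ! ?i"
      using j md True i by (simp add: gen_poly_def)
    ultimately show ?thesis by (simp only: coprime_add_multiple)
  next
    case False
    have "int (nthz (kap d) j) dvd ?q" using kap[OF j False] by simp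
    then have "coprime ?p (int (nthz (kap d) j))"
      using p(1)[OF b] by (meson coprime_divisors dvd_refl)
    then show ?thesis using j False by (simp add: gen_poly_def)
  qed
  then have "coprime ?p (poly_at (class_poly d 1) u)"
    unfolding poly_at_class_poly by (intro prod_coprime_right) auto
  moreover have "coprime ?p (nthz (sgs d) 0)"
    using s by (rule is_unit_right_imp_coprime)
  ultimately have c: "coprime ?p (nthz (sgs d) 0 * poly_at (class_poly d 1) u)" by simp
  have "?p dvd G (jv d) u" using jv md by (simp add: gen_poly_def)
  then have "?p dvd G (jv d) u ^ nthz (mults d) (jv d)"
    using jv(4) dvd_power[of "nthz (mults d) (jv d)" "G (jv d) u"] by (metis dvd_trans)
  then have "?p dvd poly_at (class_poly d 2) u"
    unfolding poly_at_class_poly using jv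
    by (intro dvd_trans[OF _ dvd_prodI[of _ "jv d"]]) auto
  then have "?p dvd nthz (sgs d) 1 * poly_at (class_poly d 2) u" by simp
  moreover have "nthz (sgs d) 0 * poly_at (class_poly d 1) u = - (nthz (sgs d) 1 * poly_at (class_poly d 2) u)"
    if "NP u = 0" using that unfolding poly_at_num_poly by simp
  ultimately have "?p dvd nthz (sgs d) 0 * poly_at (class_poly d 1) u" if "NP u = 0"
    using that by simp
  then have "is_unit ?p" if "NP u = 0"
    using that coprime_common_divisor[OF c dvd_refl] by blast
  then show ?thesis using p(2)[OF b] by auto
qed

text \<open>The numerator is constant in mode 0 and constant modulo a multiple of the denominator in
  mode 1, so divisibility at \<open>[]\<close> carries over to all parameter values.\<close>

lemma den_0_dvd: "DP 0 u dvd NP u"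
proof (cases "md d = 0")
  case True
  then show ?thesis using num_poly_mode_0 den_dvd den_poly_0 by metis
next
  case False
  then have "DP 0 [] dvd int (md_q d)" using modes by (auto simp: coprime_data_def)
  then show ?thesis using num_poly_cong[OF False] den_dvd den_poly_0
    by (metis cong_dvd_iff cong_dvd_modulus)
qed

text \<open>Both claims go through one induction: the range of parameter t means something only if
  the previous denominator is a non-zero divisor of the numerator, and the next denominator is
  non-zero because it divides the non-zero numerator.\<close>

lemma den_poly_dvd:
  assumes "t \<le> m" "adm d b u" "3 + 2 * m + t \<le> b"
  shows "DP t u \<noteq> 0 \<and> DP t u dvd NP u"
  using assms
proof (induction t)
  case 0
  show ?case using den_nonzero den_poly_0 den_0_dvd by metis
next
  case (Suc t)
  then have IH: "DP t u \<noteq> 0" "DP t u dvd NP u" by auto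
  have t: "t < m" using Suc.prems by simp
  show ?case
  proof (cases "nthz (cls d) t = 3 \<and> t \<noteq> jw d \<and> nthz (fixs d) t = 0")
    case True
    let ?i = "3 + 2 * m + t"
    have i: "?i < b" "length u = b" using Suc.prems by (auto simp: adm_def)
    have g: "G t u = u ! ?i" using True i by (simp add: gen_poly_def)
    have "u ! ?i \<in> range_at (param_range d ?i) (take ?i u)"
      using Suc.prems(2) i by (simp add: adm_def)
    then have "u ! ?i ^ nthz (mults d) t dvd NP u div DP t u"
      using True i t poly_at_take[OF vars_below_num_poly, of d ?i u]
        poly_at_take[OF vars_below_den_poly, of t d ?i u]
      by (simp add: param_range_def Let_def D_def value_at_def)
    then have "u ! ?i ^ nthz (mults d) t * DP t u dvd NP u"
      using IH dvd_div_iff_mult[of "DP t u" "NP u" "u ! ?i ^ nthz (mults d) t"] by simp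
    then have "DP (Suc t) u dvd NP u"
      using poly_at_den_poly_Suc[OF t, of u] True g by (simp add: mult.commute)
    moreover have "NP u \<noteq> 0" using num_poly_nonzero[OF Suc.prems(2)] Suc.prems(3) by simp
    ultimately show ?thesis by auto
  next
    case False
    then show ?thesis using IH poly_at_den_poly_Suc[OF t, of u] by auto
  qed
qed

text \<open>The actual values of the generators; at \<open>jw d\<close> the quotient replaces the
  dummy parameter.\<close>

definition V :: "int list \<Rightarrow> nat \<Rightarrow> int" where
  "V u j = (if j = jw d then NP u div DP m u else G j u)"

lemma coord_expr_parts:
  assumes "adm d (3 + 3 * m) u"
  shows "poly_at (snd (coord_expr d i)) u = DP m u ^ gen_exp d (jw d) i"
    "poly_at (fst (coord_expr d i)) u =
      DP m u ^ gen_exp d (jw d) i * (nthz (eps d) i * (\<Prod>j<m. V u j ^ gen_exp d j i))"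
proof -
  have dp: "DP m u \<noteq> 0" "DP m u dvd NP u" using den_poly_dvd[OF order_refl assms] by auto
  show "poly_at (snd (coord_expr d i)) u = DP m u ^ gen_exp d (jw d) i"
    using jw_less by (simp add: coord_expr_def gen_exp_def)
  let ?f = "\<lambda>j. poly_at (if j = jw d then num_poly d else gen_poly d j) u ^ gen_exp d j i"
  have "prod ?f {..<m} = ?f (jw d) * prod ?f ({..<m} - {jw d})"
    using jw_less by (intro prod.remove) auto
  moreover have "(\<Prod>j<m. V u j ^ gen_exp d j i) =
      V u (jw d) ^ gen_exp d (jw d) i * (\<Prod>j\<in>{..<m} - {jw d}. V u j ^ gen_exp d j i)"
    using jw_less by (intro prod.remove) auto
  moreover have "(\<Prod>j\<in>{..<m} - {jw d}. V u j ^ gen_exp d j i) = prod ?f ({..<m} - {jw d})"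
    by (intro prod.cong) (auto simp: V_def)
  moreover have "NP u = DP m u * V u (jw d)" using dp by (simp add: V_def)
  ultimately show "poly_at (fst (coord_expr d i)) u =
      DP m u ^ gen_exp d (jw d) i * (nthz (eps d) i * (\<Prod>j<m. V u j ^ gen_exp d j i))"
    by (simp add: coord_expr_def gen_exp_def power_mult_distrib)
qed

lemma coord_expr_value:
  assumes "adm d (3 + 3 * m) u"
  shows "integral_at (coord_expr d i) u"
    "value_at (coord_expr d i) u = nthz (eps d) i * (\<Prod>j<m. V u j ^ gen_exp d j i)"
  using coord_expr_parts[OF assms] den_poly_dvd[OF order_refl assms]
  by (auto simp: integral_at_def value_at_def)

lemma integer_valued: "integer_valued (dat_family n d)"
proof -
  have "integral_at E u" if j: "j < 3 + 3 * m" "param_range d j = Divisors k E" "adm d j u" for j k E u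
  proof (cases "j < 3 + 2 * m")
    case True
    then show ?thesis using j by (auto simp: param_range_def Let_def integral_at_def split: if_splits)
  next
    case False
    define t where "t = j - (3 + 2 * m)"
    have t: "j = 3 + 2 * m + t" "t < m" using False j(1) by (auto simp: t_def)
    then have "E = (num_poly d, den_poly d t)"
      using j(2) by (auto simp: param_range_def Let_def split: if_splits)
    then show ?thesis using den_poly_dvd[of t j u] t j(3) by (simp add: integral_at_def)
  qed
  moreover have "admissible (map (param_range d) [0..<3 + 3 * m]) u \<longleftrightarrow> adm d (3 + 3 * m) u" for u
    using admissible_iff_adm[OF order_refl, of "3 + 3 * m" d u] by simp
  ultimately show ?thesis
    using coord_expr_value(1) unfolding integer_valued_def dat_family_def
    by (auto simp: admissible_iff_adm)
qed

text \<open>The reduced equation. Since the linear parameter has exponent 1 in W, multiplying it by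
  the complete denominator restores exactly the numerator.\<close>

lemma class_sum:
  assumes "adm d (3 + 3 * m) u"
  shows "nthz (sgs d) 0 * (\<Prod>j<m. if nthz (cls d) j = 1 then V u j ^ nthz (mults d) j else 1) +
    nthz (sgs d) 1 * (\<Prod>j<m. if nthz (cls d) j = 2 then V u j ^ nthz (mults d) j else 1) +
    nthz (sgs d) 2 * (\<Prod>j<m. if nthz (cls d) j = 3 then V u j ^ nthz (mults d) j else 1) = 0"
proof -
  have dp: "DP m u \<noteq> 0" "DP m u dvd NP u" using den_poly_dvd[OF order_refl assms] by auto
  have c: "(\<Prod>j<m. if nthz (cls d) j = t then V u j ^ nthz (mults d) j else 1) = poly_at (class_poly d t) u"
    if "t \<noteq> 3" for t
    unfolding poly_at_class_poly using that jw_class by (intro prod.cong) (auto simp: V_def)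
  let ?f = "\<lambda>j. if nthz (cls d) j = 3 then V u j ^ nthz (mults d) j else 1"
  let ?g = "\<lambda>j. if nthz (cls d) j = 3 \<and> j \<noteq> jw d \<and> (nthz (fixs d) j \<noteq> 0 \<or> j < m)
    then G j u ^ nthz (mults d) j else 1"
  have "prod ?f {..<m} = ?f (jw d) * prod ?f ({..<m} - {jw d})"
    "prod ?g {..<m} = ?g (jw d) * prod ?g ({..<m} - {jw d})"
    using jw_less by (intro prod.remove; auto)+
  moreover have "prod ?f ({..<m} - {jw d}) = prod ?g ({..<m} - {jw d})"
    by (intro prod.cong) (auto simp: V_def)
  ultimately have "prod ?f {..<m} = V u (jw d) * prod ?g {..<m}" using jw_class by simp
  then have "nthz (sgs d) 2 * prod ?f {..<m} = DP m u * V u (jw d)"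
    unfolding poly_at_den_poly by simp
  also have "\<dots> = NP u" using dp by (simp add: V_def)
  finally show ?thesis unfolding poly_at_num_poly by (simp add: c)
qed

end

section \<open>Monomials, classes of generators, and the equation on a family\<close>

definition dot :: "nat list \<Rightarrow> nat list \<Rightarrow> nat" where
  "dot A h = (\<Sum>i<length A. nthz A i * nthz h i)"

definition monom_at :: "nat list \<Rightarrow> int list \<Rightarrow> int" where
  "monom_at A x = (\<Prod>i<length A. nthz x i ^ nthz A i)"

definition fixed_value :: "dat \<Rightarrow> nat \<Rightarrow> int" where
  "fixed_value d j = (if nthz (fixs d) j \<noteq> 0 \<and> nthz (cls d) j \<noteq> 4 then int (nthz (kap d) j) else 1)"

text \<open>The constant coordinates come out right at all parameter values: every generator that
  reaches them is fixed, and the fixed values give the constants.\<close>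

definition consistent :: "nat \<Rightarrow> int list \<Rightarrow> dat \<Rightarrow> bool" where
  "consistent n cs d \<longleftrightarrow> (\<forall>i<length cs.
     nthz (eps d) (n + i) * (\<Prod>j<length (gens d). fixed_value d j ^ gen_exp d j (n + i)) = nthz cs i \<and>
     (\<forall>j<length (gens d). gen_exp d j (n + i) \<noteq> 0 \<longrightarrow> nthz (fixs d) j \<noteq> 0))"

text \<open>Names the exponent that exceeds the common value of the other two. Class 4 means that
  the minimum is attained only once, which cannot happen for the valuations of three non-zero
  integers with sum 0.\<close>

definition class3 :: "nat \<Rightarrow> nat \<Rightarrow> nat \<Rightarrow> nat" where
  "class3 a b c = (if a = b \<and> b = c then 0 else if b = c \<and> b < a then 1 else if a = c \<and> a < b then 2
    else if a = b \<and> b < c then 3 else 4)"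

text \<open>For a generator of class 1, 2 or 3, the exponent that remains in its monomial after
  division by the common factor.\<close>

definition spread :: "nat \<Rightarrow> nat \<Rightarrow> nat \<Rightarrow> nat" where
  "spread a b c = max a (max b c) - min a (min b c)"

definition class_active :: "int \<Rightarrow> int \<Rightarrow> int \<Rightarrow> nat \<Rightarrow> nat \<Rightarrow> nat \<Rightarrow> nat" where
  "class_active s t r a b c =
    (if (s \<noteq> 0 \<and> t \<noteq> 0 \<longrightarrow> a = b) \<and> (s \<noteq> 0 \<and> r \<noteq> 0 \<longrightarrow> a = c) \<and> (t \<noteq> 0 \<and> r \<noteq> 0 \<longrightarrow> b = c)
     then 0 else 4)"

lemma class3_split:
  "class3 a b c \<noteq> 4 \<Longrightarrow>
    a = min a (min b c) + (if class3 a b c = 1 then spread a b c else 0) \<and>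
    b = min a (min b c) + (if class3 a b c = 2 then spread a b c else 0) \<and>
    c = min a (min b c) + (if class3 a b c = 3 then spread a b c else 0)"
  unfolding class3_def spread_def by (simp split: if_splits)

lemma power_class_split:
  fixes v :: int
  assumes "class3 a b c = 4 \<Longrightarrow> v = 1"
  shows "v ^ a = v ^ min a (min b c) * (if class3 a b c = 1 then v ^ spread a b c else 1)"
    "v ^ b = v ^ min a (min b c) * (if class3 a b c = 2 then v ^ spread a b c else 1)"
    "v ^ c = v ^ min a (min b c) * (if class3 a b c = 3 then v ^ spread a b c else 1)"
proof -
  have pw: "v ^ k = v ^ l * (if P then v ^ e else 1)" if "v = 1 \<or> k = l + (if P then e else 0)" for k l e P
    using that by (auto simp: power_add)
  have e: "v = 1 \<or> a = min a (min b c) + (if class3 a b c = 1 then spread a b c else 0)"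
    "v = 1 \<or> b = min a (min b c) + (if class3 a b c = 2 then spread a b c else 0)"
    "v = 1 \<or> c = min a (min b c) + (if class3 a b c = 3 then spread a b c else 0)"
    using assms class3_split by blast+
  show "v ^ a = v ^ min a (min b c) * (if class3 a b c = 1 then v ^ spread a b c else 1)"
    using e(1) by (rule pw)
  show "v ^ b = v ^ min a (min b c) * (if class3 a b c = 2 then v ^ spread a b c else 1)"
    using e(2) by (rule pw)
  show "v ^ c = v ^ min a (min b c) * (if class3 a b c = 3 then v ^ spread a b c else 1)"
    using e(3) by (rule pw)
qed

lemma prod_power_class_split:
  fixes V :: "nat \<Rightarrow> int"
  assumes "\<And>j. j < m \<Longrightarrow> class3 (a j) (b j) (c j) = 4 \<Longrightarrow> V j = 1"
  shows "(\<Prod>j<m. V j ^ a j) = (\<Prod>j<m. V j ^ min (a j) (min (b j) (c j))) *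
      (\<Prod>j<m. if class3 (a j) (b j) (c j) = 1 then V j ^ spread (a j) (b j) (c j) else 1)"
    "(\<Prod>j<m. V j ^ b j) = (\<Prod>j<m. V j ^ min (a j) (min (b j) (c j))) *
      (\<Prod>j<m. if class3 (a j) (b j) (c j) = 2 then V j ^ spread (a j) (b j) (c j) else 1)"
    "(\<Prod>j<m. V j ^ c j) = (\<Prod>j<m. V j ^ min (a j) (min (b j) (c j))) *
      (\<Prod>j<m. if class3 (a j) (b j) (c j) = 3 then V j ^ spread (a j) (b j) (c j) else 1)"
  unfolding prod.distrib[symmetric]
  by (intro prod.cong refl power_class_split; use assms in simp)+

abbreviation gen_dot :: "dat \<Rightarrow> nat list \<Rightarrow> nat \<Rightarrow> nat" where
  "gen_dot d A j \<equiv> dot A (hd (drop j (gens d)))"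

lemma dot_gens: "gen_dot d A j = (\<Sum>i<length A. nthz A i * gen_exp d j i)"
  by (simp add: dot_def gen_exp_def)

text \<open>The values at unfixed generators are arbitrary, because \<open>consistent\<close> keeps
  these generators out of the constant coordinates.\<close>

lemma monom_at_values:
  assumes "consistent n cs d" "length A = n + length cs"
    and "\<And>j. j < length (gens d) \<Longrightarrow> nthz (fixs d) j \<noteq> 0 \<Longrightarrow> W j = fixed_value d j"
  shows "monom_at A (map (\<lambda>i. nthz (eps d) i * (\<Prod>j<length (gens d). W j ^ gen_exp d j i)) [0..<n] @ cs) =
    monom_at A (eps d) * (\<Prod>j<length (gens d). W j ^ gen_dot d A j)"
proof -
  let ?x = "map (\<lambda>i. nthz (eps d) i * (\<Prod>j<length (gens d). W j ^ gen_exp d j i)) [0..<n] @ cs"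
  have "nthz ?x i = nthz (eps d) i * (\<Prod>j<length (gens d). W j ^ gen_exp d j i)"
    if "i < n + length cs" for i
  proof (cases "i < n")
    case True
    then show ?thesis by (simp add: nthz_eq nth_append)
  next
    case False
    define k where "k = i - n"
    have k: "i = n + k" "k < length cs" using False that by (auto simp: k_def)
    have "(\<Prod>j<length (gens d). W j ^ gen_exp d j i) = (\<Prod>j<length (gens d). fixed_value d j ^ gen_exp d j i)"
    proof (intro prod.cong refl)
      fix j assume "j \<in> {..<length (gens d)}"
      then show "W j ^ gen_exp d j i = fixed_value d j ^ gen_exp d j i"
        using assms(1,3) k unfolding consistent_def by (cases "gen_exp d j i = 0") auto
    qed
    then show ?thesis using assms(1) k by (simp add: consistent_def nthz_eq[of ?x] nthz_eq[of cs] nth_append)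
  qed
  then have "monom_at A ?x = (\<Prod>i<length A. (nthz (eps d) i * (\<Prod>j<length (gens d). W j ^ gen_exp d j i)) ^ nthz A i)"
    unfolding monom_at_def using assms(2) by (intro prod.cong refl) simp
  then show ?thesis unfolding monomial_of_products dot_gens by (simp add: monom_at_def)
qed

lemma points_dat_family:
  "points (dat_family n d) =
    {map (\<lambda>i. value_at (coord_expr d i) u) [0..<n] | u. adm d (3 + 3 * length (gens d)) u}"
proof -
  have "admissible (map (param_range d) [0..<3 + 3 * length (gens d)]) u \<longleftrightarrow> adm d (3 + 3 * length (gens d)) u" for u
    using admissible_iff_adm[OF order_refl, of "3 + 3 * length (gens d)" d u] by simp
  then show ?thesis by (simp add: points_def dat_family_def comp_def)
qed

text \<open>The three monomials share the factor formed with the minimal exponents; what remains is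
  \<open>class_sum\<close>.\<close>

lemma (in main_family) points_solve:
  assumes "consistent n cs d"
    and "length A1 = n + length cs" "length A2 = n + length cs" "length A3 = n + length cs"
    and "sgs d = [monom_at A1 (eps d), monom_at A2 (eps d), monom_at A3 (eps d)]"
    and "\<And>j. j < m \<Longrightarrow> nthz (cls d) j = class3 (gen_dot d A1 j) (gen_dot d A2 j)
      (gen_dot d A3 j)"
    and "\<And>j. j < m \<Longrightarrow> nthz (mults d) j = spread (gen_dot d A1 j) (gen_dot d A2 j)
      (gen_dot d A3 j)"
    and "x \<in> points (dat_family n d)"
  shows "length x = n \<and> monom_at A1 (x @ cs) + monom_at A2 (x @ cs) + monom_at A3 (x @ cs) = 0"
proof -
  from assms(8) obtain u where u: "adm d (3 + 3 * m) u" and x: "x = map (\<lambda>i. value_at (coord_expr d i) u) [0..<n]"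
    unfolding points_dat_family by auto
  have x': "x = map (\<lambda>i. nthz (eps d) i * (\<Prod>j<m. V u j ^ gen_exp d j i)) [0..<n]"
    unfolding x using coord_expr_value(2)[OF u] by simp
  have fixed: "V u j = fixed_value d j" if "j < m" "nthz (fixs d) j \<noteq> 0" for j
    using that jw_class by (auto simp: V_def fixed_value_def gen_poly_def)
  let ?dot = "\<lambda>A j. gen_dot d A j"
  let ?c = "\<lambda>j. min (?dot A1 j) (min (?dot A2 j) (?dot A3 j))"
  let ?C = "\<Prod>j<m. V u j ^ ?c j"
  let ?P = "\<lambda>t. \<Prod>j<m. if nthz (cls d) j = t then V u j ^ nthz (mults d) j else 1"
  have V4: "V u j = 1" if "j < m" "nthz (cls d) j = 4" for j
    using that jw_class by (auto simp: V_def gen_poly_def)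
  have P_eq: "?P t = (\<Prod>j<m. if class3 (?dot A1 j) (?dot A2 j) (?dot A3 j) = t
      then V u j ^ spread (?dot A1 j) (?dot A2 j) (?dot A3 j) else 1)" for t
    by (intro prod.cong refl) (simp add: assms(6,7))
  have p: "(\<Prod>j<m. V u j ^ ?dot A1 j) = ?C * ?P 1" "(\<Prod>j<m. V u j ^ ?dot A2 j) = ?C * ?P 2"
    "(\<Prod>j<m. V u j ^ ?dot A3 j) = ?C * ?P 3"
    unfolding P_eq by (rule prod_power_class_split, simp add: V4 assms(6))+
  have v: "monom_at A (map (\<lambda>i. nthz (eps d) i * (\<Prod>j<m. V u j ^ gen_exp d j i)) [0..<n] @ cs) =
      monom_at A (eps d) * (\<Prod>j<m. V u j ^ ?dot A j)" if "length A = n + length cs" for A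
    using assms(1) that fixed by (rule monom_at_values)
  have s: "monom_at A1 (eps d) = nthz (sgs d) 0" "monom_at A2 (eps d) = nthz (sgs d) 1"
    "monom_at A3 (eps d) = nthz (sgs d) 2"
    by (simp_all add: assms(5) nthz_eq)
  have "monom_at A1 (x @ cs) + monom_at A2 (x @ cs) + monom_at A3 (x @ cs) =
      ?C * (nthz (sgs d) 0 * ?P 1 + nthz (sgs d) 1 * ?P 2 + nthz (sgs d) 2 * ?P 3)"
    unfolding x' v[OF assms(2)] v[OF assms(3)] v[OF assms(4)] p s
    by (simp only: distrib_left mult.left_commute)
  then show ?thesis using class_sum[OF u] x by simp
qed

locale degenerate_family =
  fixes d :: dat and A1 A2 A3 :: "nat list"
  assumes jw: "jw d \<ge> length (gens d)"
    and sgs: "sgs d = [monom_at A1 (eps d), monom_at A2 (eps d), monom_at A3 (eps d)]"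
    and sgs_sum: "monom_at A1 (eps d) + monom_at A2 (eps d) + monom_at A3 (eps d) = 0"
    and cls: "j < length (gens d) \<Longrightarrow> nthz (cls d) j =
      class_active (monom_at A1 (eps d)) (monom_at A2 (eps d)) (monom_at A3 (eps d)) (gen_dot d A1 j)
        (gen_dot d A2 j) (gen_dot d A3 j)"
begin

abbreviation "m \<equiv> length (gens d)"

lemma cls_cases: "j < m \<Longrightarrow> nthz (cls d) j = 0 \<or> nthz (cls d) j = 4"
  using cls[of j] by (simp add: class_active_def)

lemma coord_expr_value:
  "integral_at (coord_expr d i) u"
  "value_at (coord_expr d i) u = nthz (eps d) i * (\<Prod>j<m. poly_at (gen_poly d j) u ^ gen_exp d j i)"
proof -
  have "(\<Prod>j<m. poly_at (if j = jw d then num_poly d else gen_poly d j) u ^ gen_exp d j i) =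
      (\<Prod>j<m. poly_at (gen_poly d j) u ^ gen_exp d j i)"
    using jw by (intro prod.cong) auto
  then show "integral_at (coord_expr d i) u"
    "value_at (coord_expr d i) u = nthz (eps d) i * (\<Prod>j<m. poly_at (gen_poly d j) u ^ gen_exp d j i)"
    using jw by (auto simp: integral_at_def value_at_def coord_expr_def gen_exp_def)
qed

lemma param_range_no_class:
  assumes "j < 3 + 3 * m" "j \<noteq> 2"
  shows "param_range d j = Integers"
proof -
  have "nthz (cls d) (j - (3 + m)) \<noteq> 1" if "\<not> j < 3 + m" "j < 3 + 2 * m"
    using cls_cases[of "j - (3 + m)"] that by fastforce
  moreover have "nthz (cls d) (j - (3 + 2 * m)) \<noteq> 3" if "\<not> j < 3 + 2 * m"
    using cls_cases[of "j - (3 + 2 * m)"] that assms(1) by fastforce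
  ultimately show ?thesis using assms(2) unfolding param_range_def Let_def by presburger
qed

lemma integer_valued: "integer_valued (dat_family n d)"
proof -
  have "integral_at E u" if "j < 3 + 3 * m" "param_range d j = Divisors k E" for j k E u
    using that param_range_no_class[OF that(1)]
    by (cases "j = 2") (auto simp: param_range_def integral_at_def Let_def)
  then show ?thesis
    using coord_expr_value(1) by (simp add: integer_valued_def dat_family_def)
qed

lemma points_solve:
  assumes "consistent n cs d"
    and "length A1 = n + length cs" "length A2 = n + length cs" "length A3 = n + length cs"
    and "x \<in> points (dat_family n d)"
  shows "length x = n \<and> monom_at A1 (x @ cs) + monom_at A2 (x @ cs) + monom_at A3 (x @ cs) = 0"
proof -
  let ?s = "\<lambda>A. monom_at A (eps d)"
  let ?dot = "\<lambda>A j. gen_dot d A j"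
  from assms(5) obtain u where u: "adm d (3 + 3 * m) u" and x: "x = map (\<lambda>i. value_at (coord_expr d i) u) [0..<n]"
    unfolding points_dat_family by auto
  let ?V = "\<lambda>j. poly_at (gen_poly d j) u"
  have x': "x = map (\<lambda>i. nthz (eps d) i * (\<Prod>j<m. ?V j ^ gen_exp d j i)) [0..<n]"
    unfolding x using coord_expr_value(2) by simp
  have fixed: "?V j = fixed_value d j" if "j < m" "nthz (fixs d) j \<noteq> 0" for j
    using that by (auto simp: fixed_value_def gen_poly_def)
  have V4: "?V j = 1" if "j < m" "nthz (cls d) j = 4" for j
    using that by (auto simp: gen_poly_def)
  define e where "e j = (if ?s A1 \<noteq> 0 then ?dot A1 j else if ?s A2 \<noteq> 0 then ?dot A2 j else ?dot A3 j)" for j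
  have pw: "?V j ^ ?dot A j = ?V j ^ e j" if "j < m" "A \<in> {A1, A2, A3}" "?s A \<noteq> 0" for A j
  proof (cases "nthz (cls d) j = 4")
    case True
    then show ?thesis using V4 that by simp
  next
    case False
    then have "?dot A j = e j"
      using cls[OF that(1)] that(2,3) unfolding class_active_def e_def
      by (auto split: if_splits)
    then show ?thesis by simp
  qed
  have eq: "?s A * (\<Prod>j<m. ?V j ^ ?dot A j) = ?s A * (\<Prod>j<m. ?V j ^ e j)" if "A \<in> {A1, A2, A3}" for A
  proof (cases "?s A = 0")
    case False
    have "(\<Prod>j<m. ?V j ^ ?dot A j) = (\<Prod>j<m. ?V j ^ e j)"
      by (rule prod.cong[OF refl], rule pw[OF _ that False]) simp
    then show ?thesis by simp
  qed simp
  have v: "monom_at A (x @ cs) = ?s A * (\<Prod>j<m. ?V j ^ ?dot A j)" if "length A = n + length cs" for A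
    unfolding x' using assms(1) that fixed by (rule monom_at_values)
  have "monom_at A (x @ cs) = ?s A * (\<Prod>j<m. ?V j ^ e j)" if "A \<in> {A1, A2, A3}" for A
    unfolding eq[OF that, symmetric] by (rule v) (use that assms(2-4) in auto)
  then have "monom_at A1 (x @ cs) + monom_at A2 (x @ cs) + monom_at A3 (x @ cs) =
      (?s A1 + ?s A2 + ?s A3) * (\<Prod>j<m. ?V j ^ e j)"
    by (simp add: algebra_simps)
  then show ?thesis using sgs_sum x by simp
qed

end

section \<open>Generators of the cones\<close>

text \<open>
  Adding the elements in a suitable order keeps all partial sums in \<open>{-K..K}\<close>, so after \<open>2K + 1\<close> steps
  some partial sum repeats and the elements in between have sum zero.
\<close>

lemma balanced_prefix:
  fixes w :: "'i \<Rightarrow> int"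
  assumes "(\<Sum>i\<in>#M. w i) = 0" "\<And>i. i \<in># M \<Longrightarrow> \<bar>w i\<bar> \<le> K" "0 \<le> K" "t \<le> size M"
  shows "\<exists>xs. length xs = t \<and> mset xs \<subseteq># M \<and> (\<forall>s\<le>t. \<bar>\<Sum>i\<leftarrow>take s xs. w i\<bar> \<le> K)"
  using assms(4)
proof (induction t)
  case (Suc t)
  then obtain xs where xs: "length xs = t" "mset xs \<subseteq># M" "\<forall>s\<le>t. \<bar>\<Sum>i\<leftarrow>take s xs. w i\<bar> \<le> K"
    by auto
  define R where "R = M - mset xs"
  have "size R = size M - t" using xs(1,2) by (simp add: R_def size_Diff_submset)
  then have R: "R \<noteq> {#}" using Suc.prems by auto
  have M: "M = mset xs + R" using xs(2) by (simp add: R_def)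
  define s where "s = (\<Sum>i\<leftarrow>xs. w i)"
  have sR: "(\<Sum>i\<in>#R. w i) = - s"
    using assms(1) unfolding M s_def by (simp add: sum_mset_sum_list flip: mset_map)
  have neg: "(\<Sum>i\<in>#Q. w i) < 0" if "Q \<noteq> {#}" "\<forall>i\<in>#Q. w i < 0" for Q
    using that
  proof (induction Q)
    case (add x Q)
    then show ?case by (cases "Q = {#}") (auto intro: add_neg_neg)
  qed simp
  have nonneg: "(\<Sum>i\<in>#Q. w i) \<ge> 0" if "\<forall>i\<in>#Q. w i \<ge> 0" for Q
    using that by (induction Q) auto
  \<comment> \<open>The remaining elements have sum -s, so one of them moves the partial sum back
    towards 0.\<close>
  obtain i where i: "i \<in># R" "\<bar>s + w i\<bar> \<le> K"
  proof (cases "s \<le> 0")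
    case True
    then obtain i where "i \<in># R" "w i \<ge> 0" using neg[OF R] sR by force
    then show ?thesis using that[of i] True xs(3)[rule_format, of t] assms(2)[of i] xs(1)
      by (auto simp: s_def M)
  next
    case False
    then obtain i where "i \<in># R" "w i < 0" using nonneg[of R] sR by force
    then show ?thesis using that[of i] False xs(3)[rule_format, of t] assms(2)[of i] xs(1)
      by (auto simp: s_def M)
  qed
  have "mset (xs @ [i]) \<subseteq># M" using i(1) by (simp add: M)
  moreover have "\<bar>\<Sum>i\<leftarrow>take r (xs @ [i]). w i\<bar> \<le> K" if "r \<le> Suc t" for r
    using xs(1,3) i(2) that by (cases "r \<le> t") (auto simp: s_def le_Suc_eq)
  ultimately show ?case using xs(1) by (intro exI[of _ "xs @ [i]"]) auto
qed (use assms(3) in auto)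

lemma zero_sum_pieces:
  fixes w :: "'i \<Rightarrow> int"
  assumes "(\<Sum>i\<in>#M. w i) = 0" "\<And>i. i \<in># M \<Longrightarrow> \<bar>w i\<bar> \<le> int K"
  shows "\<exists>P. \<Sum>\<^sub># P = M \<and> (\<forall>X\<in>#P. (\<Sum>i\<in>#X. w i) = 0 \<and> size X \<le> 2 * K + 1)"
  using assms
proof (induction "size M" arbitrary: M rule: less_induct)
  case less
  show ?case
  proof (cases "size M \<le> 2 * K + 1")
    case True
    then show ?thesis using less.prems by (intro exI[of _ "{#M#}"]) auto
  next
    case False
    then obtain xs where xs: "length xs = 2 * K + 1" "mset xs \<subseteq># M"
        "\<forall>s\<le>2 * K + 1. \<bar>\<Sum>i\<leftarrow>take s xs. w i\<bar> \<le> int K"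
      using balanced_prefix[OF less.prems, of "2 * K + 1"] by auto
    let ?f = "\<lambda>s. \<Sum>i\<leftarrow>take s xs. w i"
    \<comment> \<open>There are 2K + 2 prefixes, counting the empty one, but only 2K + 1 possible
      sums.\<close>
    have "?f ` {..2 * K + 1} \<subseteq> {- int K..int K}" using xs(3) by (auto simp: abs_le_iff)
    then have "card (?f ` {..2 * K + 1}) \<le> card {- int K..int K}" by (rule card_mono[rotated]) simp
    then have "\<not> inj_on ?f {..2 * K + 1}" by (intro pigeonhole) simp
    then obtain s t where st: "s < t" "t \<le> 2 * K + 1" "?f s = ?f t"
      by (auto simp: inj_on_def) (metis linorder_neqE_nat)
    define X where "X = mset (drop s (take t xs))"
    have take_t: "take t xs = take s xs @ drop s (take t xs)"
      using st(1) by (metis append_take_drop_id min.strict_order_iff take_take)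
    then have "?f t = ?f s + (\<Sum>i\<leftarrow>drop s (take t xs). w i)"
      by (metis map_append sum_list_append)
    then have X0: "(\<Sum>i\<in>#X. w i) = 0"
      using st(3) by (simp add: X_def sum_mset_sum_list flip: mset_map)
    have X_sub: "X \<subseteq># M"
      using xs(2) unfolding X_def by (metis append_take_drop_id mset_append mset_subset_eq_add_left
          mset_subset_eq_add_right subset_mset.order_trans take_t)
    have X_size: "size X \<le> 2 * K + 1" "size X > 0" using st xs(1) by (auto simp: X_def)
    have "size (M - X) < size M" using X_sub X_size by (simp add: size_Diff_submset size_mset_mono less_le_trans)
    moreover have "(\<Sum>i\<in>#M - X. w i) = 0"
      using less.prems(1) X0 X_sub by (metis add_cancel_left_left image_mset_union subset_mset.diff_add sum_mset.union add.right_neutral)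
    ultimately obtain P where "\<Sum>\<^sub># P = M - X" "\<forall>Y\<in>#P. (\<Sum>i\<in>#Y. w i) = 0 \<and> size Y \<le> 2 * K + 1"
      using less.hyps[of "M - X"] less.prems(2) by (meson in_diffD)
    then show ?thesis using X0 X_sub X_size by (intro exI[of _ "add_mset X P"]) auto
  qed
qed

text \<open>\<open>zero_sum_pieces\<close> is applied twice. For the equation it gives pieces of at
  most 2K + 1 elements, whose weights for the inequality are at most K(2K + 1) in absolute value.
  With this number in place of K it groups at most 2K(2K + 1) + 1 such pieces.\<close>

definition gen_bound :: "nat \<Rightarrow> nat" where
  "gen_bound K = (2 * K + 1) * (2 * (K * (2 * K + 1)) + 1)"

lemma abs_sum_mset_le:
  fixes w :: "'i \<Rightarrow> int"
  shows "(\<And>i. i \<in># X \<Longrightarrow> \<bar>w i\<bar> \<le> K) \<Longrightarrow> \<bar>\<Sum>i\<in>#X. w i\<bar> \<le> K * int (size X)"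
proof (induction X)
  case (add x X)
  then show ?case by (simp add: algebra_simps) (smt (verit) add.prems add.IH)
qed simp

lemma size_Sum_mset_le:
  fixes Q :: "'i multiset multiset"
  shows "(\<And>Y. Y \<in># Q \<Longrightarrow> size Y \<le> b) \<Longrightarrow> size (\<Sum>\<^sub># Q) \<le> b * size Q"
  by (induction Q) (auto simp: add_mono)

lemma sum_mset_Sum_mset: "(\<Sum>i\<in>#\<Sum>\<^sub># Q. w i) = (\<Sum>Y\<in>#Q. \<Sum>i\<in>#Y. w i)"
  by (induction Q) auto

text \<open>The inequality is turned into an equation by adding slack elements \<open>None\<close> of weight \<open>-1\<close>.\<close>

lemma cone_pieces:
  fixes l k :: "'i \<Rightarrow> int"
  assumes "(\<Sum>i\<in>#M. l i) = 0" "(\<Sum>i\<in>#M. k i) \<ge> 0"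
    and "\<And>i. i \<in># M \<Longrightarrow> \<bar>l i\<bar> \<le> int K \<and> \<bar>k i\<bar> \<le> int K" "K \<ge> 1"
  shows "\<exists>P. \<Sum>\<^sub># P = M \<and>
    (\<forall>X\<in>#P. (\<Sum>i\<in>#X. l i) = 0 \<and> (\<Sum>i\<in>#X. k i) \<ge> 0 \<and> size X \<le> gen_bound K)"
proof -
  define M' where "M' = image_mset Some M + replicate_mset (nat (\<Sum>i\<in>#M. k i)) None"
  define l' where "l' = (\<lambda>x. case x of Some i \<Rightarrow> l i | None \<Rightarrow> 0)"
  define k' where "k' = (\<lambda>x. case x of Some i \<Rightarrow> k i | None \<Rightarrow> -1)"
  define f where "f Z = image_mset the (filter_mset (\<lambda>x. x \<noteq> None) Z)" for Z :: "'i option multiset"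
  have "filter_mset (\<lambda>x. x \<noteq> None) (replicate_mset n (None :: 'i option)) = {#}" for n
    by (induction n) auto
  then have f_M': "f M' = M"
    unfolding f_def M'_def by (simp add: filter_mset_image_mset multiset.map_comp comp_def)
  \<comment> \<open>Dropping the slack elements leaves the \<open>l\<close>-sum unchanged and can
    only raise the \<open>k\<close>-sum.\<close>
  have f_sum: "(\<Sum>i\<in>#f Z. l i) = (\<Sum>x\<in>#Z. l' x)" "(\<Sum>i\<in>#f Z. k i) \<ge> (\<Sum>x\<in>#Z. k' x)" for Z
    unfolding f_def l'_def k'_def by (induction Z) (auto split: option.splits)
  have f_Sum: "f (\<Sum>\<^sub># Q) = \<Sum>\<^sub># (image_mset f Q)" for Q
    unfolding f_def by (induction Q) auto
  have bounds: "\<bar>l' x\<bar> \<le> int K \<and> \<bar>k' x\<bar> \<le> int K" if "x \<in># M'" for x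
    using that assms(3,4) by (auto simp: M'_def l'_def k'_def split: if_splits)
  have l0: "(\<Sum>x\<in>#M'. l' x) = 0"
    using assms(1) by (simp add: M'_def l'_def image_mset.compositionality comp_def)
  have k0: "(\<Sum>x\<in>#M'. k' x) = 0"
    using assms(2) by (simp add: M'_def k'_def image_mset.compositionality comp_def)
  obtain P1 where P1: "\<Sum>\<^sub># P1 = M'" "\<forall>X\<in>#P1. (\<Sum>x\<in>#X. l' x) = 0 \<and> size X \<le> 2 * K + 1"
    using zero_sum_pieces[of l' M' K] l0 bounds by blast
  have "\<bar>\<Sum>x\<in>#X. k' x\<bar> \<le> int (K * (2 * K + 1))" if X: "X \<in># P1" for X
  proof -
    have "\<bar>k' x\<bar> \<le> int K" if "x \<in># X" for x
      using bounds X that P1(1) by (metis in_Union_mset_iff)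
    then have "\<bar>\<Sum>x\<in>#X. k' x\<bar> \<le> int K * int (size X)" by (rule abs_sum_mset_le)
    also have "\<dots> \<le> int K * int (2 * K + 1)" using P1(2) X by (intro mult_left_mono) auto
    finally show ?thesis by (simp only: of_nat_mult)
  qed
  moreover have "(\<Sum>X\<in>#P1. \<Sum>x\<in>#X. k' x) = 0"
    using k0 unfolding P1(1)[symmetric] sum_mset_Sum_mset .
  \<comment> \<open>The pieces in \<open>P1\<close> now act as elements, weighted by their
    \<open>k'\<close>-sums.\<close>
  ultimately obtain P2 where P2: "\<Sum>\<^sub># P2 = P1"
    "\<forall>Q\<in>#P2. (\<Sum>X\<in>#Q. \<Sum>x\<in>#X. k' x) = 0 \<and> size Q \<le> 2 * (K * (2 * K + 1)) + 1"
    using zero_sum_pieces[of "\<lambda>X. \<Sum>x\<in>#X. k' x" P1 "K * (2 * K + 1)"] by blast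
  define P where "P = image_mset (\<lambda>Q. f (\<Sum>\<^sub># Q)) P2"
  have "\<Sum>\<^sub># P = f (\<Sum>\<^sub># (\<Sum>\<^sub># P2))"
    unfolding P_def f_Sum by (induction P2) auto
  then have "\<Sum>\<^sub># P = M" using P2(1) P1(1) f_M' by simp
  moreover have "(\<Sum>i\<in>#X. l i) = 0 \<and> (\<Sum>i\<in>#X. k i) \<ge> 0 \<and> size X \<le> gen_bound K" if "X \<in># P" for X
  proof -
    obtain Q where Q: "Q \<in># P2" "X = f (\<Sum>\<^sub># Q)" using \<open>X \<in># P\<close> by (auto simp: P_def)
    have sub: "Y \<in># P1" if "Y \<in># Q" for Y using Q(1) that P2(1) by (metis in_Union_mset_iff)
    have "(\<Sum>Y\<in>#Q. \<Sum>x\<in>#Y. l' x) = 0" using sub P1(2) by (simp add: sum_mset.neutral)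
    moreover have "size (\<Sum>\<^sub># Q) \<le> (2 * K + 1) * size Q" using sub P1(2) by (intro size_Sum_mset_le) auto
    moreover have "(2 * K + 1) * size Q \<le> gen_bound K"
      unfolding gen_bound_def using P2(2) Q(1) by (intro mult_left_mono) auto
    moreover have "size X \<le> size (\<Sum>\<^sub># Q)" unfolding Q(2) f_def size_image_mset
      by (rule size_filter_mset_lesseq)
    ultimately show ?thesis
      using f_sum[of "\<Sum>\<^sub># Q"] P2(2) Q unfolding sum_mset_Sum_mset by auto
  qed
  ultimately show ?thesis by blast
qed

lemma count_Sum_as_combination:
  assumes "\<And>X. X \<in># P \<Longrightarrow> map (count X) [0..<\<nu>] \<in> set H"
  shows "\<exists>c. (\<forall>i<\<nu>. count (\<Sum>\<^sub># P) i = (\<Sum>j<length H. c j * nthz (H ! j) i)) \<and>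
    (\<forall>j<length H. c j > 0 \<longrightarrow> (\<exists>X\<in>#P. H ! j = map (count X) [0..<\<nu>]))"
  using assms
proof (induction P)
  case empty
  show ?case by (intro exI[of _ "\<lambda>_. 0"]) auto
next
  case (add X P)
  then obtain c where c: "\<forall>i<\<nu>. count (\<Sum>\<^sub># P) i = (\<Sum>j<length H. c j * nthz (H ! j) i)"
    "\<forall>j<length H. c j > 0 \<longrightarrow> (\<exists>X\<in>#P. H ! j = map (count X) [0..<\<nu>])" by auto
  obtain k where k: "k < length H" "H ! k = map (count X) [0..<\<nu>]"
    using add.prems[of X] by (auto simp: in_set_conv_nth)
  have "(\<Sum>j<length H. (c(k := Suc (c k))) j * nthz (H ! j) i) =
      nthz (H ! k) i + (\<Sum>j<length H. c j * nthz (H ! j) i)" for i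
  proof -
    have "(\<Sum>j<length H. (c(k := Suc (c k))) j * nthz (H ! j) i) =
        (\<Sum>j<length H. (if j = k then nthz (H ! k) i else 0) + c j * nthz (H ! j) i)"
      by (intro sum.cong) auto
    then show ?thesis using k(1) by (simp add: sum.distrib)
  qed
  then show ?case using c k by (intro exI[of _ "c(k := Suc (c k))"]) (auto simp: nthz_eq)
qed

text \<open>\<open>v\<close> is read as the multiset in which the index i occurs
  \<open>nthz v i\<close> times, with weight \<open>A - B\<close> for the equation and
  \<open>C - A\<close> for the inequality. The counts of a piece form a vector in the box
  \<open>H\<close>.\<close>

lemma cone_generators:
  assumes "length v = \<nu>" "length A = \<nu>" "length B = \<nu>" "length C = \<nu>"
    and "\<And>i. nthz A i \<le> K" "\<And>i. nthz B i \<le> K" "\<And>i. nthz C i \<le> K" "K \<ge> 1"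
    and "dot A v = dot B v" "dot A v \<le> dot C v"
    and H: "H = List.n_lists \<nu> [0..<Suc (gen_bound K)]"
  shows "\<exists>c. (\<forall>i<\<nu>. nthz v i = (\<Sum>j<length H. c j * nthz (H ! j) i)) \<and>
    (\<forall>j<length H. c j > 0 \<longrightarrow> dot A (H ! j) = dot B (H ! j) \<and> dot A (H ! j) \<le> dot C (H ! j))"
proof -
  define M where "M = (\<Sum>i<\<nu>. replicate_mset (nthz v i) i)"
  have count_M: "count M i = (if i < \<nu> then nthz v i else 0)" for i
    by (simp add: M_def count_sum)
  then have M_less: "i < \<nu>" if "i \<in># M" for i using that by (metis count_greater_zero_iff less_irrefl)
  have wsum: "(\<Sum>i\<in>#X. int (nthz D i) - int (nthz E i)) =
      int (dot D (map (count X) [0..<\<nu>])) - int (dot E (map (count X) [0..<\<nu>]))"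
    if "\<And>i. i \<in># X \<Longrightarrow> i < \<nu>" "length D = \<nu>" "length E = \<nu>" for X D E
  proof -
    have "(\<Sum>i\<in>#X. int (nthz D i)) = int (\<Sum>i<\<nu>. nthz D i * count X i)"
      if "\<And>i. i \<in># X \<Longrightarrow> i < \<nu>" for D
      using that
    proof (induction X)
      case (add x X)
      have "(\<Sum>i<\<nu>. nthz D i * count (add_mset x X) i) =
          (\<Sum>i<\<nu>. (if i = x then nthz D x else 0) + nthz D i * count X i)"
        by (intro sum.cong) auto
      then show ?case using add by (simp add: sum.distrib)
    qed simp
    moreover have "(\<Sum>i<\<nu>. nthz D i * count X i) = dot D (map (count X) [0..<\<nu>])" if "length D = \<nu>" for D
      unfolding dot_def that by (intro sum.cong) (auto simp: nthz_eq)
    moreover have "(\<Sum>i\<in>#X. f i - g i) = (\<Sum>i\<in>#X. f i) - (\<Sum>i\<in>#X. g i)" for f g :: "nat \<Rightarrow> int"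
      by (induction X) auto
    ultimately show ?thesis using that by (simp del: of_nat_sum)
  qed
  have v: "map (count M) [0..<\<nu>] = v"
    using assms(1) by (intro nth_equalityI) (auto simp: count_M nthz_eq)
  have "\<exists>P. \<Sum>\<^sub># P = M \<and> (\<forall>X\<in>#P. (\<Sum>i\<in>#X. int (nthz A i) - int (nthz B i)) = 0 \<and>
      (\<Sum>i\<in>#X. int (nthz C i) - int (nthz A i)) \<ge> 0 \<and> size X \<le> gen_bound K)"
  proof (rule cone_pieces)
    show "(\<Sum>i\<in>#M. int (nthz A i) - int (nthz B i)) = 0" "(\<Sum>i\<in>#M. int (nthz C i) - int (nthz A i)) \<ge> 0"
      using assms(9,10) by (simp_all add: wsum[OF M_less] assms(2-4) v)
    show "\<bar>int (nthz A i) - int (nthz B i)\<bar> \<le> int K \<and> \<bar>int (nthz C i) - int (nthz A i)\<bar> \<le> int K" for i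
      using assms(5-7)[of i] by linarith
  qed fact
  then obtain P where P: "\<Sum>\<^sub># P = M" "\<And>X. X \<in># P \<Longrightarrow> (\<Sum>i\<in>#X. int (nthz A i) - int (nthz B i)) = 0 \<and>
      (\<Sum>i\<in>#X. int (nthz C i) - int (nthz A i)) \<ge> 0 \<and> size X \<le> gen_bound K" by blast
  have X_less: "i < \<nu>" if "X \<in># P" "i \<in># X" for X i
    using that P(1) M_less by (metis in_Union_mset_iff)
  have "map (count X) [0..<\<nu>] \<in> set H" if "X \<in># P" for X
  proof -
    have "count X i < Suc (gen_bound K)" for i using P(2)[OF that] count_le_size[of X i] by linarith
    then show ?thesis unfolding H set_n_lists by (simp add: image_subset_iff del: upt_Suc)
  qed
  then obtain c where c: "\<forall>i<\<nu>. count M i = (\<Sum>j<length H. c j * nthz (H ! j) i)"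
    "\<forall>j<length H. c j > 0 \<longrightarrow> (\<exists>X\<in>#P. H ! j = map (count X) [0..<\<nu>])"
    using count_Sum_as_combination[of P \<nu> H] P(1) by blast
  have "dot A (H ! j) = dot B (H ! j) \<and> dot A (H ! j) \<le> dot C (H ! j)" if j: "j < length H" "c j > 0" for j
  proof -
    obtain X where X: "X \<in># P" "H ! j = map (count X) [0..<\<nu>]" using c(2) j by blast
    then show ?thesis using P(2)[OF X(1)] by (simp add: wsum[OF X_less[OF X(1)]] assms(2-4))
  qed
  moreover have "\<forall>i<\<nu>. nthz v i = (\<Sum>j<length H. c j * nthz (H ! j) i)" using c(1) by (simp add: count_M)
  ultimately show ?thesis by blast
qed

section \<open>Decomposition of a solution\<close>

text \<open>The multiplicity in 0 is 0 by convention, so a zero coordinate contributes nothing here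
  and is recorded by its sign alone.\<close>

definition vals :: "nat \<Rightarrow> int list \<Rightarrow> nat list" where
  "vals p x = map (\<lambda>y. multiplicity p (nat \<bar>y\<bar>)) x"

lemma nthz_vals: "nthz (vals p x) i = (if i < length x then multiplicity p (nat \<bar>nthz x i\<bar>) else 0)"
  by (simp add: vals_def nthz_eq)

lemma monom_at_nonzero_iff:
  "monom_at A x \<noteq> 0 \<longleftrightarrow> (\<forall>i<length A. nthz A i \<noteq> 0 \<longrightarrow> nthz x i \<noteq> 0)"
  by (auto simp: monom_at_def)

lemma multiplicity_monom_at:
  assumes "prime p" "monom_at A x \<noteq> 0" "length A = length x"
  shows "multiplicity p (nat \<bar>monom_at A x\<bar>) = dot A (vals p x)"
proof -
  have "nat \<bar>monom_at A x\<bar> = (\<Prod>i<length A. nat \<bar>nthz x i\<bar> ^ nthz A i)"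
  proof -
    have "\<bar>monom_at A x\<bar> = int (\<Prod>i<length A. nat \<bar>nthz x i\<bar> ^ nthz A i)"
      unfolding monom_at_def by (simp add: abs_prod power_abs)
    then show ?thesis by linarith
  qed
  moreover have nz: "nat \<bar>nthz x i\<bar> ^ nthz A i \<noteq> 0" if "i < length A" for i
    using assms(2) that by (auto simp: monom_at_nonzero_iff)
  ultimately have "multiplicity p (nat \<bar>monom_at A x\<bar>) =
      (\<Sum>i<length A. multiplicity p (nat \<bar>nthz x i\<bar> ^ nthz A i))"
    using assms(1) by (simp only:) (intro prime_elem_multiplicity_prod_distrib, auto)
  also have "\<dots> = dot A (vals p x)"
    unfolding dot_def
  proof (intro sum.cong refl)
    fix i assume "i \<in> {..<length A}"
    then have "i < length A" by simp
    then show "multiplicity p (nat \<bar>nthz x i\<bar> ^ nthz A i) = nthz A i * nthz (vals p x) i"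
      using assms nz[of i]
      by (cases "nthz A i = 0") (auto simp: nthz_vals prime_elem_multiplicity_power_distrib)
  qed
  finally show ?thesis .
qed

lemma multiplicity_sum_zero:
  fixes X Y Z :: int
  assumes "X + Y + Z = 0" "X \<noteq> 0" "Y \<noteq> 0" "Z \<noteq> 0" "prime p"
  shows "min (multiplicity p (nat \<bar>X\<bar>)) (multiplicity p (nat \<bar>Y\<bar>)) \<le> multiplicity p (nat \<bar>Z\<bar>)"
proof -
  let ?k = "min (multiplicity p (nat \<bar>X\<bar>)) (multiplicity p (nat \<bar>Y\<bar>))"
  have "p ^ ?k dvd nat \<bar>X\<bar>" "p ^ ?k dvd nat \<bar>Y\<bar>" by (intro multiplicity_dvd'; simp)+
  then have "int (p ^ ?k) dvd X" "int (p ^ ?k) dvd Y" by (simp_all only: dvd_nat_abs_iff)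
  then have "int (p ^ ?k) dvd - (X + Y)" by (simp only: dvd_minus_iff dvd_add)
  moreover have "- (X + Y) = Z" using assms(1) by simp
  ultimately have "p ^ ?k dvd nat \<bar>Z\<bar>" by (simp only: dvd_nat_abs_iff)
  then show ?thesis
    using assms(4,5) by (intro multiplicity_geI) (auto dest: prime_gt_1_nat)
qed

definition primes_of :: "int list \<Rightarrow> nat set" where
  "primes_of x = (\<Union>y\<in>set x. prime_factors (nat \<bar>y\<bar>))"

lemma finite_primes_of [simp]: "finite (primes_of x)"
  by (simp add: primes_of_def)

lemma prime_primes_of: "p \<in> primes_of x \<Longrightarrow> prime p"
  by (auto simp: primes_of_def)

lemma nat_abs_eq_prod_primes_of:
  assumes "y \<in> set x" "y \<noteq> 0"
  shows "nat \<bar>y\<bar> = (\<Prod>p\<in>primes_of x. p ^ multiplicity p (nat \<bar>y\<bar>))"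
proof -
  have "(\<Prod>p\<in>prime_factors (nat \<bar>y\<bar>). p ^ multiplicity p (nat \<bar>y\<bar>)) = nat \<bar>y\<bar>"
    using prime_factorization_nat[of "nat \<bar>y\<bar>"] assms(2) by simp
  moreover have "(\<Prod>p\<in>prime_factors (nat \<bar>y\<bar>). p ^ multiplicity p (nat \<bar>y\<bar>)) =
      (\<Prod>p\<in>primes_of x. p ^ multiplicity p (nat \<bar>y\<bar>))"
  proof (rule prod.mono_neutral_left)
    show "prime_factors (nat \<bar>y\<bar>) \<subseteq> primes_of x" using assms(1) by (auto simp: primes_of_def)
    show "\<forall>p\<in>primes_of x - prime_factors (nat \<bar>y\<bar>). p ^ multiplicity p (nat \<bar>y\<bar>) = 1"
      using assms(2) prime_primes_of
      by (auto simp: prime_factors_multiplicity)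
  qed simp
  ultimately show ?thesis by simp
qed

text \<open>The value of generator j, when \<open>c p\<close> holds the coefficients that decompose
  the valuation vector at p.\<close>

definition prime_product :: "nat set \<Rightarrow> (nat \<Rightarrow> nat \<Rightarrow> nat) \<Rightarrow> nat \<Rightarrow> nat" where
  "prime_product P c j = (\<Prod>p\<in>P. p ^ c p j)"

lemma decomposition_of_valuations:
  assumes "\<And>p i. p \<in> primes_of x \<Longrightarrow> i < length x \<Longrightarrow>
      nthz (vals p x) i = (\<Sum>j<m. c p j * h j i)" "i < length x"
  shows "nthz x i = sgn (nthz x i) * (\<Prod>j<m. int (prime_product (primes_of x) c j) ^ h j i)"
proof (cases "nthz x i = 0")
  case False
  let ?P = "primes_of x"
  have "nthz x i \<in> set x" using assms(2) by (simp add: nthz_eq)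
  then have "nat \<bar>nthz x i\<bar> = (\<Prod>p\<in>?P. p ^ multiplicity p (nat \<bar>nthz x i\<bar>))"
    using False by (rule nat_abs_eq_prod_primes_of)
  also have "\<dots> = (\<Prod>p\<in>?P. \<Prod>j<m. p ^ (c p j * h j i))"
    using assms(1)[OF _ assms(2)] assms(2)
    by (intro prod.cong refl) (simp add: nthz_vals power_sum)
  also have "\<dots> = (\<Prod>j<m. \<Prod>p\<in>?P. p ^ (c p j * h j i))" by (rule prod.swap)
  also have "\<dots> = (\<Prod>j<m. prime_product ?P c j ^ h j i)"
    by (simp add: prime_product_def prod_power_distrib power_mult)
  finally have "\<bar>nthz x i\<bar> = int (\<Prod>j<m. prime_product ?P c j ^ h j i)" by linarith
  then show ?thesis using sgn_mult_abs[of "nthz x i"] by simp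
qed simp

lemma prime_product_pos: "(\<And>p. p \<in> P \<Longrightarrow> prime p) \<Longrightarrow> prime_product P c j > 0"
  unfolding prime_product_def by (intro prod_pos) (auto simp: prime_gt_0_nat)

lemma prime_dvd_prime_product:
  assumes "finite P" "\<And>p. p \<in> P \<Longrightarrow> prime p" "prime q" "q dvd prime_product P c j"
  shows "q \<in> P \<and> c q j > 0"
proof -
  obtain p where p: "p \<in> P" "q dvd p ^ c p j"
    using assms(1,3,4) unfolding prime_product_def by (auto simp: prime_dvd_prod_iff)
  then have "q = p" using assms(2,3) prime_dvd_power primes_dvd_imp_eq by blast
  moreover have "c p j \<noteq> 0" using p(2) assms(3) by (metis not_prime_unit power_0)
  ultimately show ?thesis using p(1) by simp
qed

definition cone_class :: "nat list \<Rightarrow> nat list \<Rightarrow> nat list \<Rightarrow> nat list \<Rightarrow> nat" where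
  "cone_class A B C h = class3 (dot A h) (dot B h) (dot C h)"

text \<open>The last clause reflects that each prime is assigned to one cone. Generators of class 0
  lie in all three cones and may share primes with any others.\<close>

definition decomposes ::
  "nat list \<Rightarrow> nat list \<Rightarrow> nat list \<Rightarrow> nat list list \<Rightarrow> int list \<Rightarrow> (nat \<Rightarrow> nat) \<Rightarrow> bool" where
  "decomposes A B C H x u \<longleftrightarrow>
    (\<forall>j<length H. u j > 0) \<and>
    (\<forall>i<length x. nthz x i = sgn (nthz x i) * (\<Prod>j<length H. int (u j) ^ nthz (H ! j) i)) \<and>
    (\<forall>j<length H. cone_class A B C (H ! j) = 4 \<longrightarrow> u j = 1) \<and>
    (\<forall>j<length H. \<forall>k<length H. cone_class A B C (H ! j) \<in> {1, 2, 3} \<longrightarrow> cone_class A B C (H ! k) \<in> {1, 2, 3} \<longrightarrow>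
      cone_class A B C (H ! j) \<noteq> cone_class A B C (H ! k) \<longrightarrow> coprime (u j) (u k))"

lemma decomposes_swap:
  assumes "decomposes A B C H x u"
  shows "decomposes B A C H x u"
proof -
  have "cone_class B A C h = (if cone_class A B C h = 1 then 2 else if cone_class A B C h = 2 then 1
    else cone_class A B C h)" for h
    by (auto simp: cone_class_def class3_def)
  then show ?thesis using assms unfolding decomposes_def by auto
qed

lemma ex_decomposition:
  assumes "length A = length x" "length B = length x" "length C = length x"
    and K: "\<And>i. nthz A i \<le> K" "\<And>i. nthz B i \<le> K" "\<And>i. nthz C i \<le> K" "K \<ge> 1"
    and H: "H = List.n_lists (length x) [0..<Suc (gen_bound K)]"
    and sum: "monom_at A x + monom_at B x + monom_at C x = 0"
    and nz: "monom_at A x \<noteq> 0" "monom_at B x \<noteq> 0" "monom_at C x \<noteq> 0"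
  shows "\<exists>u. decomposes A B C H x u"
proof -
  \<comment> \<open>t is the class of the monomial whose valuation at p may exceed the other
    two.\<close>
  define Q where "Q p c t \<longleftrightarrow> (\<forall>i<length x. nthz (vals p x) i = (\<Sum>j<length H. c j * nthz (H ! j) i)) \<and>
      (\<forall>j<length H. c j > 0 \<longrightarrow> cone_class A B C (H ! j) \<in> {0, t}) \<and> t \<in> {1, 2, 3 :: nat}" for p c t
  have "\<exists>c t. Q p c t" if p: "prime p" for p
  proof -
    let ?v = "vals p x"
    note [simp] = multiplicity_monom_at[OF p nz(1) assms(1)] multiplicity_monom_at[OF p nz(2) assms(2)]
      multiplicity_monom_at[OF p nz(3) assms(3)]
    have len: "length ?v = length x" by (simp add: vals_def)
    have "min (dot A ?v) (dot B ?v) \<le> dot C ?v"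
      using multiplicity_sum_zero[OF sum nz p] by simp
    moreover have "min (dot A ?v) (dot C ?v) \<le> dot B ?v"
      using multiplicity_sum_zero[OF _ nz(1,3,2) p] sum by simp
    moreover have "min (dot B ?v) (dot C ?v) \<le> dot A ?v"
      using multiplicity_sum_zero[OF _ nz(2,3,1) p] sum by simp
    ultimately consider "dot A ?v = dot B ?v" "dot A ?v \<le> dot C ?v" | "dot A ?v = dot C ?v" "dot A ?v \<le> dot B ?v"
      | "dot B ?v = dot C ?v" "dot B ?v \<le> dot A ?v"
      by linarith
    then show ?thesis
    proof cases
      case 1
      from cone_generators[OF len assms(1-3) K(1,2,3,4) 1 H] obtain c where
        "\<forall>i<length x. nthz ?v i = (\<Sum>j<length H. c j * nthz (H ! j) i)"
        "\<forall>j<length H. c j > 0 \<longrightarrow> dot A (H ! j) = dot B (H ! j) \<and> dot A (H ! j) \<le> dot C (H ! j)" by blast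
      then show ?thesis by (intro exI[of _ c] exI[of _ 3]) (auto simp: Q_def cone_class_def class3_def)
    next
      case 2
      from cone_generators[OF len assms(1,3,2) K(1,3,2,4) 2 H] obtain c where
        "\<forall>i<length x. nthz ?v i = (\<Sum>j<length H. c j * nthz (H ! j) i)"
        "\<forall>j<length H. c j > 0 \<longrightarrow> dot A (H ! j) = dot C (H ! j) \<and> dot A (H ! j) \<le> dot B (H ! j)" by blast
      then show ?thesis by (intro exI[of _ c] exI[of _ 2]) (auto simp: Q_def cone_class_def class3_def)
    next
      case 3
      from cone_generators[OF len assms(2,3,1) K(2,3,1,4) 3 H] obtain c where
        "\<forall>i<length x. nthz ?v i = (\<Sum>j<length H. c j * nthz (H ! j) i)"
        "\<forall>j<length H. c j > 0 \<longrightarrow> dot B (H ! j) = dot C (H ! j) \<and> dot B (H ! j) \<le> dot A (H ! j)" by blast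
      then show ?thesis by (intro exI[of _ c] exI[of _ 1]) (auto simp: Q_def cone_class_def class3_def)
    qed
  qed
  then obtain c t where "\<And>p. prime p \<Longrightarrow> Q p (c p) (t p)" by metis
  then have c: "\<And>p i. prime p \<Longrightarrow> i < length x \<Longrightarrow>
      nthz (vals p x) i = (\<Sum>j<length H. c p j * nthz (H ! j) i)"
    "\<And>p j. prime p \<Longrightarrow> j < length H \<Longrightarrow> c p j > 0 \<Longrightarrow> cone_class A B C (H ! j) \<in> {0, t p}"
    "\<And>p. prime p \<Longrightarrow> t p \<in> {1, 2, 3}"
    unfolding Q_def by blast+
  define u where "u = prime_product (primes_of x) c"
  note pr = prime_primes_of[of _ x]
  have u_dvd: "q \<in> primes_of x \<and> c q j > 0" if "prime q" "q dvd u j" for q j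
    using prime_dvd_prime_product[OF finite_primes_of pr] that unfolding u_def by blast
  have pos: "u j > 0" for j unfolding u_def using pr by (rule prime_product_pos)
  have dec: "nthz x i = sgn (nthz x i) * (\<Prod>j<length H. int (u j) ^ nthz (H ! j) i)" if "i < length x" for i
    unfolding u_def by (rule decomposition_of_valuations) (use c(1) pr that in auto)
  have one: "u j = 1" if j: "j < length H" "cone_class A B C (H ! j) = 4" for j
  proof (rule ccontr)
    assume "u j \<noteq> 1"
    then obtain q where q: "prime q" "q dvd u j" using prime_factor_nat by blast
    have "cone_class A B C (H ! j) \<in> {0, t q}" using c(2) q(1) j(1) u_dvd[OF q] by blast
    then have "t q = 4" using j(2) by (metis insertE singletonD zero_neq_numeral)
    then show False using c(3)[OF q(1)] by simp
  qed
  have cop: "coprime (u j) (u k)"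
    if j: "j < length H" "k < length H" "cone_class A B C (H ! j) \<in> {1, 2, 3}"
      "cone_class A B C (H ! k) \<in> {1, 2, 3}" "cone_class A B C (H ! j) \<noteq> cone_class A B C (H ! k)" for j k
  proof (rule ccontr)
    assume "\<not> coprime (u j) (u k)"
    then have "gcd (u j) (u k) \<noteq> 1" by (simp only: coprime_iff_gcd_eq_1 not_False_eq_True)
    then obtain q where "prime q" "q dvd gcd (u j) (u k)" using prime_factor_nat by blast
    then have q: "prime q" "q dvd u j" "q dvd u k" by simp_all
    have "cone_class A B C (H ! j) \<in> {0, t q}" "cone_class A B C (H ! k) \<in> {0, t q}"
      using c(2) q(1) j(1,2) u_dvd[OF q(1,2)] u_dvd[OF q(1,3)] by blast+
    moreover have "cone_class A B C (H ! j) \<noteq> 0" "cone_class A B C (H ! k) \<noteq> 0"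
      using j(3,4) by auto
    ultimately show False using j(5) by (metis insertE singletonD)
  qed
  have "decomposes A B C H x u"
    unfolding decomposes_def using pos dec one cop by blast
  then show ?thesis by blast
qed

section \<open>Every solution lies in a family\<close>

definition make_dat :: "nat \<Rightarrow> nat list \<Rightarrow> nat list \<Rightarrow> nat list \<Rightarrow> nat list list \<Rightarrow> int list \<Rightarrow> nat list \<Rightarrow>
    nat \<Rightarrow> nat \<Rightarrow> nat \<Rightarrow> nat \<Rightarrow> nat \<Rightarrow> nat \<Rightarrow> nat list \<Rightarrow> dat" where
  "make_dat n A B C H e ka mo ja jb q rh ri rs =
    Dat H
      (map (\<lambda>h. if mo = 2 then class_active (monom_at A e) (monom_at B e) (monom_at C e) (dot A h) (dot B h) (dot C h)
        else cone_class A B C h) H)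
      (map (\<lambda>h. spread (dot A h) (dot B h) (dot C h)) H)
      (map (\<lambda>h. sum_list (drop n h)) H)
      e ka [monom_at A e, monom_at B e, monom_at C e] mo ja jb q rh ri rs"

text \<open>The datum extracted from a solution. Values of unfixed generators are erased from
  \<open>kap\<close>, since they become parameters; so only finitely many data arise.\<close>

locale solution_target =
  fixes n :: nat and A B C :: "nat list" and H :: "nat list list" and x cs :: "int list" and u :: "nat \<Rightarrow> nat"
    and mo ja jb q rh ri :: nat and rs :: "nat list" and d :: dat
  assumes lens: "length A = n + length cs" "length B = n + length cs" "length C = n + length cs" "length x = n"
    and u_pos: "\<And>j. j < length H \<Longrightarrow> u j > 0"
    and decomp: "\<And>i. i < n + length cs \<Longrightarrow>
      nthz (x @ cs) i = sgn (nthz (x @ cs) i) * (\<Prod>j<length H. int (u j) ^ nthz (H ! j) i)"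
    and d_def: "d = make_dat n A B C H (map sgn (x @ cs))
      (map (\<lambda>j. if sum_list (drop n (H ! j)) = 0 then 0 else u j) [0..<length H]) mo ja jb q rh ri rs"
    and u_class_4: "\<And>j. j < length H \<Longrightarrow> nthz (cls d) j = 4 \<Longrightarrow> u j = 1"
begin

lemma d_simps [simp]:
  "gens d = H" "md d = mo" "jv d = ja" "jw d = jb" "md_q d = q" "rho d = rh" "rho_inv d = ri" "res d = rs"
  "sgs d = [monom_at A (eps d), monom_at B (eps d), monom_at C (eps d)]" "eps d = map sgn (x @ cs)"
  "length (cls d) = length H"
  by (simp_all add: d_def make_dat_def)

lemma d_nthz:
  assumes "j < length H"
  shows "nthz (fixs d) j = sum_list (drop n (H ! j))"
    "nthz (kap d) j = (if nthz (fixs d) j = 0 then 0 else u j)"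
    "nthz (mults d) j = spread (dot A (H ! j)) (dot B (H ! j)) (dot C (H ! j))"
    "mo \<noteq> 2 \<Longrightarrow> nthz (cls d) j = cone_class A B C (H ! j)"
    "mo = 2 \<Longrightarrow> nthz (cls d) j = class_active (monom_at A (eps d)) (monom_at B (eps d)) (monom_at C (eps d))
      (dot A (H ! j)) (dot B (H ! j)) (dot C (H ! j))"
    "gen_exp d j i = nthz (H ! j) i" "hd (drop j (gens d)) = H ! j"
  using assms by (simp_all add: d_def make_dat_def nthz_eq gen_exp_def hd_drop_conv_nth del: sum_list_eq_0_iff)

lemma nthz_eps: "i < n + length cs \<Longrightarrow> nthz (eps d) i = sgn (nthz (x @ cs) i)"
  using lens by (auto simp: nthz_eq nth_append)

lemma consistent: "consistent n cs d"
proof -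
  have fixed: "fixed_value d j = int (u j)" if "j < length H" "nthz (fixs d) j \<noteq> 0" for j
    using that u_class_4[of j] by (auto simp: fixed_value_def d_nthz(2))
  have fx: "nthz (fixs d) j \<noteq> 0" if "j < length H" "gen_exp d j (n + i) \<noteq> 0" for i j
  proof -
    have i: "i < length (drop n (H ! j))" "drop n (H ! j) ! i \<noteq> 0"
      using that by (auto simp: d_nthz nthz_eq split: if_splits)
    have "sum_list (drop n (H ! j)) \<noteq> 0"
      using i(2) nth_mem[OF i(1)] by (metis sum_list_eq_0_iff)
    then show ?thesis using that by (simp add: d_nthz(1))
  qed
  have "nthz (eps d) (n + i) * (\<Prod>j<length H. fixed_value d j ^ gen_exp d j (n + i)) = nthz cs i"
    if i: "i < length cs" for i
  proof -
    have "(\<Prod>j<length H. fixed_value d j ^ gen_exp d j (n + i)) = (\<Prod>j<length H. int (u j) ^ nthz (H ! j) (n + i))"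
    proof (intro prod.cong refl)
      fix j assume "j \<in> {..<length H}"
      then have j: "j < length H" by simp
      show "fixed_value d j ^ gen_exp d j (n + i) = int (u j) ^ nthz (H ! j) (n + i)"
        using fx[OF j, of i] fixed[OF j] d_nthz(6)[OF j, of "n + i"]
        by (cases "gen_exp d j (n + i) = 0") simp_all
    qed
    moreover have "nthz (x @ cs) (n + i) = nthz cs i" using lens(4) by (simp add: nthz_eq nth_append)
    ultimately show ?thesis using decomp[of "n + i"] nthz_eps[of "n + i"] i by simp
  qed
  then show ?thesis using fx unfolding consistent_def by simp
qed

lemma monom_at_decomposed:
  assumes "length E = n + length cs"
  shows "monom_at E (x @ cs) = monom_at E (eps d) * (\<Prod>j<length H. int (u j) ^ dot E (H ! j))"
proof -
  have "monom_at E (x @ cs) = (\<Prod>i<length E. (nthz (eps d) i * (\<Prod>j<length H. int (u j) ^ nthz (H ! j) i)) ^ nthz E i)"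
    unfolding monom_at_def using decomp nthz_eps assms by (intro prod.cong refl) simp
  then show ?thesis unfolding monomial_of_products by (simp add: monom_at_def dot_def)
qed

text \<open>\<open>uu\<close> is a list of parameter values that reproduces the \<open>u j\<close>,
  except at \<open>jb\<close>, whose value the family has to compute.\<close>

context
  fixes uu :: "int list"
  assumes mode: "mo \<noteq> 2"
    and sum_zero: "monom_at A (x @ cs) + monom_at B (x @ cs) + monom_at C (x @ cs) = 0"
    and nonzero: "monom_at A (x @ cs) \<noteq> 0" "monom_at B (x @ cs) \<noteq> 0" "monom_at C (x @ cs) \<noteq> 0"
    and jb: "jb < length H" "cone_class A B C (H ! jb) = 3"
      "spread (dot A (H ! jb)) (dot B (H ! jb)) (dot C (H ! jb)) = 1" "sum_list (drop n (H ! jb)) = 0"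
    and gen_values: "\<And>j. j < length H \<Longrightarrow> j \<noteq> jb \<Longrightarrow> poly_at (gen_poly d j) uu = int (u j)"
begin

text \<open>The common factor of the three monomials is non-zero and cancels; in the remaining W
  term the generator \<open>jb\<close> has exponent 1.\<close>

lemma num_eq_den: "poly_at (num_poly d) uu = poly_at (den_poly d (length H)) uu * int (u jb)"
proof -
  let ?a = "\<lambda>j. dot A (H ! j)" and ?b = "\<lambda>j. dot B (H ! j)" and ?c = "\<lambda>j. dot C (H ! j)"
  let ?U = "\<lambda>j. int (u j)"
  let ?M = "\<Prod>j<length H. ?U j ^ min (?a j) (min (?b j) (?c j))"
  let ?P = "\<lambda>t. \<Prod>j<length H. if class3 (?a j) (?b j) (?c j) = t then ?U j ^ spread (?a j) (?b j) (?c j) else 1"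
  have cl: "nthz (cls d) j = class3 (?a j) (?b j) (?c j)" if "j < length H" for j
    using d_nthz(4)[OF that] mode by (simp add: cone_class_def)
  have one: "?U j = 1" if "j < length H" "class3 (?a j) (?b j) (?c j) = 4" for j
    using u_class_4 that cl by simp
  have split: "(\<Prod>j<length H. ?U j ^ ?a j) = ?M * ?P 1" "(\<Prod>j<length H. ?U j ^ ?b j) = ?M * ?P 2"
    "(\<Prod>j<length H. ?U j ^ ?c j) = ?M * ?P 3"
    by (rule prod_power_class_split, rule one, assumption+)+
  have "?M * (monom_at A (eps d) * ?P 1 + monom_at B (eps d) * ?P 2 + monom_at C (eps d) * ?P 3) = 0"
    using sum_zero unfolding monom_at_decomposed[OF lens(1)] monom_at_decomposed[OF lens(2)]
      monom_at_decomposed[OF lens(3)] split by (simp only: distrib_left mult.left_commute)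
  moreover have "?M \<noteq> 0" using u_pos by (simp add: prod_zero_iff)
  ultimately have sum: "monom_at A (eps d) * ?P 1 + monom_at B (eps d) * ?P 2 + monom_at C (eps d) * ?P 3 = 0"
    by simp
  have class_poly: "poly_at (class_poly d t) uu = ?P t" if "t \<noteq> 3" for t
    unfolding poly_at_class_poly
  proof (intro prod.cong)
    fix j assume "j \<in> {..<length H}"
    then have j: "j < length H" by simp
    have "j \<noteq> jb" if "class3 (?a j) (?b j) (?c j) = t"
      using that \<open>t \<noteq> 3\<close> jb(2) by (auto simp: cone_class_def)
    then show "(if nthz (cls d) j = t then poly_at (gen_poly d j) uu ^ nthz (mults d) j else 1) =
        (if class3 (?a j) (?b j) (?c j) = t then ?U j ^ spread (?a j) (?b j) (?c j) else 1)"
      using gen_values[OF j] by (simp add: cl[OF j] d_nthz(3)[OF j])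
  qed simp
  have s: "nthz (sgs d) 0 = monom_at A (eps d)" "nthz (sgs d) 1 = monom_at B (eps d)"
    "nthz (sgs d) 2 = monom_at C (eps d)"
    unfolding d_simps(9) by (simp_all add: nthz_eq)
  have num: "poly_at (num_poly d) uu = monom_at C (eps d) * ?P 3"
    unfolding poly_at_num_poly s using class_poly[of 1] class_poly[of 2] sum by simp
  let ?f = "\<lambda>j. if class3 (?a j) (?b j) (?c j) = 3 then ?U j ^ spread (?a j) (?b j) (?c j) else 1"
  have "?P 3 = ?f jb * prod ?f ({..<length H} - {jb})" using jb(1) by (intro prod.remove) auto
  moreover have "?f jb = ?U jb" using jb(2,3) by (simp add: cone_class_def)
  moreover have "poly_at (den_poly d (length H)) uu = monom_at C (eps d) * prod ?f ({..<length H} - {jb})"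
  proof -
    let ?g = "\<lambda>j. if nthz (cls d) j = 3 \<and> j \<noteq> jb \<and> (nthz (fixs d) j \<noteq> 0 \<or> j < length H)
      then poly_at (gen_poly d j) uu ^ nthz (mults d) j else 1"
    have "prod ?g {..<length H} = ?g jb * prod ?g ({..<length H} - {jb})"
      using jb(1) by (intro prod.remove) auto
    also have "prod ?g ({..<length H} - {jb}) = prod ?f ({..<length H} - {jb})"
      by (intro prod.cong) (auto simp: cl d_nthz(3) gen_values)
    finally show ?thesis unfolding poly_at_den_poly s by simp
  qed
  ultimately show ?thesis unfolding num by (simp only: ac_simps)
qed

lemma den_nonzero: "poly_at (den_poly d t) uu \<noteq> 0"
proof -
  have "monom_at C (eps d) \<noteq> 0"
    using nonzero(3) unfolding monom_at_decomposed[OF lens(3)] by auto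
  then have "nthz (sgs d) 2 \<noteq> 0" by (simp only: d_simps(9)) (simp add: nthz_eq)
  moreover have "poly_at (gen_poly d j) uu \<noteq> 0" if "j < length H" "j \<noteq> jb" for j
    using gen_values[OF that] u_pos[OF that(1)] by simp
  ultimately show ?thesis unfolding poly_at_den_poly by (auto simp: prod_zero_iff)
qed

lemma den_dvd_den: "t \<le> k \<Longrightarrow> k \<le> length H \<Longrightarrow> poly_at (den_poly d t) uu dvd poly_at (den_poly d k) uu"
proof (induction k rule: dec_induct)
  case (step k)
  then show ?case using poly_at_den_poly_Suc[of k d uu] by simp
qed simp

lemma den_dvd_num: "t \<le> length H \<Longrightarrow> poly_at (den_poly d t) uu dvd poly_at (num_poly d) uu"
  unfolding num_eq_den by (intro dvd_mult2 den_dvd_den) auto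

lemma num_nonzero: "poly_at (num_poly d) uu \<noteq> 0"
  unfolding num_eq_den using den_nonzero u_pos[OF jb(1)] by simp

lemma den_0_nonzero: "poly_at (den_poly d 0) [] \<noteq> 0"
  using den_nonzero den_poly_0 by metis

lemma den_0_dvd_num: "poly_at (den_poly d 0) [] dvd poly_at (num_poly d) uu"
  using den_dvd_num[of 0] den_poly_0 by (metis le0)

text \<open>Only ranges outside W have to be checked. Those in W follow from
  \<open>num_eq_den\<close>, since every partial denominator divides the complete one.\<close>

lemma in_points:
  assumes "main_family d"
    and len: "length uu = 3 + 3 * length H"
    and adm: "\<And>i. i < 3 + 2 * length H \<Longrightarrow> uu ! i \<in> range_at (param_range d i) (take i uu)"
    and uu: "\<And>j. j < length H \<Longrightarrow> uu ! (3 + 2 * length H + j) = int (u j)"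
  shows "x \<in> points (dat_family n d)"
proof -
  note den_nz = den_nonzero
  interpret main_family d by fact
  have "uu ! i \<in> range_at (param_range d i) (take i uu)" if i: "i < 3 + 3 * length H" for i
  proof (cases "i < 3 + 2 * length H")
    case True
    then show ?thesis by (rule adm)
  next
    case False
    define j where "j = i - (3 + 2 * length H)"
    have j: "i = 3 + 2 * length H + j" "j < length H" using False i by (auto simp: j_def)
    show ?thesis
    proof (cases "nthz (cls d) j = 3 \<and> nthz (fixs d) j = 0 \<and> j \<noteq> jb")
      case True
      have "poly_at (den_poly d j) uu * int (u j) ^ nthz (mults d) j dvd poly_at (num_poly d) uu"
        using den_dvd_num[of "Suc j"] poly_at_den_poly_Suc[of j d uu] True j(2) gen_values[of j] by simp
      then have "int (u j) ^ nthz (mults d) j dvd poly_at (num_poly d) uu div poly_at (den_poly d j) uu"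
        using dvd_div_iff_mult[of "poly_at (den_poly d j) uu" "poly_at (num_poly d) uu"
            "int (u j) ^ nthz (mults d) j"] den_nz[of j] den_dvd_num[of j] j(2)
        by (simp add: mult.commute)
      then show ?thesis
        using True j uu[OF j(2)] poly_at_take[OF vars_below_num_poly, of d i uu]
          poly_at_take[OF vars_below_den_poly, of j d i uu]
        by (simp add: param_range_def Let_def D_def value_at_def)
    next
      case False
      then show ?thesis using j by (auto simp: param_range_def Let_def)
    qed
  qed
  then have a: "adm d (3 + 3 * length (gens d)) uu" using len by (simp add: adm_def)
  have V: "V uu j = int (u j)" if "j < length H" for j
    using that gen_values[OF that] den_nz[of "length H"] by (simp add: V_def num_eq_den)
  have "value_at (coord_expr d i) uu = x ! i" if "i < n" for i
  proof -
    have "value_at (coord_expr d i) uu = nthz (eps d) i * (\<Prod>j<length H. int (u j) ^ nthz (H ! j) i)"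
      using coord_expr_value(2)[OF a, of i] by (simp add: V d_nthz(6))
    also have "\<dots> = nthz (x @ cs) i" using decomp[of i] nthz_eps[of i] that by simp
    also have "\<dots> = x ! i" using that lens(4) by (simp add: nthz_eq nth_append)
    finally show ?thesis .
  qed
  then have "x = map (\<lambda>i. value_at (coord_expr d i) uu) [0..<n]"
    using lens(4) by (intro nth_equalityI) auto
  then show ?thesis using a unfolding points_dat_family by blast
qed

end

end

section \<open>Parameter values that reproduce a given solution\<close>

definition params :: "nat \<Rightarrow> int \<Rightarrow> int \<Rightarrow> int \<Rightarrow> (nat \<Rightarrow> int) \<Rightarrow> (nat \<Rightarrow> int) \<Rightarrow> (nat \<Rightarrow> int) \<Rightarrow> int list" where
  "params m s s' k S T W = [s, s', k] @ map S [0..<m] @ map T [0..<m] @ map W [0..<m]"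

lemma params_nth:
  "length (params m s s' k S T W) = 3 + 3 * m"
  "params m s s' k S T W ! 0 = s" "params m s s' k S T W ! 1 = s'" "params m s s' k S T W ! 2 = k"
  "j < m \<Longrightarrow> params m s s' k S T W ! (3 + j) = S j"
  "j < m \<Longrightarrow> params m s s' k S T W ! (3 + m + j) = T j"
  "j < m \<Longrightarrow> params m s s' k S T W ! (3 + 2 * m + j) = W j"
  by (simp_all add: params_def nth_append)

lemma mod_poly_params:
  "poly_at (mod_poly d) (params m s s' k S T W) = 3 * int (md_q d) ^ 2 * k + (int (rho d) - 1)"
  using params_nth(1)[of m s s' k S T W] by (simp add: mod_poly_def params_nth)

lemma gen_poly_params:
  assumes "j < length (gens d)"
  shows "poly_at (gen_poly d j) (params (length (gens d)) s s' k S T W) =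
    (if nthz (cls d) j = 4 then 1 else if nthz (fixs d) j \<noteq> 0 then int (nthz (kap d) j)
     else if nthz (cls d) j = 0 then T j else if nthz (cls d) j = 3 then W j else if md d = 0 then 1
     else if nthz (cls d) j = 1 then int (nthz (res d) j * rho_inv d) *
       (3 * int (md_q d) ^ 2 * k + (int (rho d) - 1)) + int (md_q d) * T j
     else (if j = jv d then 3 * int (md_q d) ^ 2 * k + (int (rho d) - 1) else 1) *
       (int (md_q d) * T j + int (nthz (res d) j)))"
  using assms params_nth(1)[of "length (gens d)" s s' k S T W] mod_poly_params[of d "length (gens d)" s s' k S T W]
  by (simp add: gen_poly_def params_nth)

lemma params_in_ranges:
  assumes "k dvd (2 * s + 1) * (3 * s' + 1)"
    and "\<And>j. j < m \<Longrightarrow> nthz (cls d) j = 1 \<Longrightarrow> nthz (fixs d) j = 0 \<Longrightarrow>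
      T j dvd (3 * int (md_q d) ^ 2 * k + (int (rho d) - 1)) * S j + 1"
    and m: "m = length (gens d)" and i: "i < 3 + 2 * m"
  shows "params m s s' k S T W ! i \<in> range_at (param_range d i) (take i (params m s s' k S T W))"
proof -
  let ?uu = "params m s s' k S T W"
  consider "i < 2" | "i = 2" | "2 < i" "i < 3 + m" | "3 + m \<le> i" by linarith
  then show ?thesis
  proof cases
    case 2
    have "poly_at (padd (pmul (pconst 2) (pvar 0)) (pconst 1)) (take 2 ?uu) = 2 * s + 1"
      "poly_at (padd (pmul (pconst 3) (pvar 1)) (pconst 1)) (take 2 ?uu) = 3 * s' + 1"
      by (simp_all add: params_def)
    then show ?thesis using assms(1) 2 params_nth(4)[of m s s' k S T W]
      by (simp add: param_range_def Let_def D_def value_at_def)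
  next
    case 4
    define j where "j = i - (3 + m)"
    have j: "i = 3 + m + j" "j < m" using 4 i by (auto simp: j_def)
    show ?thesis
    proof (cases "nthz (cls d) j = 1 \<and> nthz (fixs d) j = 0")
      case True
      have "poly_at (mod_poly d) (take i ?uu) = 3 * int (md_q d) ^ 2 * k + (int (rho d) - 1)"
        using poly_at_take[OF vars_below_mod_poly[OF order_refl], of i d ?uu] j mod_poly_params by simp
      moreover have "poly_at (pvar (3 + j)) (take i ?uu) = S j"
        using j params_nth(1)[of m s s' k S T W] params_nth(5)[OF j(2)] by simp
      ultimately show ?thesis using True assms(2)[OF j(2)] j params_nth(6)[OF j(2)] m
        by (simp add: param_range_def Let_def D_def value_at_def del: poly_at_pvar)
    next
      case False
      then show ?thesis using j m by (auto simp: param_range_def Let_def)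
    qed
  qed (use m in \<open>auto simp: param_range_def Let_def\<close>)
qed

lemma ex_dvd_linear:
  fixes a k :: int
  assumes "coprime a k"
  shows "\<exists>s. k dvd a * s + 1"
proof -
  obtain t where "[a * t = 1] (mod k)" using assms cong_solve_coprime_int by blast
  then have "k dvd 1 - a * t" by (metis cong_iff_dvd_diff cong_sym)
  then show ?thesis by (intro exI[of _ "- t"]) simp
qed

text \<open>The odd part of k is itself of the form 2s + 1, and the power of 2 divides some 3s' + 1
  because 3 is invertible modulo it.\<close>

lemma ex_dvd_nonzero_product:
  fixes k :: int
  assumes "k \<noteq> 0"
  shows "\<exists>s s'. k dvd (2 * s + 1) * (3 * s' + 1)"
proof -
  obtain y where y: "k = 2 ^ multiplicity 2 k * y" "\<not> 2 dvd y"
    using multiplicity_decompose'[of k 2] assms by (metis odd_one)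
  obtain s where s: "y = 2 * s + 1" using y(2) by (rule oddE)
  have "coprime (3 :: int) (2 ^ multiplicity 2 k)" by simp
  from ex_dvd_linear[OF this] obtain s' :: int where "2 ^ multiplicity 2 k dvd 3 * s' + 1" by (rule exE)
  then have "2 ^ multiplicity 2 k * y dvd (3 * s' + 1) * (2 * s + 1)" by (intro mult_dvd_mono) (simp add: s)+
  then have "k dvd (2 * s + 1) * (3 * s' + 1)"
    by (subst y(1)) (simp only: mult.commute[of "2 * s + 1"])
  then show ?thesis by blast
qed

lemma decomposes_target:
  assumes "decomposes A B C H (x @ cs) u" "length A = n + length cs" "length B = n + length cs"
    "length C = n + length cs" "length x = n" "mo \<noteq> 2"
    and "d = make_dat n A B C H (map sgn (x @ cs))
      (map (\<lambda>j. if sum_list (drop n (H ! j)) = 0 then 0 else u j) [0..<length H]) mo ja jb q rh ri rs"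
  shows "solution_target n A B C H x cs u mo ja jb q rh ri rs d"
proof
  show "u j = 1" if "j < length H" "nthz (cls d) j = 4" for j
  proof -
    have "cone_class A B C (H ! j) = 4" using that assms(6,7) by (simp add: make_dat_def nthz_eq)
    then show ?thesis using assms(1) that unfolding decomposes_def by blast
  qed
qed (use assms in \<open>auto simp: decomposes_def\<close>)

lemma solution_in_mode_0:
  assumes dec: "decomposes A B C H (x @ cs) u" and lens: "length A = n + length cs" "length B = n + length cs"
    "length C = n + length cs" "length x = n"
    and eq: "monom_at A (x @ cs) + monom_at B (x @ cs) + monom_at C (x @ cs) = 0"
    "monom_at A (x @ cs) \<noteq> 0" "monom_at B (x @ cs) \<noteq> 0" "monom_at C (x @ cs) \<noteq> 0"
    and jb: "jb < length H" "cone_class A B C (H ! jb) = 3"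
      "spread (dot A (H ! jb)) (dot B (H ! jb)) (dot C (H ! jb)) = 1" "sum_list (drop n (H ! jb)) = 0"
    and one: "\<And>j. j < length H \<Longrightarrow> cone_class A B C (H ! j) \<in> {1, 2} \<Longrightarrow> sum_list (drop n (H ! j)) = 0 \<Longrightarrow> u j = 1"
    and d: "d = make_dat n A B C H (map sgn (x @ cs))
      (map (\<lambda>j. if sum_list (drop n (H ! j)) = 0 then 0 else u j) [0..<length H]) 0 ja jb q rh ri rs"
  shows "main_family d \<and> consistent n cs d \<and> x \<in> points (dat_family n d)"
proof -
  interpret solution_target n A B C H x cs u 0 ja jb q rh ri rs d
    by (rule decomposes_target) (use assms in auto)
  let ?m = "length H"
  \<comment> \<open>With k = 1 and all \<open>S\<close> equal to 0, a free parameter of U has to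
    divide 1; in mode 0 it does not affect the value of its generator.\<close>
  define uu where "uu = params ?m 0 0 1 (\<lambda>_. 0)
    (\<lambda>j. if nthz (cls d) j = 1 \<and> nthz (fixs d) j = 0 then 1 else int (u j)) (\<lambda>j. int (u j))"
  have cl: "nthz (cls d) j = cone_class A B C (H ! j)" if "j < ?m" for j using d_nthz(4)[OF that] by simp
  have cl_range: "cone_class A B C h \<in> {0, 1, 2, 3, 4}" for h by (simp add: cone_class_def class3_def)
  have gv: "poly_at (gen_poly d j) uu = int (u j)" if j: "j < ?m" for j
    using gen_poly_params[of j d] j u_class_4[OF j] d_nthz(2)[OF j] one[OF j] cl[OF j] d_nthz(1)[OF j]
      cl_range[of "H ! j"]
    unfolding uu_def by (auto simp del: sum_list_eq_0_iff)
  note target = eq jb gv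
  have mf: "main_family d"
  proof
    show "poly_at (den_poly d 0) [] \<noteq> 0"
      by (rule den_0_nonzero[of uu]) (use target in auto)
    have num: "poly_at (num_poly d) uu = poly_at (num_poly d) []" by (rule num_poly_mode_0) simp
    show "poly_at (den_poly d 0) [] dvd poly_at (num_poly d) []"
      using den_0_dvd_num[of uu] target unfolding num by auto
    have "poly_at (num_poly d) [] \<noteq> 0"
      using num_nonzero[of uu] target unfolding num by auto
    then show "md d = 0 \<and> poly_at (num_poly d) [] \<noteq> 0 \<or> coprime_data d" by simp
  qed (use jb cl d_nthz in \<open>auto simp del: sum_list_eq_0_iff\<close>)
  moreover have "x \<in> points (dat_family n d)"
  proof (rule in_points[of uu])
    show "uu ! i \<in> range_at (param_range d i) (take i uu)" if "i < 3 + 2 * ?m" for i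
      unfolding uu_def by (rule params_in_ranges) (use that in auto)
  qed (use target mf in \<open>auto simp: uu_def params_nth\<close>)
  ultimately show ?thesis using consistent by blast
qed

lemma sgn_prod_power: "sgn (\<Prod>i<k. f i ^ e i) = (\<Prod>i<k. sgn (f i) ^ e i)" for f :: "nat \<Rightarrow> int"
proof (induction k)
  case (Suc k)
  have "sgn (y ^ a) = sgn y ^ a" for y :: int and a by (induction a) (simp_all add: sgn_mult)
  with Suc show ?case by (simp add: sgn_mult)
qed simp

lemma monom_at_sgn: "monom_at E (map sgn x) = sgn (monom_at E x)"
proof -
  have "nthz (map sgn x) i = sgn (nthz x i)" for i by (simp add: nthz_eq)
  then show ?thesis by (simp add: monom_at_def sgn_prod_power)
qed

text \<open>Such a generator divides one of the non-zero constants; the sum of their absolute values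
  bounds all cases at once.\<close>

lemma fixed_generator_bound:
  assumes "solution_target n A B C H x cs u mo ja jb q rh ri rs d"
    and j: "j < length H" "length (H ! j) = n + length cs" "sum_list (drop n (H ! j)) \<noteq> 0"
    and "0 \<notin> set cs"
  shows "u j \<le> nat (\<Sum>c\<leftarrow>cs. \<bar>c\<bar>)"
proof -
  interpret solution_target n A B C H x cs u mo ja jb q rh ri rs d by fact
  obtain a where "a \<in> set (drop n (H ! j))" "a \<noteq> 0" using j(3) by (metis sum_list_eq_0_iff)
  then obtain i where i: "i < length cs" "nthz (H ! j) (n + i) \<noteq> 0"
    using j(2) by (auto simp: in_set_conv_nth nthz_eq)
  have cs_i: "nthz (x @ cs) (n + i) = cs ! i" using lens(4) i by (simp add: nthz_eq nth_append)
  have "int (u j) dvd int (u j) ^ nthz (H ! j) (n + i)" using i(2) by (intro dvd_power) simp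
  also have "\<dots> dvd (\<Prod>j<length H. int (u j) ^ nthz (H ! j) (n + i))"
    using j(1) by (intro dvd_prodI) auto
  also have "\<dots> dvd cs ! i" using decomp[of "n + i"] i(1) unfolding cs_i by (metis add_less_cancel_left dvd_triv_right)
  finally have "int (u j) \<le> \<bar>cs ! i\<bar>"
    using assms(5) i(1) by (metis dvd_imp_le_int nth_mem abs_of_nat)
  also have "\<dots> \<le> (\<Sum>c\<leftarrow>cs. \<bar>c\<bar>)"
    using i(1) by (intro member_le_sum_list) auto
  finally show ?thesis by linarith
qed

lemma solution_in_mode_2:
  assumes lens: "length A = n + length cs" "length B = n + length cs" "length C = n + length cs" "length x = n"
    and K: "\<And>i. nthz A i \<le> K" "\<And>i. nthz B i \<le> K" "\<And>i. nthz C i \<le> K" "K \<ge> 1"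
    and H: "H = List.n_lists (n + length cs) [0..<Suc (gen_bound K)]"
    and eq: "monom_at A (x @ cs) + monom_at B (x @ cs) + monom_at C (x @ cs) = 0"
    and degenerate: "monom_at A (x @ cs) = 0 \<or> monom_at B (x @ cs) = 0 \<or> monom_at C (x @ cs) = 0"
  shows "\<exists>u. \<forall>ja q rh ri rs d. d = make_dat n A B C H (map sgn (x @ cs))
      (map (\<lambda>j. if sum_list (drop n (H ! j)) = 0 then 0 else u j) [0..<length H]) 2 ja (length H) q rh ri rs \<longrightarrow>
      solution_target n A B C H x cs u 2 ja (length H) q rh ri rs d \<and> degenerate_family d A B C \<and>
      consistent n cs d \<and> x \<in> points (dat_family n d)"
proof -
  let ?x = "x @ cs"
  let ?s = "\<lambda>E. monom_at E (map sgn ?x)"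
  let ?cl = "\<lambda>h. class_active (?s A) (?s B) (?s C) (dot A h) (dot B h) (dot C h)"
  have s0: "?s E = 0 \<longleftrightarrow> monom_at E ?x = 0" for E by (simp only: monom_at_sgn sgn_0_0)
  have dots: "dot E (vals p ?x) = dot F (vals p ?x)"
    if "monom_at E ?x + monom_at F ?x = 0" "monom_at E ?x \<noteq> 0" "E \<in> {A, B, C}" "F \<in> {A, B, C}" "prime p" for E F p
  proof -
    have "\<bar>monom_at E ?x\<bar> = \<bar>monom_at F ?x\<bar>" "monom_at F ?x \<noteq> 0" using that(1,2) by auto
    moreover have "length E = length ?x" "length F = length ?x" using that(3,4) lens by auto
    ultimately show ?thesis
      using multiplicity_monom_at[OF that(5), of E ?x] multiplicity_monom_at[OF that(5), of F ?x] that(2) by simp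
  qed
  \<comment> \<open>E and F are the two non-zero monomials. If all three vanish, E = F makes the
    condition on the valuations void.\<close>
  have "\<exists>E F. E \<in> {A, B, C} \<and> F \<in> {A, B, C} \<and> (\<forall>p. prime p \<longrightarrow> dot E (vals p ?x) = dot F (vals p ?x)) \<and>
      (\<forall>h. dot E h = dot F h \<longrightarrow> ?cl h = 0)"
  proof -
    consider "monom_at A ?x = 0" "monom_at B ?x = 0" "monom_at C ?x = 0"
      | "monom_at A ?x = 0" "monom_at B ?x \<noteq> 0" "monom_at C ?x \<noteq> 0"
      | "monom_at A ?x \<noteq> 0" "monom_at B ?x = 0" "monom_at C ?x \<noteq> 0"
      | "monom_at A ?x \<noteq> 0" "monom_at B ?x \<noteq> 0" "monom_at C ?x = 0"
      using eq degenerate by linarith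
    then show ?thesis
    proof cases
      case 1
      then show ?thesis by (intro exI[of _ A]) (auto simp: class_active_def s0 s0[unfolded map_append])
    next
      case 2
      then show ?thesis using dots[of B C] eq
        by (intro exI[of _ B] exI[of _ C]) (auto simp: class_active_def s0 s0[unfolded map_append])
    next
      case 3
      then show ?thesis using dots[of A C] eq
        by (intro exI[of _ A] exI[of _ C]) (auto simp: class_active_def s0 s0[unfolded map_append])
    next
      case 4
      then show ?thesis using dots[of A B] eq
        by (intro exI[of _ A] exI[of _ B]) (auto simp: class_active_def s0 s0[unfolded map_append])
    qed
  qed
  then obtain E F where EF: "E \<in> {A, B, C}" "F \<in> {A, B, C}"
    "\<And>p. prime p \<Longrightarrow> dot E (vals p ?x) = dot F (vals p ?x)" "\<And>h. dot E h = dot F h \<Longrightarrow> ?cl h = 0" by blast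
  have lenEF: "length E = n + length cs" "length F = n + length cs" using EF(1,2) lens by auto
  have KEF: "nthz E i \<le> K" "nthz F i \<le> K" for i using EF(1,2) K(1-3) by auto
  have "\<exists>c. (\<forall>i<n + length cs. nthz (vals p ?x) i = (\<Sum>j<length H. c j * nthz (H ! j) i)) \<and>
      (\<forall>j<length H. c j > 0 \<longrightarrow> dot E (H ! j) = dot F (H ! j))" if p: "prime p" for p
  proof -
    have len_v: "length (vals p ?x) = n + length cs" using lens by (simp add: vals_def)
    \<comment> \<open>Taking E also as the third monomial makes the inequality of the cone
      trivial.\<close>
    have "\<exists>c. (\<forall>i<n + length cs. nthz (vals p ?x) i = (\<Sum>j<length H. c j * nthz (H ! j) i)) \<and>
      (\<forall>j<length H. c j > 0 \<longrightarrow> dot E (H ! j) = dot F (H ! j) \<and> dot E (H ! j) \<le> dot E (H ! j))"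
      by (rule cone_generators[OF len_v lenEF(1,2,1) _ _ _ K(4) _ _ H]) (use KEF EF(3)[OF p] in auto)
    then show ?thesis by blast
  qed
  then obtain c where c: "\<And>p i. prime p \<Longrightarrow> i < n + length cs \<Longrightarrow>
      nthz (vals p ?x) i = (\<Sum>j<length H. c p j * nthz (H ! j) i)"
    "\<And>p j. prime p \<Longrightarrow> j < length H \<Longrightarrow> c p j > 0 \<Longrightarrow> dot E (H ! j) = dot F (H ! j)"
    by metis
  define u where "u = prime_product (primes_of ?x) c"
  have u_pos: "u j > 0" for j unfolding u_def using prime_primes_of by (rule prime_product_pos)
  have u_one: "u j = 1" if "j < length H" "?cl (H ! j) = 4" for j
  proof (rule ccontr)
    assume "u j \<noteq> 1"
    then obtain r where r: "prime r" "r dvd u j" using prime_factor_nat by blast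
    then have "c r j > 0"
      using prime_dvd_prime_product[OF finite_primes_of, of ?x r c j] prime_primes_of unfolding u_def by blast
    then show False using c(2)[OF r(1) that(1)] EF(4) that(2) by fastforce
  qed
  have dec: "nthz ?x i = sgn (nthz ?x i) * (\<Prod>j<length H. int (u j) ^ nthz (H ! j) i)" if "i < n + length cs" for i
    unfolding u_def using that lens(4) c(1) prime_primes_of by (intro decomposition_of_valuations) auto
  have "solution_target n A B C H x cs u 2 ja (length H) q rh ri rs d \<and> degenerate_family d A B C \<and>
      consistent n cs d \<and> x \<in> points (dat_family n d)"
    if d: "d = make_dat n A B C H (map sgn ?x)
      (map (\<lambda>j. if sum_list (drop n (H ! j)) = 0 then 0 else u j) [0..<length H]) 2 ja (length H) q rh ri rs"
    for ja q rh ri rs d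
  proof -
    interpret solution_target n A B C H x cs u 2 ja "length H" q rh ri rs d
    proof
      show "u j = 1" if "j < length H" "nthz (cls d) j = 4" for j
        using that u_one[of j] by (simp add: d make_dat_def nthz_eq)
    qed (use lens u_pos dec d in auto)
    interpret degenerate_family d A B C
    proof
      show "monom_at A (eps d) + monom_at B (eps d) + monom_at C (eps d) = 0"
        using eq degenerate unfolding d_simps(10) monom_at_sgn by (auto simp: sgn_if)
    qed (use d_nthz in auto)
    let ?m = "length H"
    define uu where "uu = params ?m 0 0 1 (\<lambda>_. 0) (\<lambda>j. int (u j)) (\<lambda>j. int (u j))"
    have gv: "poly_at (gen_poly d j) uu = int (u j)" if j: "j < ?m" for j
      using gen_poly_params[of j d] j u_class_4[OF j] d_nthz(2)[OF j] cls_cases[of j]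
      unfolding uu_def by auto
    have "uu ! i \<in> range_at (param_range d i) (take i uu)" if i: "i < 3 + 3 * ?m" for i
    proof (cases "i = 2")
      case True
      have "nthz (cls d) j \<noteq> 1" if "j < ?m" for j using cls_cases[of j] that by auto
      then show ?thesis unfolding uu_def by (intro params_in_ranges) (use True in auto)
    next
      case False
      then show ?thesis using param_range_no_class[of i] i by simp
    qed
    then have a: "adm d (3 + 3 * length (gens d)) uu" by (simp add: adm_def uu_def params_nth)
    have "value_at (coord_expr d i) uu = x ! i" if "i < n" for i
    proof -
      have "value_at (coord_expr d i) uu = nthz (eps d) i * (\<Prod>j<?m. int (u j) ^ nthz (H ! j) i)"
        using coord_expr_value(2)[of i uu] by (simp add: gv d_nthz(6))
      also have "\<dots> = nthz (x @ cs) i" using decomp[of i] nthz_eps[of i] that by simp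
      also have "\<dots> = x ! i" using that lens(4) by (simp add: nthz_eq nth_append)
      finally show ?thesis .
    qed
    then have "x = map (\<lambda>i. value_at (coord_expr d i) uu) [0..<n]"
      using lens(4) by (intro nth_equalityI) auto
    then have "x \<in> points (dat_family n d)" using a unfolding points_dat_family by blast
    then show ?thesis using consistent solution_target_axioms degenerate_family_axioms by blast
  qed
  then show ?thesis by blast
qed

text \<open>The fixed part of W, so that divisibility by it is a condition modulo q, times the fixed
  parameters of U, so that p, being prime to q, is prime to them.\<close>

definition base_modulus :: "nat \<Rightarrow> nat list \<Rightarrow> nat list \<Rightarrow> nat list \<Rightarrow> nat list list \<Rightarrow> nat list \<Rightarrow> nat" where
  "base_modulus n A B C H ka = (\<Prod>j<length H. if sum_list (drop n (H ! j)) = 0 then 1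
    else if cone_class A B C (H ! j) = 3
      then nthz ka j ^ spread (dot A (H ! j)) (dot B (H ! j)) (dot C (H ! j))
    else if cone_class A B C (H ! j) = 1 then nthz ka j else 1)"

lemma monom_at_sgn_unit: "monom_at E x \<noteq> 0 \<Longrightarrow> monom_at E (map sgn x) dvd 1"
  unfolding monom_at_sgn by (auto simp: sgn_if)

text \<open>A prime factor of the parameter \<open>ja\<close> supplies p; it is coprime to all of U
  and W because generators of different non-zero classes are coprime. The bounds on
  \<open>rh\<close>, \<open>ri\<close> and \<open>rs\<close> place the datum in
  \<open>all_dats\<close>.\<close>

lemma solution_in_mode_1:
  assumes dec: "decomposes A B C H (x @ cs) u" and lens: "length A = n + length cs" "length B = n + length cs"
    "length C = n + length cs" "length x = n"
    and eq: "monom_at A (x @ cs) + monom_at B (x @ cs) + monom_at C (x @ cs) = 0"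
    "monom_at A (x @ cs) \<noteq> 0" "monom_at B (x @ cs) \<noteq> 0" "monom_at C (x @ cs) \<noteq> 0"
    and jb: "jb < length H" "cone_class A B C (H ! jb) = 3"
      "spread (dot A (H ! jb)) (dot B (H ! jb)) (dot C (H ! jb)) = 1" "sum_list (drop n (H ! jb)) = 0"
    and ja: "ja < length H" "cone_class A B C (H ! ja) = 2" "sum_list (drop n (H ! ja)) = 0" "u ja \<noteq> 1"
    and ka: "ka = map (\<lambda>j. if sum_list (drop n (H ! j)) = 0 then 0 else u j) [0..<length H]"
    and q: "q = base_modulus n A B C H ka"
  shows "\<exists>rh ri rs. rh \<le> 3 * q ^ 2 \<and> ri \<le> q \<and> length rs = length H \<and> (\<forall>r\<in>set rs. r \<le> q) \<and>
    main_family (make_dat n A B C H (map sgn (x @ cs)) ka 1 ja jb q rh ri rs) \<and>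
    consistent n cs (make_dat n A B C H (map sgn (x @ cs)) ka 1 ja jb q rh ri rs) \<and>
    x \<in> points (dat_family n (make_dat n A B C H (map sgn (x @ cs)) ka 1 ja jb q rh ri rs))"
proof -
  let ?m = "length H"
  let ?fix = "\<lambda>j. sum_list (drop n (H ! j))"
  let ?cl = "\<lambda>j. cone_class A B C (H ! j)"
  let ?fac = "\<lambda>j. if ?fix j = 0 then 1
    else if ?cl j = 3 then nthz ka j ^ spread (dot A (H ! j)) (dot B (H ! j)) (dot C (H ! j))
    else if ?cl j = 1 then nthz ka j else 1"
  have u_pos: "u j > 0" if "j < ?m" for j using dec that unfolding decomposes_def by blast
  have cop: "coprime (u j) (u k)" if "j < ?m" "k < ?m" "?cl j \<in> {1, 2, 3}" "?cl k \<in> {1, 2, 3}" "?cl j \<noteq> ?cl k" for j k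
    using dec that unfolding decomposes_def by blast
  have ka_nth: "nthz ka j = u j" if "j < ?m" "?fix j \<noteq> 0" for j
    using that by (simp add: ka nthz_eq del: sum_list_eq_0_iff)
  have q_pos: "q > 0"
    unfolding q base_modulus_def using u_pos ka_nth by (intro prod_pos) (auto simp del: sum_list_eq_0_iff)
  obtain p0 where p0: "prime p0" "p0 dvd u ja" using prime_factor_nat[OF ja(4)] by blast
  \<comment> \<open>The negative sign forces k to be negative below; a small positive prime could
    give k = 0.\<close>
  define p where "p = - int p0"
  have cop_p: "coprime p (int (u j))" if "j < ?m" "?cl j \<in> {1, 3}" for j
  proof -
    have "coprime (u ja) (u j)" using cop[OF ja(1) that(1)] ja(2) that(2) by auto
    then have "coprime p0 (u j)" using p0(2) by (meson coprime_divisors dvd_refl)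
    then show ?thesis by (simp add: p_def)
  qed
  have "coprime p (int q)"
  proof -
    have "coprime p0 q" unfolding q base_modulus_def
    proof (rule prod_coprime_right)
      fix j assume "j \<in> {..<?m}"
      then have j: "j < ?m" by simp
      have "coprime p0 (u j)" if "?cl j \<in> {1, 3}" using cop_p[OF j that] by (simp add: p_def)
      then show "coprime p0 (?fac j)"
        using ka_nth[OF j] by (simp del: sum_list_eq_0_iff)
    qed
    then show ?thesis by (simp add: p_def)
  qed
  then obtain t where t: "[p * t = 1] (mod int q)" using cong_solve_coprime_int by blast
  define ri where "ri = nat (t mod int q)"
  have mod_le: "y mod int q \<le> int q" for y :: int
    using q_pos pos_mod_bound[of "int q" y] by linarith
  have ri: "int ri = t mod int q" "ri \<le> q"
    using q_pos mod_le[of t] by (simp_all add: ri_def nat_le_iff)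
  have p_ri: "[p * int ri = 1] (mod int q)"
    using t by (simp add: ri(1) cong_def mod_simps)
  define L where "L = 3 * int q ^ 2"
  have L: "L > 0" using q_pos by (simp add: L_def)
  \<comment> \<open>Since p = Lk + (rh - 1), the residue is that of p + 1.\<close>
  define rh where "rh = nat ((p + 1) mod L)"
  have rh: "int rh = (p + 1) mod L" "int rh < L" using L by (auto simp: rh_def)
  have rh_less: "rh < 3 * q ^ 2"
    using rh(2) unfolding L_def by (metis of_nat_less_iff of_nat_mult of_nat_numeral of_nat_power)
  define k where "k = (p + 1) div L"
  have p_eq: "3 * int q ^ 2 * k + (int rh - 1) = p"
    unfolding L_def[symmetric] k_def rh(1) by (simp add: algebra_simps)
  have "p + 1 < 0" using prime_ge_2_nat[OF p0(1)] by (simp add: p_def)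
  then have "k \<noteq> 0" unfolding k_def using L by (metis div_neg_pos_less0 less_irrefl)
  then obtain s s' where ss: "k dvd (2 * s + 1) * (3 * s' + 1)" using ex_dvd_nonzero_product by blast
  \<comment> \<open>The cofactor of p at \<open>ja\<close>, with the sign that makes
    \<open>p * w ja\<close> equal to \<open>u ja\<close>.\<close>
  define w where "w j = (if j = ja then - int (u ja div p0) else int (u j))" for j
  define r where "r j = nat (w j mod int q)" for j
  have r: "int (r j) = w j mod int q" "r j \<le> q" for j
    using q_pos mod_le[of "w j"] by (simp_all add: r_def nat_le_iff)
  define rs where "rs = map r [0..<?m]"
  have rs_nth: "nthz rs j = r j" if "j < ?m" for j using that by (simp add: rs_def nthz_eq)
  define d where d_eq: "d = make_dat n A B C H (map sgn (x @ cs)) ka 1 ja jb q rh ri rs"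
  interpret solution_target n A B C H x cs u 1 ja jb q rh ri rs d
    by (rule decomposes_target) (use assms d_eq in auto)
  \<comment> \<open>Obtained by solving the two forms of \<open>gen_poly\<close> for their
    parameter: \<open>r p' p + q T = u\<close> in U and \<open>q T + r = w\<close> in V.\<close>
  define T where "T j = (if nthz (fixs d) j = 0 \<and> ?cl j = 1 then (int (u j) - int (r j * ri) * p) div int q
    else if nthz (fixs d) j = 0 \<and> ?cl j = 2 then (w j - int (r j)) div int q else int (u j))" for j
  have cl: "nthz (cls d) j = ?cl j" if "j < ?m" for j using d_nthz(4)[OF that] by simp
  have T1: "int q * T j = int (u j) - int (r j * ri) * p"
    if "j < ?m" "nthz (fixs d) j = 0" "?cl j = 1" for j
  proof -
    have "j \<noteq> ja" using that ja by auto
    then have "[int (r j) = int (u j)] (mod int q)" by (simp add: r(1) w_def)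
    then have "[int (r j) * (p * int ri) = int (u j) * 1] (mod int q)" using p_ri by (rule cong_mult)
    then have "int q dvd int (u j) - int (r j * ri) * p"
      unfolding cong_iff_dvd_diff by (simp add: dvd_diff_commute ac_simps)
    then show ?thesis using that by (simp add: T_def)
  qed
  have T2: "int q * T j = w j - int (r j)" if "j < ?m" "nthz (fixs d) j = 0" "?cl j = 2" for j
    using that by (simp add: T_def r(1) minus_mod_eq_mult_div)
  have ex_S: "\<exists>s. T j dvd p * s + 1" if j: "j < ?m" "nthz (fixs d) j = 0" "?cl j = 1" for j
  proof (rule ex_dvd_linear)
    have "coprime p (- int (r j * ri) * p + int (u j))" using cop_p[of j] j by (intro coprime_add_multiple) auto
    then have "coprime p (int q * T j)" unfolding T1[OF j] by (simp add: algebra_simps)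
    then show "coprime p (T j)" by simp
  qed
  define S where "S j = (SOME s. T j dvd p * s + 1)" for j
  have S: "T j dvd p * S j + 1" if "j < ?m" "nthz (fixs d) j = 0" "?cl j = 1" for j
    unfolding S_def by (rule someI_ex[OF ex_S[OF that]])
  define uu where "uu = params ?m s s' k S T (\<lambda>j. int (u j))"
  have cl_range: "cone_class A B C h \<in> {0, 1, 2, 3, 4}" for h by (simp add: cone_class_def class3_def)
  have w_ja: "p * w ja = int (u ja)"
    using p0(2) by (simp add: p_def w_def flip: of_nat_mult)
  have gv: "poly_at (gen_poly d j) uu = int (u j)" if j: "j < ?m" for j
  proof -
    have pe: "3 * int (md_q d) ^ 2 * k + (int (rho d) - 1) = p" using p_eq by simp
    note g = gen_poly_params[of j d s s' k S T "\<lambda>j. int (u j)", unfolded pe]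
    consider "nthz (cls d) j = 4" | "nthz (cls d) j \<noteq> 4" "nthz (fixs d) j \<noteq> 0"
      | "nthz (fixs d) j = 0" "?cl j = 0" | "nthz (fixs d) j = 0" "?cl j = 3"
      | "nthz (fixs d) j = 0" "?cl j = 1" | "nthz (fixs d) j = 0" "?cl j = 2"
      using cl_range[of "H ! j"] cl[OF j] by auto
    then show ?thesis
    proof cases
      case 1
      then show ?thesis using g j u_class_4[OF j] by (simp add: uu_def)
    next
      case 2
      then show ?thesis using g j d_nthz(2)[OF j] by (simp add: uu_def)
    next
      case 3
      then show ?thesis using g j cl[OF j] by (simp add: uu_def T_def)
    next
      case 4
      then show ?thesis using g j cl[OF j] by (simp add: uu_def)
    next
      case 5
      then show ?thesis using g j cl[OF j] T1[OF j] rs_nth[OF j] by (simp add: uu_def)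
    next
      case 6
      then show ?thesis using g j cl[OF j] T2[OF j] rs_nth[OF j] w_ja by (simp add: uu_def w_def)
    qed
  qed
  note target = eq jb gv
  have sg: "nthz (sgs d) 0 dvd 1" "nthz (sgs d) 2 dvd 1"
    unfolding d_simps(9,10) using monom_at_sgn_unit eq(2,4) by (simp_all add: nthz_eq del: map_append)
  have mf: "main_family d"
  proof
    have den: "poly_at (den_poly d 0) [] dvd int q"
    proof -
      have "(\<Prod>j<?m. if nthz (cls d) j = 3 \<and> j \<noteq> jw d \<and> (nthz (fixs d) j \<noteq> 0 \<or> j < 0)
          then poly_at (gen_poly d j) [] ^ nthz (mults d) j else 1) dvd
        (\<Prod>j<?m. int (?fac j))"
      proof (rule prod_dvd_prod)
        fix j assume "j \<in> {..<?m}"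
        then have j: "j < ?m" by simp
        show "(if nthz (cls d) j = 3 \<and> j \<noteq> jw d \<and> (nthz (fixs d) j \<noteq> 0 \<or> j < 0)
          then poly_at (gen_poly d j) [] ^ nthz (mults d) j else 1) dvd
          int (?fac j)"
          using cl[OF j] d_nthz(1-3)[OF j] ka_nth[OF j] by (simp add: gen_poly_def del: sum_list_eq_0_iff)
      qed
      then have "nthz (sgs d) 2 * (\<Prod>j<?m. if nthz (cls d) j = 3 \<and> j \<noteq> jw d \<and> (nthz (fixs d) j \<noteq> 0 \<or> j < 0)
          then poly_at (gen_poly d j) [] ^ nthz (mults d) j else 1) dvd 1 * int q"
        unfolding q base_modulus_def of_nat_prod using sg(2) by (intro mult_dvd_mono)
      then show ?thesis unfolding poly_at_den_poly by simp
    qed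
    show "poly_at (den_poly d 0) [] \<noteq> 0"
      by (rule den_0_nonzero[of uu]) (use target in auto)
    have num: "[poly_at (num_poly d) uu = poly_at (num_poly d) []] (mod int q)"
      using num_poly_cong[of d uu] by simp
    have "poly_at (den_poly d 0) [] dvd poly_at (num_poly d) uu"
      by (rule den_0_dvd_num) (use target in auto)
    then show "poly_at (den_poly d 0) [] dvd poly_at (num_poly d) []"
      using cong_dvd_iff[OF cong_dvd_modulus[OF num den]] by blast
    have kap_dvd: "nthz (kap d) j dvd q" if j: "j < ?m" "nthz (cls d) j = 1" "nthz (fixs d) j \<noteq> 0" for j
    proof -
      have "nthz (kap d) j = (?fac j)"
        using j cl[OF j(1)] d_nthz(1,2)[OF j(1)] ka_nth[OF j(1)] by (simp del: sum_list_eq_0_iff)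
      also have "\<dots> dvd q" unfolding q base_modulus_def using j(1) by (intro dvd_prodI) auto
      finally show ?thesis .
    qed
    have inv: "int q dvd (int rh - 1) * int ri - 1"
    proof -
      have "[int rh - 1 = p] (mod int q)"
        unfolding p_eq[symmetric] cong_iff_dvd_diff by (simp add: power2_eq_square)
      then have "[(int rh - 1) * int ri = p * int ri] (mod int q)" by (rule cong_mult) simp
      then show ?thesis using p_ri cong_trans unfolding cong_iff_dvd_diff[symmetric] by blast
    qed
    have "spread (dot A (H ! ja)) (dot B (H ! ja)) (dot C (H ! ja)) > 0"
      using ja(2) by (auto simp: cone_class_def class3_def spread_def split: if_splits)
    then show "md d = 0 \<and> poly_at (num_poly d) [] \<noteq> 0 \<or> coprime_data d"
      using q_pos den sg(1) kap_dvd rh_less inv ja cl[OF ja(1)] d_nthz(1,3)[OF ja(1)]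
      by (simp add: coprime_data_def del: sum_list_eq_0_iff d_simps(9) of_nat_mult)
  qed (use jb cl d_nthz in \<open>auto simp del: sum_list_eq_0_iff\<close>)
  have "x \<in> points (dat_family n d)"
  proof (rule in_points[of uu])
    show "uu ! i \<in> range_at (param_range d i) (take i uu)" if "i < 3 + 2 * ?m" for i
      unfolding uu_def by (rule params_in_ranges) (use that ss S cl p_eq in auto)
  qed (use target mf in \<open>auto simp: uu_def params_nth\<close>)
  moreover have "\<forall>a\<in>set rs. a \<le> q" by (auto simp: rs_def r(2))
  moreover have "length rs = ?m" by (simp add: rs_def)
  ultimately show ?thesis
    using mf consistent ri(2) less_imp_le[OF rh_less] unfolding d_eq
    by - (rule exI[of _ rh], rule exI[of _ ri], rule exI[of _ rs], intro conjI; assumption)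
qed

section \<open>The algorithm\<close>

text \<open>The sum exceeds every single exponent, and \<open>Suc\<close> makes the bound at least
  1, as \<open>cone_pieces\<close> requires.\<close>

definition exps_bound :: "nat list \<Rightarrow> nat list \<Rightarrow> nat list \<Rightarrow> nat" where
  "exps_bound A B C = Suc (sum_list A + sum_list B + sum_list C)"

definition generators :: "nat \<Rightarrow> nat list \<Rightarrow> nat list \<Rightarrow> nat list \<Rightarrow> nat list list" where
  "generators \<nu> A B C = List.n_lists \<nu> [0..<Suc (gen_bound (exps_bound A B C))]"

text \<open>Outside mode 1 the choice \<open>q = 0\<close> leaves 0 as the only value for
  \<open>rh\<close>, \<open>ri\<close> and the residues. The indices may equal
  \<open>length H\<close>, which stands for no generator and is the value of \<open>jb\<close> for
  degenerate data.\<close>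

definition all_dats :: "nat \<Rightarrow> nat list \<Rightarrow> nat list \<Rightarrow> nat list \<Rightarrow> int list \<Rightarrow> dat list" where
  "all_dats n A B C cs =
    (let H = generators (n + length cs) A B C in
     concat (map (\<lambda>e.
     concat (map (\<lambda>ka.
     concat (map (\<lambda>mo.
     concat (map (\<lambda>ja.
     concat (map (\<lambda>jb.
     (let q = (if mo = 1 then base_modulus n A B C H ka else 0) in
     concat (map (\<lambda>rh.
     concat (map (\<lambda>ri.
     map (\<lambda>rs. make_dat n A B C H e ka mo ja jb q rh ri rs)
       (List.n_lists (length H) [0..<Suc q]))
       [0..<Suc q]))
       [0..<Suc (3 * q ^ 2)])))
       [0..<Suc (length H)]))
       [0..<Suc (length H)]))
       [0..<3]))
       (List.n_lists (length H) [0..<Suc (nat (\<Sum>c\<leftarrow>cs. \<bar>c\<bar>))])))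
       (List.n_lists (n + length cs) [-1, 0, 1])))"

text \<open>What enumeration cannot guarantee. The remaining conditions of
  \<open>degenerate_family\<close> hold for every \<open>make_dat\<close> of mode 2.\<close>

definition valid_dat :: "nat \<Rightarrow> int list \<Rightarrow> dat \<Rightarrow> bool" where
  "valid_dat n cs d \<longleftrightarrow> consistent n cs d \<and>
    (if md d = 2 then length (gens d) \<le> jw d \<and> nthz (sgs d) 0 + nthz (sgs d) 1 + nthz (sgs d) 2 = 0
     else main_family d)"

definition families :: "nat \<Rightarrow> nat list \<Rightarrow> nat list \<Rightarrow> nat list \<Rightarrow> int list \<Rightarrow> family list" where
  "families n A B C cs = map (\<lambda>d. dat_family n d) (filter (\<lambda>d. valid_dat n cs d) (all_dats n A B C cs))"

text \<open>Three choices of the monomial that is solved for, each with both orders of the other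
  two, since mode 1 singles out a parameter of the second monomial.\<close>

definition description :: "nat \<Rightarrow> int \<Rightarrow> int \<Rightarrow> int \<Rightarrow> nat list \<Rightarrow> nat list \<Rightarrow> nat list \<Rightarrow> family list" where
  "description n a b c \<alpha> \<beta> \<gamma> =
    (let cs = [a, b, - c]; A = \<alpha> @ [1, 0, 0]; B = \<beta> @ [0, 1, 0]; C = \<gamma> @ [0, 0, 1] in
     families n A B C cs @ families n B A C cs @ families n A C B cs @ families n C A B cs @
     families n C B A cs @ families n B C A cs)"

section \<open>Computability of the algorithm\<close>

lemma computable_prod_list_nat [computable_intros]:
  "computable f \<Longrightarrow> computable (\<lambda>x. prod_list (f x :: nat list))"
  unfolding prod_list.eq_foldr comp_id by (intro computable_intros)

lemma computable_prod_int [computable_intros]: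
  fixes k :: "'a :: enc \<Rightarrow> nat" and f :: "'a \<Rightarrow> nat \<Rightarrow> int"
  assumes "computable (\<lambda>p. f (fst p) (snd p))" "computable k"
  shows "computable (\<lambda>x. \<Prod>j<k x. f x j)"
proof -
  have "(\<Prod>j<k x. f x j) = prod_list (map (\<lambda>j. f x j) [0..<k x])" for x
    by (simp add: prod.list_conv_set_nth lessThan_atLeast0)
  then show ?thesis by (simp only:) (intro computable_intros assms)
qed

lemma computable_prod_nat [computable_intros]:
  fixes k :: "'a :: enc \<Rightarrow> nat" and f :: "'a \<Rightarrow> nat \<Rightarrow> nat"
  assumes "computable (\<lambda>p. f (fst p) (snd p))" "computable k"
  shows "computable (\<lambda>x. \<Prod>j<k x. f x j)"
proof -
  have "(\<Prod>j<k x. f x j) = prod_list (map (\<lambda>j. f x j) [0..<k x])" for x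
    by (simp add: prod.list_conv_set_nth lessThan_atLeast0)
  then show ?thesis by (simp only:) (intro computable_intros assms)
qed

lemma computable_sum_nat [computable_intros]:
  fixes k :: "'a :: enc \<Rightarrow> nat" and f :: "'a \<Rightarrow> nat \<Rightarrow> nat"
  assumes "computable (\<lambda>p. f (fst p) (snd p))" "computable k"
  shows "computable (\<lambda>x. \<Sum>j<k x. f x j)"
proof -
  have "(\<Sum>j<k x. f x j) = sum_list (map (\<lambda>j. f x j) [0..<k x])" for x
    by (simp add: sum.list_conv_set_nth lessThan_atLeast0)
  then show ?thesis by (simp only:) (intro computable_intros assms)
qed

lemma computable_dvd_nat [computable_intros]:
  "computable f \<Longrightarrow> computable g \<Longrightarrow> computable (\<lambda>x. f x dvd (g x :: nat))"
  unfolding dvd_eq_mod_eq_0 by (intro computable_intros)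

lemma computable_dot [computable_intros]:
  "computable f \<Longrightarrow> computable g \<Longrightarrow> computable (\<lambda>x. dot (f x) (g x))"
  unfolding dot_def by (rule computable_comp2, (intro computable_intros)+)

lemma computable_monom_at [computable_intros]:
  "computable f \<Longrightarrow> computable g \<Longrightarrow> computable (\<lambda>x. monom_at (f x) (g x))"
  unfolding monom_at_def by (rule computable_comp2, (intro computable_intros)+)

lemma computable_class3 [computable_intros]:
  "computable f \<Longrightarrow> computable g \<Longrightarrow> computable h \<Longrightarrow> computable (\<lambda>x. class3 (f x) (g x) (h x))"
  unfolding class3_def by (intro computable_intros)

lemma computable_spread [computable_intros]:
  "computable f \<Longrightarrow> computable g \<Longrightarrow> computable h \<Longrightarrow> computable (\<lambda>x. spread (f x) (g x) (h x))"
  unfolding spread_def by (intro computable_intros)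

lemma computable_cone_class [computable_intros]:
  "computable f \<Longrightarrow> computable g \<Longrightarrow> computable h \<Longrightarrow> computable k \<Longrightarrow>
    computable (\<lambda>x. cone_class (f x) (g x) (h x) (k x))"
  unfolding cone_class_def by (intro computable_intros)

lemma computable_class_active [computable_intros]:
  assumes "computable f1" "computable f2" "computable f3" "computable f4" "computable f5" "computable f6"
  shows "computable (\<lambda>x. class_active (f1 x) (f2 x) (f3 x) (f4 x) (f5 x) (f6 x))"
  unfolding class_active_def by (intro computable_intros assms)

lemma computable_gen_exp [computable_intros]:
  "computable f \<Longrightarrow> computable g \<Longrightarrow> computable h \<Longrightarrow> computable (\<lambda>x. gen_exp (f x) (g x) (h x))"
  unfolding gen_exp_def by (intro computable_intros)

lemma computable_fixed_value [computable_intros]: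
  "computable f \<Longrightarrow> computable g \<Longrightarrow> computable (\<lambda>x. fixed_value (f x) (g x))"
  unfolding fixed_value_def by (intro computable_intros)

lemma computable_consistent: "computable (\<lambda>p. consistent (fst p) (fst (snd p)) (snd (snd p)))"
  unfolding consistent_def by (intro computable_intros)

lemma computable_main_family [computable_intros]:
  "computable f \<Longrightarrow> computable (\<lambda>x. main_family (f x))"
proof (rule computable_comp[of main_family])
  show "computable main_family"
    unfolding main_family_def coprime_data_def poly_at_Nil by (intro computable_intros)
qed

lemma computable_valid_dat: "computable (\<lambda>p. valid_dat (fst p) (fst (snd p)) (snd (snd p)))"
  unfolding valid_dat_def by (intro computable_intros computable_consistent)

lemma computable_gen_bound [computable_intros]: "computable f \<Longrightarrow> computable (\<lambda>x. gen_bound (f x))"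
  unfolding gen_bound_def by (intro computable_intros)

lemma computable_generators [computable_intros]:
  assumes "computable f" "computable g" "computable h" "computable k"
  shows "computable (\<lambda>x. generators (f x) (g x) (h x) (k x))"
  unfolding generators_def exps_bound_def by (intro computable_intros assms)

lemma computable_base_modulus [computable_intros]:
  assumes "computable f1" "computable f2" "computable f3" "computable f4" "computable f5" "computable f6"
  shows "computable (\<lambda>x. base_modulus (f1 x) (f2 x) (f3 x) (f4 x) (f5 x) (f6 x))"
proof -
  \<comment> \<open>Within range \<open>hd (drop j H)\<close> equals \<open>H ! j\<close>, and it is
    built from functions already shown to be computable.\<close>
  have eq: "base_modulus n A B C H ka = (\<Prod>j<length H.
      (let h = hd (drop j H) in if sum_list (drop n h) = 0 then 1
       else if cone_class A B C h = 3 then nthz ka j ^ spread (dot A h) (dot B h) (dot C h)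
       else if cone_class A B C h = 1 then nthz ka j else 1))" for n A B C H ka
    unfolding base_modulus_def by (intro prod.cong refl) (simp add: hd_drop_conv_nth Let_def)
  have "computable (\<lambda>p. base_modulus (fst p) (fst (snd p)) (fst (snd (snd p))) (fst (snd (snd (snd p))))
      (fst (snd (snd (snd (snd p))))) (snd (snd (snd (snd (snd p))))))"
    unfolding eq by (intro computable_intros)
  from computable_comp[OF this, of "\<lambda>x. (f1 x, f2 x, f3 x, f4 x, f5 x, f6 x)"] show ?thesis
    unfolding fst_conv snd_conv by this (intro computable_intros assms)
qed

lemma computable_all_dats:
  "computable (\<lambda>p. all_dats (fst p) (fst (snd p)) (fst (snd (snd p))) (fst (snd (snd (snd p))))
    (snd (snd (snd (snd p)))))"
  unfolding all_dats_def make_dat_def by (intro computable_intros)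

lemma computable_families [computable_intros]:
  assumes "computable f1" "computable f2" "computable f3" "computable f4" "computable f5"
  shows "computable (\<lambda>x. families (f1 x) (f2 x) (f3 x) (f4 x) (f5 x))"
proof -
  have valid: "computable (\<lambda>x. valid_dat (g1 x) (g2 x) (g3 x))" if "computable g1" "computable g2" "computable g3"
    for g1 :: "'c :: enc \<Rightarrow> nat" and g2 g3
    using computable_comp[OF computable_valid_dat, of "\<lambda>x. (g1 x, g2 x, g3 x)"] that
    unfolding fst_conv snd_conv by (simp only: computable_Pair)
  have "computable (\<lambda>p. families (fst p) (fst (snd p)) (fst (snd (snd p))) (fst (snd (snd (snd p))))
      (snd (snd (snd (snd p)))))"
    unfolding families_def by (intro computable_map computable_filter computable_all_dats valid computable_intros)
  from computable_comp[OF this, of "\<lambda>x. (f1 x, f2 x, f3 x, f4 x, f5 x)"]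
  show ?thesis unfolding fst_conv snd_conv by this (intro computable_intros assms)
qed

lemma computable_description:
  "computable (\<lambda>p. description (fst p) (fst (snd p)) (fst (snd (snd p))) (fst (snd (snd (snd p))))
    (fst (snd (snd (snd (snd p))))) (fst (snd (snd (snd (snd (snd p)))))) (snd (snd (snd (snd (snd (snd p)))))))"
  unfolding description_def by (intro computable_intros)

lemma program_for_description:
  "\<exists>algorithm. \<forall>n a b c \<alpha> \<beta> \<gamma>. computes algorithm
    [n, int_encode a, int_encode b, int_encode c, list_encode \<alpha>, list_encode \<beta>, list_encode \<gamma>]
    (encode_description (description n a b c \<alpha> \<beta> \<gamma>))"
proof -
  obtain F where F: "ncomp F" "\<And>p. F (enc p) = enc (description (fst p) (fst (snd p)) (fst (snd (snd p)))
      (fst (snd (snd (snd p)))) (fst (snd (snd (snd (snd p))))) (fst (snd (snd (snd (snd (snd p))))))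
      (snd (snd (snd (snd (snd (snd p)))))))"
    using computable_description by (rule computableE) blast
  obtain f where f: "\<And>x. computes f [x] (F x)" using F(1) unfolding ncomp_def by blast
  obtain g where g: "\<And>x y. computes g [x, y] (prod_encode (x, y))" using ncomp2_pair unfolding ncomp2_def by blast
  let ?p = "Comp f [Comp g [Proj 0, Comp g [Proj 1, Comp g [Proj 2, Comp g [Proj 3, Comp g [Proj 4,
    Comp g [Proj 5, Proj 6]]]]]]]"
  have "computes ?p [n, int_encode a, int_encode b, int_encode c, list_encode \<alpha>, list_encode \<beta>, list_encode \<gamma>]
      (F (enc (n, a, b, c, \<alpha>, \<beta>, \<gamma>)))" for n a b c \<alpha> \<beta> \<gamma>
    unfolding enc_Pair enc_nat_def enc_int_def enc_nat_list
    by (rule computes_Comp1[OF _ f]) ((rule computes_Comp2[OF _ _ g] computes_Proj | simp)+)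
  then show ?thesis unfolding F(2) enc_description by auto
qed

section \<open>Soundness and completeness of the enumeration\<close>

lemma sum_list_bound: "nthz A i \<le> sum_list A" for A :: "nat list"
  by (auto simp: nthz_eq intro: member_le_sum_list)

lemma set_concat_map: "y \<in> set (concat (map f xs)) \<longleftrightarrow> (\<exists>x\<in>set xs. y \<in> set (f x))"
  by auto

lemma set_all_dats:
  "d \<in> set (all_dats n A B C cs) \<longleftrightarrow>
    (let H = generators (n + length cs) A B C in
     \<exists>e\<in>set (List.n_lists (n + length cs) [-1, 0, 1]).
     \<exists>ka\<in>set (List.n_lists (length H) [0..<Suc (nat (\<Sum>c\<leftarrow>cs. \<bar>c\<bar>))]).
     \<exists>mo\<in>set [0..<3]. \<exists>ja\<in>set [0..<Suc (length H)]. \<exists>jb\<in>set [0..<Suc (length H)].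
     let q = (if mo = 1 then base_modulus n A B C H ka else 0) in
     \<exists>rh\<in>set [0..<Suc (3 * q ^ 2)]. \<exists>ri\<in>set [0..<Suc q].
     \<exists>rs\<in>set (List.n_lists (length H) [0..<Suc q]). d = make_dat n A B C H e ka mo ja jb q rh ri rs)"
  unfolding all_dats_def Let_def set_concat_map set_map image_iff by (rule refl)

lemma families_sound:
  assumes lens: "length A = n + length cs" "length B = n + length cs" "length C = n + length cs"
    and F: "F \<in> set (families n A B C cs)"
  shows "integer_valued F"
    "x \<in> points F \<Longrightarrow> length x = n \<and> monom_at A (x @ cs) + monom_at B (x @ cs) + monom_at C (x @ cs) = 0"
proof -
  from F obtain d where d: "d \<in> set (all_dats n A B C cs)" "valid_dat n cs d" "F = dat_family n d"
    unfolding families_def by auto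
  obtain H e ka mo ja jb q rh ri rs where d_def: "d = make_dat n A B C H e ka mo ja jb q rh ri rs"
    using d(1) unfolding set_all_dats Let_def by blast
  have sgs: "sgs d = [monom_at A (eps d), monom_at B (eps d), monom_at C (eps d)]"
    by (simp add: d_def make_dat_def)
  have cons: "consistent n cs d" using d(2) by (simp add: valid_dat_def)
  have "integer_valued F \<and> (x \<in> points F \<longrightarrow>
    length x = n \<and> monom_at A (x @ cs) + monom_at B (x @ cs) + monom_at C (x @ cs) = 0)"
  proof (cases "md d = 2")
    case True
    interpret degenerate_family d A B C
    proof
      show "monom_at A (eps d) + monom_at B (eps d) + monom_at C (eps d) = 0"
        using d(2) True unfolding valid_dat_def sgs by (simp add: nthz_eq)
      show "jw d \<ge> length (gens d)" using d(2) True by (simp add: valid_dat_def)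
      show "nthz (cls d) j = class_active (monom_at A (eps d)) (monom_at B (eps d)) (monom_at C (eps d))
          (gen_dot d A j) (gen_dot d B j) (gen_dot d C j)"
        if "j < length (gens d)" for j
        using that True by (simp add: d_def make_dat_def nthz_eq hd_drop_conv_nth)
    qed fact
    show ?thesis using integer_valued points_solve[OF cons lens] d(3) by blast
  next
    case False
    then interpret main_family d using d(2) by (simp add: valid_dat_def)
    have "nthz (cls d) j = class3 (gen_dot d A j) (gen_dot d B j) (gen_dot d C j)"
      "nthz (mults d) j = spread (gen_dot d A j) (gen_dot d B j) (gen_dot d C j)"
      if "j < length (gens d)" for j
      using that False by (simp_all add: d_def make_dat_def nthz_eq hd_drop_conv_nth cone_class_def)
    then show ?thesis using integer_valued points_solve[OF cons lens sgs] d(3) by blast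
  qed
  then show "integer_valued F"
    "x \<in> points F \<Longrightarrow> length x = n \<and> monom_at A (x @ cs) + monom_at B (x @ cs) + monom_at C (x @ cs) = 0"
    by blast+
qed

lemma all_dats_memI:
  assumes "H = generators (n + length cs) A B C" "length x = n"
    and "length ka = length H" "\<And>k. k \<in> set ka \<Longrightarrow> k \<le> nat (\<Sum>c\<leftarrow>cs. \<bar>c\<bar>)"
    and "mo < 3" "ja \<le> length H" "jb \<le> length H" "q = (if mo = 1 then base_modulus n A B C H ka else 0)"
    and "rh \<le> 3 * q ^ 2" "ri \<le> q" "length rs = length H" "\<forall>r\<in>set rs. r \<le> q"
  shows "make_dat n A B C H (map sgn (x @ cs)) ka mo ja jb q rh ri rs \<in> set (all_dats n A B C cs)"
proof -
  have e: "map sgn (x @ cs) \<in> set (List.n_lists (n + length cs) [-1, 0, 1])"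
    using assms(2) by (auto simp: set_n_lists sgn_if)
  have ka: "ka \<in> set (List.n_lists (length H) [0..<Suc (nat (\<Sum>c\<leftarrow>cs. \<bar>c\<bar>))])"
    using assms(3,4) by (auto simp: set_n_lists less_Suc_eq_le simp del: upt_Suc)
  have rs: "rs \<in> set (List.n_lists (length H) [0..<Suc q])"
    using assms(11,12) by (auto simp: set_n_lists less_Suc_eq_le simp del: upt_Suc)
  have mo: "mo \<in> set [0..<3]" and ja: "ja \<in> set [0..<Suc (length H)]"
    and jb: "jb \<in> set [0..<Suc (length H)]" and rh: "rh \<in> set [0..<Suc (3 * q ^ 2)]"
    and ri: "ri \<in> set [0..<Suc q]"
    using assms(5-7,9,10) by (auto simp: less_Suc_eq_le simp del: upt_Suc)
  show ?thesis
    unfolding set_all_dats Let_def assms(1)[symmetric]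
    by (rule bexI[OF _ e], rule bexI[OF _ ka], rule bexI[OF _ mo], rule bexI[OF _ ja], rule bexI[OF _ jb],
        rule bexI[OF _ rh[unfolded assms(8)]], rule bexI[OF _ ri[unfolded assms(8)]],
        rule bexI[OF _ rs[unfolded assms(8)]]) (simp only: assms(8))
qed

lemma dot_combination:
  assumes "length E = \<nu>" "\<forall>i<\<nu>. nthz v i = (\<Sum>j<m. c j * nthz (H ! j) i)"
  shows "dot E v = (\<Sum>j<m. c j * dot E (H ! j))"
proof -
  have "dot E v = (\<Sum>i<\<nu>. \<Sum>j<m. c j * (nthz E i * nthz (H ! j) i))"
    unfolding dot_def assms(1) using assms(2) by (intro sum.cong refl) (simp add: sum_distrib_left ac_simps)
  also have "\<dots> = (\<Sum>j<m. c j * dot E (H ! j))"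
    unfolding sum.swap[of _ "{..<m}"] dot_def assms(1) by (simp add: sum_distrib_left)
  finally show ?thesis .
qed

text \<open>The excess of C over A is additive over the generators in a decomposition of
  \<open>v\<close> and equals 1 at \<open>v\<close>. A sum of naturals equal to 1 has one non-zero
  term, so some generator has coefficient 1 and excess 1. It vanishes on the constant coordinates
  because \<open>v\<close> does.\<close>

lemma ex_linear_generator:
  assumes lens: "length A = n + k" "length B = n + k" "length C = n + k" "length v = n + k"
    and v: "dot A v = dot B v" "dot C v = Suc (dot A v)" "\<And>i. n \<le> i \<Longrightarrow> nthz v i = 0"
    and H: "H = generators (n + k) A B C"
  shows "\<exists>j<length H. cone_class A B C (H ! j) = 3 \<and>
    spread (dot A (H ! j)) (dot B (H ! j)) (dot C (H ! j)) = 1 \<and> sum_list (drop n (H ! j)) = 0"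
proof -
  have K: "nthz A i \<le> exps_bound A B C" "nthz B i \<le> exps_bound A B C" "nthz C i \<le> exps_bound A B C"
    "exps_bound A B C \<ge> 1" for i
    using sum_list_bound[of A i] sum_list_bound[of B i] sum_list_bound[of C i] by (auto simp: exps_bound_def)
  have le: "dot A v \<le> dot C v" using v(2) by simp
  obtain c where c: "\<forall>i<n + k. nthz v i = (\<Sum>j<length H. c j * nthz (H ! j) i)"
    "\<forall>j<length H. c j > 0 \<longrightarrow> dot A (H ! j) = dot B (H ! j) \<and> dot A (H ! j) \<le> dot C (H ! j)"
    using cone_generators[OF lens(4,1-3) K v(1) le H[unfolded generators_def]] by blast
  have "(\<Sum>j<length H. c j * (dot C (H ! j) - dot A (H ! j))) = dot C v - dot A v"
  proof -
    have "(\<Sum>j<length H. c j * dot C (H ! j)) =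
        (\<Sum>j<length H. c j * (dot C (H ! j) - dot A (H ! j)) + c j * dot A (H ! j))"
      using c(2) by (intro sum.cong refl) (auto simp flip: distrib_left)
    then show ?thesis
      unfolding dot_combination[OF lens(3) c(1)] dot_combination[OF lens(1) c(1)] by (simp add: sum.distrib)
  qed
  then have one: "(\<Sum>j<length H. c j * (dot C (H ! j) - dot A (H ! j))) = 1" using v(2) by simp
  then obtain j where j: "j < length H" "c j * (dot C (H ! j) - dot A (H ! j)) \<noteq> 0"
    by (metis (no_types, lifting) lessThan_iff sum.neutral zero_neq_one)
  have "c j * (dot C (H ! j) - dot A (H ! j)) \<le> 1"
    unfolding one[symmetric] using j(1) by (intro member_le_sum) auto
  then have "c j * (dot C (H ! j) - dot A (H ! j)) = 1" using j(2) by linarith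
  then have d: "c j = 1" "dot C (H ! j) = Suc (dot A (H ! j))" by auto
  moreover have "dot A (H ! j) = dot B (H ! j)" using c(2) j(1) d(1) by simp
  moreover have "nthz (H ! j) i = 0" if "n \<le> i" for i
  proof (cases "i < n + k")
    case True
    then have "(\<Sum>j<length H. c j * nthz (H ! j) i) = 0" using c(1) v(3)[OF that] by metis
    moreover have "c j * nthz (H ! j) i \<le> (\<Sum>j<length H. c j * nthz (H ! j) i)"
      using j(1) by (intro member_le_sum[where f = "\<lambda>j. c j * nthz (H ! j) i"]) auto
    ultimately show ?thesis by (simp only: d(1) mult_1 le_zero_eq)
  next
    case False
    have "H ! j \<in> set H" using j(1) by simp
    then have "length (H ! j) = n + k" unfolding H generators_def set_n_lists by simp
    then show ?thesis using False by (simp add: nthz_eq)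
  qed
  then have "\<forall>a\<in>set (drop n (H ! j)). a = 0"
    by (auto simp: in_set_conv_nth nthz_eq) (metis le_add1 less_diff_conv add.commute)
  then have "sum_list (drop n (H ! j)) = 0" by (simp add: sum_list_eq_0_iff)
  ultimately show ?thesis using j(1) by (intro exI[of _ j]) (simp add: cone_class_def class3_def spread_def)
qed

text \<open>\<open>v\<close> supplies the linear generator. If a free parameter of U or V differs
  from 1, mode 1 applies, with U and V exchanged when that parameter lies in U; this is why the
  lists for both orders appear.\<close>

lemma families_complete:
  assumes lens: "length A = n + length cs" "length B = n + length cs" "length C = n + length cs" "length x = n"
    and cs: "0 \<notin> set cs"
    and v: "length v = n + length cs" "dot A v = dot B v" "dot C v = Suc (dot A v)"
      "\<And>i. n \<le> i \<Longrightarrow> nthz v i = 0"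
    and eq: "monom_at A (x @ cs) + monom_at B (x @ cs) + monom_at C (x @ cs) = 0"
  shows "\<exists>F\<in>set (families n A B C cs) \<union> set (families n B A C cs). x \<in> points F"
proof -
  define H where H: "H = generators (n + length cs) A B C"
  have H': "H = generators (n + length cs) B A C"
    unfolding H generators_def exps_bound_def by (simp add: add.commute)
  have K: "nthz A i \<le> exps_bound A B C" "nthz B i \<le> exps_bound A B C" "nthz C i \<le> exps_bound A B C"
    "exps_bound A B C \<ge> 1" for i
    using sum_list_bound[of A i] sum_list_bound[of B i] sum_list_bound[of C i] by (auto simp: exps_bound_def)
  have len_gen: "length (H ! j) = n + length cs" if "j < length H" for j
    using nth_mem[OF that] unfolding H generators_def set_n_lists by simp
  let ?ka = "\<lambda>u. map (\<lambda>j. if sum_list (drop n (H ! j)) = 0 then 0 else u j) [0..<length H]"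
  have ka_le: "k \<le> nat (\<Sum>c\<leftarrow>cs. \<bar>c\<bar>)"
    if "solution_target n A' B' C' H x cs u mo ja jb q rh ri rs d" "k \<in> set (?ka u)"
    for A' B' C' u mo ja jb q rh ri rs d k
  proof -
    from that(2) obtain j where j: "j < length H" "k = (if sum_list (drop n (H ! j)) = 0 then 0 else u j)"
      unfolding set_map by (elim imageE) simp
    then show ?thesis
      using fixed_generator_bound[OF that(1) j(1) len_gen[OF j(1)] _ cs] by (simp del: sum_list_eq_0_iff)
  qed
  have found: "\<exists>F\<in>set (families n A' B' C' cs). x \<in> points F"
    if "d \<in> set (all_dats n A' B' C' cs)" "valid_dat n cs d" "x \<in> points (dat_family n d)" for A' B' C' d
    using that unfolding families_def by auto
  show ?thesis
  proof (cases "monom_at A (x @ cs) = 0 \<or> monom_at B (x @ cs) = 0 \<or> monom_at C (x @ cs) = 0")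
    case True
    obtain u where u: "\<And>ja q rh ri rs d. d = make_dat n A B C H (map sgn (x @ cs)) (?ka u) 2 ja (length H) q rh ri rs \<Longrightarrow>
      solution_target n A B C H x cs u 2 ja (length H) q rh ri rs d \<and> degenerate_family d A B C \<and>
      consistent n cs d \<and> x \<in> points (dat_family n d)"
      using solution_in_mode_2[OF lens K H[unfolded generators_def] eq True] by blast
    define d where "d = make_dat n A B C H (map sgn (x @ cs)) (?ka u) 2 0 (length H) 0 0 0 (replicate (length H) 0)"
    note d = u[OF d_def]
    have "valid_dat n cs d"
      using d by (simp add: valid_dat_def degenerate_family_def d_def make_dat_def nthz_eq)
    moreover have "d \<in> set (all_dats n A B C cs)"
      unfolding d_def
    proof (rule all_dats_memI[OF H lens(4)])
      show "k \<le> nat (\<Sum>c\<leftarrow>cs. \<bar>c\<bar>)" if "k \<in> set (?ka u)" for k using ka_le[OF _ that] d by blast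
    qed auto
    ultimately show ?thesis using found d by blast
  next
    case False
    then have nz: "monom_at A (x @ cs) \<noteq> 0" "monom_at B (x @ cs) \<noteq> 0" "monom_at C (x @ cs) \<noteq> 0" by auto
    have lens': "length A = length (x @ cs)" "length B = length (x @ cs)" "length C = length (x @ cs)" using lens by auto
    have H'': "H = List.n_lists (length (x @ cs)) [0..<Suc (gen_bound (exps_bound A B C))]"
      unfolding H generators_def using lens(4) by simp
    obtain u where u: "decomposes A B C H (x @ cs) u"
      using ex_decomposition[OF lens' K H'' eq nz] by blast
    obtain jb where jb: "jb < length H" "cone_class A B C (H ! jb) = 3"
      "spread (dot A (H ! jb)) (dot B (H ! jb)) (dot C (H ! jb)) = 1" "sum_list (drop n (H ! jb)) = 0"
      using ex_linear_generator[OF lens(1-3) v H] by blast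
    have mode_1: "\<exists>F\<in>set (families n A' B' C cs). x \<in> points F"
      if dec: "decomposes A' B' C H (x @ cs) u" and lens1: "length A' = n + length cs" "length B' = n + length cs"
        and eq1: "monom_at A' (x @ cs) + monom_at B' (x @ cs) + monom_at C (x @ cs) = 0"
        and nz1: "monom_at A' (x @ cs) \<noteq> 0" "monom_at B' (x @ cs) \<noteq> 0"
        and jb1: "cone_class A' B' C (H ! jb) = 3" "spread (dot A' (H ! jb)) (dot B' (H ! jb)) (dot C (H ! jb)) = 1"
        and ja: "ja < length H" "cone_class A' B' C (H ! ja) = 2" "sum_list (drop n (H ! ja)) = 0" "u ja \<noteq> 1"
        and H1: "H = generators (n + length cs) A' B' C" for A' B' ja
    proof -
      define q where "q = base_modulus n A' B' C H (?ka u)"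
      obtain rh ri rs where r: "rh \<le> 3 * q ^ 2" "ri \<le> q" "length rs = length H" "\<forall>r\<in>set rs. r \<le> q"
        "main_family (make_dat n A' B' C H (map sgn (x @ cs)) (?ka u) 1 ja jb q rh ri rs)"
        "consistent n cs (make_dat n A' B' C H (map sgn (x @ cs)) (?ka u) 1 ja jb q rh ri rs)"
        "x \<in> points (dat_family n (make_dat n A' B' C H (map sgn (x @ cs)) (?ka u) 1 ja jb q rh ri rs))"
        using solution_in_mode_1[OF dec lens1 lens(3,4) eq1 nz1 nz(3) jb(1) jb1 jb(4) ja refl q_def] by blast
      define d where "d = make_dat n A' B' C H (map sgn (x @ cs)) (?ka u) 1 ja jb q rh ri rs"
      have st: "solution_target n A' B' C H x cs u 1 ja jb q rh ri rs d"
        by (rule decomposes_target[OF dec lens1 lens(3,4) _ d_def]) simp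
      have "md d = 1" by (simp add: d_def make_dat_def)
      then have "valid_dat n cs d" using r(5,6) by (simp add: valid_dat_def d_def)
      moreover have "d \<in> set (all_dats n A' B' C cs)"
        unfolding d_def
      proof (rule all_dats_memI[OF H1 lens(4)])
        show "k \<le> nat (\<Sum>c\<leftarrow>cs. \<bar>c\<bar>)" if "k \<in> set (?ka u)" for k using ka_le[OF st that] .
      qed (use r(1-4) ja(1) jb(1) q_def in auto)
      moreover have "x \<in> points (dat_family n d)" using r(7) by (simp add: d_def)
      ultimately show ?thesis using found by blast
    qed
    consider ja where "ja < length H" "cone_class A B C (H ! ja) = 2" "sum_list (drop n (H ! ja)) = 0" "u ja \<noteq> 1"
      | ja where "ja < length H" "cone_class A B C (H ! ja) = 1" "sum_list (drop n (H ! ja)) = 0" "u ja \<noteq> 1"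
      | "\<And>j. j < length H \<Longrightarrow> cone_class A B C (H ! j) \<in> {1, 2} \<Longrightarrow> sum_list (drop n (H ! j)) = 0 \<Longrightarrow> u j = 1"
      by blast
    then show ?thesis
    proof cases
      case 1
      from mode_1[OF u lens(1,2) eq nz(1,2) jb(2,3) 1 H] show ?thesis by blast
    next
      case 2
      have "cone_class B A C (H ! ja) = 2" using 2(2) by (auto simp: cone_class_def class3_def split: if_splits)
      moreover have "cone_class B A C (H ! jb) = 3" using jb(2) by (auto simp: cone_class_def class3_def split: if_splits)
      moreover have "spread (dot B (H ! jb)) (dot A (H ! jb)) (dot C (H ! jb)) = 1"
        using jb(3) by (simp add: spread_def max.left_commute min.left_commute)
      moreover have "monom_at B (x @ cs) + monom_at A (x @ cs) + monom_at C (x @ cs) = 0" using eq by simp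
      ultimately show ?thesis
        using mode_1[OF decomposes_swap[OF u] lens(2,1) _ nz(2,1) _ _ 2(1) _ 2(3,4) H'] by blast
    next
      case 3
      define d where "d = make_dat n A B C H (map sgn (x @ cs)) (?ka u) 0 0 jb 0 0 0 (replicate (length H) 0)"
      have st: "solution_target n A B C H x cs u 0 0 jb 0 0 0 (replicate (length H) 0) d"
        by (rule decomposes_target[OF u lens _ d_def]) simp
      have ok: "main_family d" "consistent n cs d" "x \<in> points (dat_family n d)"
        using solution_in_mode_0[OF u lens eq nz jb 3 d_def] by auto
      have "md d = 0" by (simp add: d_def make_dat_def)
      then have "valid_dat n cs d" using ok by (simp add: valid_dat_def)
      moreover have "d \<in> set (all_dats n A B C cs)"
        unfolding d_def
      proof (rule all_dats_memI[OF H lens(4)])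
        show "k \<le> nat (\<Sum>c\<leftarrow>cs. \<bar>c\<bar>)" if "k \<in> set (?ka u)" for k using ka_le[OF st that] .
      qed (use jb(1) in auto)
      ultimately show ?thesis using found ok(3) by blast
    qed
  qed
qed

section \<open>From the given equation to three monomials with coefficient 1\<close>

lemma monom_at_append:
  assumes "length A = n" "length x = n"
  shows "monom_at (A @ es) (x @ cs) = (\<Prod>i<n. x ! i ^ (A ! i)) * monom_at es cs"
proof -
  have split: "(\<Prod>i<n + k. f i) = (\<Prod>i<n. f i) * (\<Prod>i<k. f (n + i))" for f :: "nat \<Rightarrow> int" and k
    by (induction k) (simp_all add: mult.assoc)
  have "(\<Prod>i<n. nthz (x @ cs) i ^ nthz (A @ es) i) = (\<Prod>i<n. x ! i ^ (A ! i))"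
    using assms by (intro prod.cong) (auto simp: nthz_eq nth_append)
  moreover have "nthz (x @ cs) (n + i) = nthz cs i" "nthz (A @ es) (n + i) = nthz es i" for i
    using assms by (auto simp: nthz_eq nth_append)
  ultimately show ?thesis unfolding monom_at_def length_append assms(1) split by simp
qed

lemma dot_append:
  assumes "length A = n" "length w = n"
  shows "dot (A @ es) (w @ zs) = (\<Sum>i<n. A ! i * w ! i) + dot es zs"
proof -
  have split: "(\<Sum>i<n + k. f i) = (\<Sum>i<n. f i) + (\<Sum>i<k. f (n + i))" for f :: "nat \<Rightarrow> nat" and k
    by (induction k) (simp_all add: add.assoc)
  have "(\<Sum>i<n. nthz (A @ es) i * nthz (w @ zs) i) = (\<Sum>i<n. A ! i * w ! i)"
    using assms by (intro sum.cong) (auto simp: nthz_eq nth_append)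
  moreover have "nthz (w @ zs) (n + i) = nthz zs i" "nthz (A @ es) (n + i) = nthz es i" for i
    using assms by (auto simp: nthz_eq nth_append)
  ultimately show ?thesis unfolding dot_def length_append assms(1) split by simp
qed

lemma mem_solutions_iff:
  assumes "length \<alpha> = n" "length \<beta> = n" "length \<gamma> = n"
  shows "x \<in> solutions n a b c \<alpha> \<beta> \<gamma> \<longleftrightarrow> length x = n \<and>
    monom_at (\<alpha> @ [1, 0, 0]) (x @ [a, b, - c]) + monom_at (\<beta> @ [0, 1, 0]) (x @ [a, b, - c]) +
    monom_at (\<gamma> @ [0, 0, 1]) (x @ [a, b, - c]) = 0"
proof -
  have "monom_at [1, 0, 0] [a, b, - c] = a" "monom_at [0, 1, 0] [a, b, - c] = b" "monom_at [0, 0, 1] [a, b, - c] = - c"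
    by (simp_all add: monom_at_def nthz_def)
  then show ?thesis
    using assms by (auto simp: solutions_def monom_at_append algebra_simps)
qed

text \<open>The solution is extended by 0 to the constant coordinates, so the exponents appended
  there do not change the scalar products.\<close>

lemma system_solvable_nat:
  assumes "system_solvable n \<alpha> \<beta> \<gamma>" "length \<alpha> = n" "length \<beta> = n" "length \<gamma> = n"
    and "length es = 3" "length fs = 3" "length gs = 3"
  obtains v where "length v = n + 3" "dot (\<alpha> @ es) v = dot (\<beta> @ fs) v" "dot (\<gamma> @ gs) v = Suc (dot (\<alpha> @ es) v)"
    "\<And>i. n \<le> i \<Longrightarrow> nthz v i = 0"
proof -
  from assms(1) obtain z :: "nat \<Rightarrow> int" where z: "\<forall>i<n. z i \<ge> 0"
    "(\<Sum>i<n. int (\<alpha> ! i) * z i) = (\<Sum>i<n. int (\<beta> ! i) * z i)"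
    "(\<Sum>i<n. int (\<beta> ! i) * z i) = (\<Sum>i<n. int (\<gamma> ! i) * z i) - 1"
    unfolding system_solvable_def by blast
  define w where "w = map (\<lambda>i. nat (z i)) [0..<n]"
  have w: "length w = n" by (simp add: w_def)
  have int_dot: "int (dot (A @ ds) (w @ [0, 0, 0])) = (\<Sum>i<n. int (A ! i) * z i)"
    if "length A = n" for A ds
  proof -
    have "dot ds [0, 0, 0] = 0" unfolding dot_def by (intro sum.neutral) (auto simp: nthz_eq nth_Cons')
    then show ?thesis
      using z(1) that w by (simp add: dot_append w_def)
  qed
  show ?thesis
  proof (rule that)
    show "length (w @ [0, 0, 0]) = n + 3" using w by simp
    show "dot (\<alpha> @ es) (w @ [0, 0, 0]) = dot (\<beta> @ fs) (w @ [0, 0, 0])"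
      using int_dot[OF assms(2), of es] int_dot[OF assms(3), of fs] z(2) by linarith
    show "dot (\<gamma> @ gs) (w @ [0, 0, 0]) = Suc (dot (\<alpha> @ es) (w @ [0, 0, 0]))"
      using int_dot[OF assms(2), of es] int_dot[OF assms(4), of gs] z(2,3) by linarith
    show "nthz (w @ [0, 0, 0]) i = 0" if "n \<le> i" for i
      using that w by (auto simp: nthz_eq nth_append nth_Cons')
  qed
qed

lemma describes_description:
  assumes lens: "length \<alpha> = n" "length \<beta> = n" "length \<gamma> = n" and nz: "a \<noteq> 0" "b \<noteq> 0" "c \<noteq> 0"
    and solvable: "solvable_in_some_form n \<alpha> \<beta> \<gamma>"
  shows "describes (description n a b c \<alpha> \<beta> \<gamma>) (solutions n a b c \<alpha> \<beta> \<gamma>)"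
proof -
  define cs where "cs = [a, b, - c]"
  define A where "A = \<alpha> @ [1, 0, 0]"
  define B where "B = \<beta> @ [0, 1, 0]"
  define C where "C = \<gamma> @ [0, 0, 1]"
  have len: "length A = n + length cs" "length B = n + length cs" "length C = n + length cs"
    using lens by (simp_all add: A_def B_def C_def cs_def)
  have cs: "0 \<notin> set cs" "length cs = 3" using nz by (auto simp: cs_def)
  let ?Fs = "description n a b c \<alpha> \<beta> \<gamma>"
  have Fs: "set ?Fs = set (families n A B C cs) \<union> set (families n B A C cs) \<union> set (families n A C B cs) \<union>
      set (families n C A B cs) \<union> set (families n C B A cs) \<union> set (families n B C A cs)"
    unfolding description_def Let_def A_def B_def C_def cs_def by (simp add: Un_assoc)
  have sol: "x \<in> solutions n a b c \<alpha> \<beta> \<gamma> \<longleftrightarrow>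
      length x = n \<and> monom_at A (x @ cs) + monom_at B (x @ cs) + monom_at C (x @ cs) = 0" for x
    unfolding mem_solutions_iff[OF lens] A_def B_def C_def cs_def ..
  have sound: "integer_valued F \<and> points F \<subseteq> solutions n a b c \<alpha> \<beta> \<gamma>" if "F \<in> set ?Fs" for F
  proof -
    from that consider "F \<in> set (families n A B C cs)" | "F \<in> set (families n B A C cs)"
      | "F \<in> set (families n A C B cs)" | "F \<in> set (families n C A B cs)"
      | "F \<in> set (families n C B A cs)" | "F \<in> set (families n B C A cs)"
      unfolding Fs by blast
    then show ?thesis
    proof cases
      case 1 from families_sound[OF len(1,2,3) this] show ?thesis unfolding subset_iff sol by auto
    next
      case 2 from families_sound[OF len(2,1,3) this] show ?thesis unfolding subset_iff sol by (auto simp: ac_simps)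
    next
      case 3 from families_sound[OF len(1,3,2) this] show ?thesis unfolding subset_iff sol by (auto simp: ac_simps)
    next
      case 4 from families_sound[OF len(3,1,2) this] show ?thesis unfolding subset_iff sol by (auto simp: ac_simps)
    next
      case 5 from families_sound[OF len(3,2,1) this] show ?thesis unfolding subset_iff sol by (auto simp: ac_simps)
    next
      case 6 from families_sound[OF len(2,3,1) this] show ?thesis unfolding subset_iff sol by (auto simp: ac_simps)
    qed
  qed
  moreover have "\<exists>F\<in>set ?Fs. x \<in> points F" if x: "x \<in> solutions n a b c \<alpha> \<beta> \<gamma>" for x
  proof -
    have x: "length x = n" "monom_at A (x @ cs) + monom_at B (x @ cs) + monom_at C (x @ cs) = 0"
      "monom_at A (x @ cs) + monom_at C (x @ cs) + monom_at B (x @ cs) = 0"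
      "monom_at C (x @ cs) + monom_at B (x @ cs) + monom_at A (x @ cs) = 0"
      using x unfolding sol by auto
    have three: "length [1, 0, 0 :: nat] = 3" "length [0, 1, 0 :: nat] = 3" "length [0, 0, 1 :: nat] = 3" by simp_all
    from solvable consider "system_solvable n \<alpha> \<beta> \<gamma>" | "system_solvable n \<alpha> \<gamma> \<beta>" | "system_solvable n \<gamma> \<beta> \<alpha>"
      unfolding solvable_in_some_form_def by blast
    then show ?thesis
    proof cases
      case 1
      from system_solvable_nat[OF this lens(1,2,3) three(1,2,3)] obtain v where
        "length v = n + length cs" "dot A v = dot B v" "dot C v = Suc (dot A v)" "\<And>i. n \<le> i \<Longrightarrow> nthz v i = 0"
        unfolding A_def[symmetric] B_def[symmetric] C_def[symmetric] cs(2)[symmetric] by blast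
      from families_complete[OF len(1,2,3) x(1) cs(1) this x(2)] show ?thesis unfolding Fs by blast
    next
      case 2
      from system_solvable_nat[OF this lens(1,3,2) three(1,3,2)] obtain v where
        "length v = n + length cs" "dot A v = dot C v" "dot B v = Suc (dot A v)" "\<And>i. n \<le> i \<Longrightarrow> nthz v i = 0"
        unfolding A_def[symmetric] B_def[symmetric] C_def[symmetric] cs(2)[symmetric] by blast
      from families_complete[OF len(1,3,2) x(1) cs(1) this x(3)] show ?thesis unfolding Fs by blast
    next
      case 3
      from system_solvable_nat[OF this lens(3,2,1) three(3,2,1)] obtain v where
        "length v = n + length cs" "dot C v = dot B v" "dot A v = Suc (dot C v)" "\<And>i. n \<le> i \<Longrightarrow> nthz v i = 0"
        unfolding A_def[symmetric] B_def[symmetric] C_def[symmetric] cs(2)[symmetric] by blast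
      from families_complete[OF len(3,2,1) x(1) cs(1) this x(4)] show ?thesis unfolding Fs by blast
    qed
  qed
  ultimately show ?thesis unfolding describes_def by blast
qed

theorem proposition3p5:
  shows "\<exists>algorithm :: recf. \<forall>(n :: nat) (a :: int) (b :: int) (c :: int)
      (\<alpha> :: nat list) (\<beta> :: nat list) (\<gamma> :: nat list).
    length \<alpha> = n \<longrightarrow> length \<beta> = n \<longrightarrow> length \<gamma> = n \<longrightarrow>
    a \<noteq> 0 \<longrightarrow> b \<noteq> 0 \<longrightarrow> c \<noteq> 0 \<longrightarrow>
    solvable_in_some_form n \<alpha> \<beta> \<gamma> \<longrightarrow>
    (\<exists>Fs :: family list.
       computes algorithm
         [n, int_encode a, int_encode b, int_encode c, list_encode \<alpha>, list_encode \<beta>, list_encode \<gamma>]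
         (encode_description Fs) \<and>
       describes Fs (solutions n a b c \<alpha> \<beta> \<gamma>))"
proof -
  obtain algorithm where "\<And>n a b c \<alpha> \<beta> \<gamma>. computes algorithm
      [n, int_encode a, int_encode b, int_encode c, list_encode \<alpha>, list_encode \<beta>, list_encode \<gamma>]
      (encode_description (description n a b c \<alpha> \<beta> \<gamma>))"
    using program_for_description by blast
  then show ?thesis
    using describes_description by (intro exI[of _ algorithm] allI impI) blast
qed

end
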